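(* Let $n$ be the smallest integer such that there exists a pair of graphs on $n$ vertices which are quantum isomorphic but not isomorphic. Let $(G,H)$ be a pair of quantum isomorphic graphs on $n$ vertices. Then one of the following holds: (1) $G$ and $H$ are isomorphic; (2) $G$ and $H$ are connected, and there exist a colour-preserving graph isomorphism $\alpha:\mathcal T(G)\to\mathcal T(H)$ of block trees and a graph isomorphism $\beta:\mathcal B(G)\to\mathcal B(H)$ of block graphs such that for every block $b$ of $G$ the blocks $b$, $\alpha(b)$ and $\beta(b)$ are (classically) isomorphic graphs; (3) $G$ and $H$ are 2-connected. Moreover, the same statement holds for the pair of complements $(G^c,H^c)$ in place of $(G,H)$.
   Context: All graphs are finite and simple. $\mathrm{Adj}(G)$ is the adjacency matrix, $G^c$ is the complement graph. Quantum isomorphism: a magic unitary with coefficients in a (nonzero) unital $C^*$-algebra $X$ is a matrix $U=(u_{ij})_{i\in I,j\in J}$ with $I,J$ finite, $u_{ij}=u_{ij}^2=u_{ij}^*\in X$, and $\sum_{k\in I}u_{kj}=1=\sum_{k\in J}u_{ik}$ for all $i\in I,j\in J$. A quantum isomorphism from a graph $G$ to a graph $H$ with the same number of vertices is a magic unitary $U$ indexed by $V(H)\times V(G)$ with $U\,\mathrm{Adj}(G)=\mathrm{Adj}(H)\,U$. $G$ and $H$ are quantum isomorphic if such a $U$ exists over some nonzero unital $C^*$-algebra. (It is known that pairs of quantum isomorphic non-isomorphic graphs exist, so $n$ is well defined.) Blocks: if $G$ has at least two vertices, a cut vertex of $G$ is a vertex $v$ such that $G\setminus\{v\}$ has strictly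 more connected components than $G$; for a graph on one vertex, its only vertex is by convention a cut vertex. A graph is 2-connected if it is connected and for every vertex $v$ the graph $G\setminus\{v\}$ is connected and nonempty (so $K_2$ is 2-connected and $K_1$ is not). A block of $G$ is a maximal 2-connected subgraph of $G$, also identified with its vertex set. The block tree $\mathcal T(G)$ has vertex set the disjoint union of the set of blocks of $G$ and the set of cut vertices of $G$, with an edge between a cut vertex $c$ and a block $b$ iff $c\in b$; it is 2-coloured: blocks are white, cut vertices are black. The block graph $\mathcal B(G)$ has as vertices the blocks of $G$, two distinct blocks being adjacent iff they intersect. *)

theory Defs
  imports
    "HOL-Analysis.Analysis"
    "HOL-Algebra.Algebraic_Closure_Type"
    "Graph_Theory.Graph_Theory"
begin

section \<open>Unital C*-algebras\<close>

text \<open>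
  Quantum isomorphism quantifies existentially over C*-algebras inside a formula, so C*-algebras
  are carrier based, on top of the HOL-Algebra records, instead of being a type class.
\<close>

record 'x star_algebra = "(complex, 'x) module" +
  star :: "'x \<Rightarrow> 'x"
  nrm :: "'x \<Rightarrow> real"

abbreviation complex_ring :: "complex ring" where
  "complex_ring \<equiv> ring_of_type_algebra"

locale unital_cstar_algebra =
  module complex_ring A + ring A for A :: "'x star_algebra" (structure) +
  assumes smult_mult_left:
      "\<lbrakk>x \<in> carrier A; y \<in> carrier A\<rbrakk> \<Longrightarrow> (c \<odot> x) \<otimes> y = c \<odot> (x \<otimes> y)"
    and smult_mult_right:
      "\<lbrakk>x \<in> carrier A; y \<in> carrier A\<rbrakk> \<Longrightarrow> x \<otimes> (c \<odot> y) = c \<odot> (x \<otimes> y)"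
    and star_closed: "x \<in> carrier A \<Longrightarrow> star A x \<in> carrier A"
    and star_star: "x \<in> carrier A \<Longrightarrow> star A (star A x) = x"
    and star_add:
      "\<lbrakk>x \<in> carrier A; y \<in> carrier A\<rbrakk> \<Longrightarrow> star A (x \<oplus> y) = star A x \<oplus> star A y"
    and star_smult: "x \<in> carrier A \<Longrightarrow> star A (c \<odot> x) = cnj c \<odot> star A x"
    and star_mult:
      "\<lbrakk>x \<in> carrier A; y \<in> carrier A\<rbrakk> \<Longrightarrow> star A (x \<otimes> y) = star A y \<otimes> star A x"
    and nrm_nonneg: "x \<in> carrier A \<Longrightarrow> 0 \<le> nrm A x"
    and nrm_eq_0_iff: "x \<in> carrier A \<Longrightarrow> nrm A x = 0 \<longleftrightarrow> x = \<zero>"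
    and nrm_triangle:
      "\<lbrakk>x \<in> carrier A; y \<in> carrier A\<rbrakk> \<Longrightarrow> nrm A (x \<oplus> y) \<le> nrm A x + nrm A y"
    and nrm_smult: "x \<in> carrier A \<Longrightarrow> nrm A (c \<odot> x) = cmod c * nrm A x"
    and nrm_mult:
      "\<lbrakk>x \<in> carrier A; y \<in> carrier A\<rbrakk> \<Longrightarrow> nrm A (x \<otimes> y) \<le> nrm A x * nrm A y"
    and cstar_identity: "x \<in> carrier A \<Longrightarrow> nrm A (star A x \<otimes> x) = (nrm A x)\<^sup>2"
    and complete:
      "\<lbrakk>\<And>n. s n \<in> carrier A; \<And>e. 0 < e \<Longrightarrow> \<exists>N::nat. \<forall>m\<ge>N. \<forall>n\<ge>N. nrm A (s m \<ominus> s n) < e\<rbrakk>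
       \<Longrightarrow> \<exists>x\<in>carrier A. (\<lambda>n. nrm A (s n \<ominus> x)) \<longlonglongrightarrow> 0"


section \<open>Finite simple graphs\<close>

text \<open>
  A finite simple graph is a \<open>pair_graph\<close>: finite vertex set and a symmetric irreflexive set of
  pairs of vertices, each edge being present as two arcs.
\<close>

definition graph_isomorphism ::
    "('a \<Rightarrow> 'b) \<Rightarrow> 'a pair_pre_digraph \<Rightarrow> 'b pair_pre_digraph \<Rightarrow> bool" where
  "graph_isomorphism f G H \<longleftrightarrow> bij_betw f (pverts G) (pverts H) \<and>
     (\<forall>u\<in>pverts G. \<forall>v\<in>pverts G. (u, v) \<in> parcs G \<longleftrightarrow> (f u, f v) \<in> parcs H)"

definition isomorphic :: "'a pair_pre_digraph \<Rightarrow> 'b pair_pre_digraph \<Rightarrow> bool" where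
  "isomorphic G H \<longleftrightarrow> (\<exists>f. graph_isomorphism f G H)"

definition complement_graph :: "'a pair_pre_digraph \<Rightarrow> 'a pair_pre_digraph" where
  "complement_graph G = \<lparr> pverts = pverts G,
     parcs = {(u, v). u \<in> pverts G \<and> v \<in> pverts G \<and> u \<noteq> v \<and> (u, v) \<notin> parcs G} \<rparr>"

definition adjacency :: "'a pair_pre_digraph \<Rightarrow> 'a \<Rightarrow> 'a \<Rightarrow> complex" where
  "adjacency G u v = (if (u, v) \<in> parcs G then 1 else 0)"


section \<open>Quantum isomorphism\<close>

definition magic_unitary ::
    "'x star_algebra \<Rightarrow> 'i set \<Rightarrow> 'j set \<Rightarrow> ('i \<Rightarrow> 'j \<Rightarrow> 'x) \<Rightarrow> bool" where
  "magic_unitary A I J U \<longleftrightarrow> finite I \<and> finite J \<and>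
     (\<forall>i\<in>I. \<forall>j\<in>J. U i j \<in> carrier A \<and> U i j \<otimes>\<^bsub>A\<^esub> U i j = U i j \<and> star A (U i j) = U i j) \<and>
     (\<forall>j\<in>J. (\<Oplus>\<^bsub>A\<^esub>k\<in>I. U k j) = \<one>\<^bsub>A\<^esub>) \<and>
     (\<forall>i\<in>I. (\<Oplus>\<^bsub>A\<^esub>k\<in>J. U i k) = \<one>\<^bsub>A\<^esub>)"

text \<open>
  The last clause is the matrix identity \<open>U Adj(G) = Adj(H) U\<close>, entry by entry.
\<close>

definition quantum_isomorphism ::
    "'x star_algebra \<Rightarrow> 'a pair_pre_digraph \<Rightarrow> 'b pair_pre_digraph \<Rightarrow> ('b \<Rightarrow> 'a \<Rightarrow> 'x) \<Rightarrow> bool"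
  where
  "quantum_isomorphism A G H U \<longleftrightarrow>
     card (pverts G) = card (pverts H) \<and> magic_unitary A (pverts H) (pverts G) U \<and>
     (\<forall>i\<in>pverts H. \<forall>j\<in>pverts G.
        (\<Oplus>\<^bsub>A\<^esub>k\<in>pverts G. adjacency G k j \<odot>\<^bsub>A\<^esub> U i k) =
        (\<Oplus>\<^bsub>A\<^esub>k\<in>pverts H. adjacency H i k \<odot>\<^bsub>A\<^esub> U k j))"

text \<open>
  HOL cannot quantify over the type of elements of \<open>A\<close> inside a formula, so the carrier is taken
  to be a set of reals, used only as a set of cardinality continuum. Nothing is lost: lemma
  \<open>quantum_isomorphicI\<close> below shows that a quantum isomorphism over a nonzero unital C*-algebra
  of any type whatsoever makes the graphs \<open>quantum_isomorphic\<close>.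
\<close>

definition quantum_isomorphic :: "'a pair_pre_digraph \<Rightarrow> 'b pair_pre_digraph \<Rightarrow> bool" where
  "quantum_isomorphic G H \<longleftrightarrow>
     (\<exists>(A :: real star_algebra) U.
        unital_cstar_algebra A \<and> \<one>\<^bsub>A\<^esub> \<noteq> \<zero>\<^bsub>A\<^esub> \<and> quantum_isomorphism A G H U)"

text \<open>
  For the same reason the graphs quantified over here have vertices in \<open>nat\<close>; by lemma
  \<open>smallest_quantum_pair_le\<close> below, graphs on any other vertex types give the same \<open>n\<close>.
\<close>

definition quantum_pair_of_order :: "nat \<Rightarrow> bool" where
  "quantum_pair_of_order n \<longleftrightarrow>
     (\<exists>(G :: nat pair_pre_digraph) (H :: nat pair_pre_digraph). pair_graph G \<and> pair_graph H \<and>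
        card (pverts G) = n \<and> card (pverts H) = n \<and>
        quantum_isomorphic G H \<and> \<not> isomorphic G H)"

definition smallest_quantum_pair_order :: "nat \<Rightarrow> bool" where
  "smallest_quantum_pair_order n \<longleftrightarrow>
     quantum_pair_of_order n \<and> (\<forall>m. quantum_pair_of_order m \<longrightarrow> n \<le> m)"


section \<open>Blocks, block trees and block graphs\<close>

text \<open>
  Connectedness is that of the graph library, where the graph without vertices is not connected,
  and for symmetric graphs the strongly connected components \<open>sccs\<close> are the connected components.
\<close>

definition graph_connected :: "'a pair_pre_digraph \<Rightarrow> bool" where
  "graph_connected G \<longleftrightarrow> Digraph_Component.connected (with_proj G)"

definition delete_vertex :: "'a pair_pre_digraph \<Rightarrow> 'a \<Rightarrow> 'a pair_pre_digraph" where
  "delete_vertex G v = \<lparr> pverts = pverts G - {v},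
     parcs = {e \<in> parcs G. fst e \<noteq> v \<and> snd e \<noteq> v} \<rparr>"

definition num_components :: "'a pair_pre_digraph \<Rightarrow> nat" where
  "num_components G = card (pre_digraph.sccs (with_proj G))"

definition cut_vertices :: "'a pair_pre_digraph \<Rightarrow> 'a set" where
  "cut_vertices G = {v \<in> pverts G. card (pverts G) = 1 \<or>
     num_components G < num_components (delete_vertex G v)}"

definition two_connected :: "'a pair_pre_digraph \<Rightarrow> bool" where
  "two_connected G \<longleftrightarrow> graph_connected G \<and>
     (\<forall>v\<in>pverts G. graph_connected (delete_vertex G v) \<and> pverts (delete_vertex G v) \<noteq> {})"

definition blocks :: "'a pair_pre_digraph \<Rightarrow> 'a pair_pre_digraph set" where
  "blocks G = {B. pair_graph B \<and> subgraph (with_proj B) (with_proj G) \<and> two_connected B \<and>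
     (\<forall>B'. pair_graph B' \<and> subgraph (with_proj B') (with_proj G) \<and> two_connected B' \<and>
        subgraph (with_proj B) (with_proj B') \<longrightarrow> B' = B)}"

datatype ('b, 'c) block_tree_vertex = is_white: White (the_block: 'b) | Black 'c

definition block_tree ::
    "'a pair_pre_digraph \<Rightarrow> ('a pair_pre_digraph, 'a) block_tree_vertex pair_pre_digraph" where
  "block_tree G = \<lparr> pverts = White ` blocks G \<union> Black ` cut_vertices G,
     parcs = (\<Union>b\<in>blocks G. \<Union>c\<in>{c \<in> cut_vertices G. c \<in> pverts b}.
       {(White b, Black c), (Black c, White b)}) \<rparr>"

definition block_tree_isomorphism ::
    "(('a pair_pre_digraph, 'a) block_tree_vertex \<Rightarrow> ('b pair_pre_digraph, 'b) block_tree_vertex)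
     \<Rightarrow> 'a pair_pre_digraph \<Rightarrow> 'b pair_pre_digraph \<Rightarrow> bool" where
  "block_tree_isomorphism \<alpha> G H \<longleftrightarrow> graph_isomorphism \<alpha> (block_tree G) (block_tree H) \<and>
     (\<forall>x\<in>pverts (block_tree G). is_white (\<alpha> x) \<longleftrightarrow> is_white x)"

definition block_graph :: "'a pair_pre_digraph \<Rightarrow> 'a pair_pre_digraph pair_pre_digraph" where
  "block_graph G = \<lparr> pverts = blocks G,
     parcs = {(b, b'). b \<in> blocks G \<and> b' \<in> blocks G \<and> b \<noteq> b' \<and> pverts b \<inter> pverts b' \<noteq> {}} \<rparr>"

definition same_block_structure :: "'a pair_pre_digraph \<Rightarrow> 'b pair_pre_digraph \<Rightarrow> bool" where
  "same_block_structure G H \<longleftrightarrow> (\<exists>\<alpha> \<beta>. block_tree_isomorphism \<alpha> G H \<and>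
     graph_isomorphism \<beta> (block_graph G) (block_graph H) \<and>
     (\<forall>b\<in>blocks G. isomorphic b (the_block (\<alpha> (White b))) \<and> isomorphic b (\<beta> b) \<and>
        isomorphic (the_block (\<alpha> (White b))) (\<beta> b)))"

text \<open>Agreement with the notions of the graph library.\<close>

lemma with_proj_delete_vertex:
  "with_proj (delete_vertex G v) = pre_digraph.del_vert (with_proj G) v"
  by (simp add: with_proj_def delete_vertex_def pre_digraph.del_vert_def)

lemma isomorphic_iff_digraph_iso:
  assumes G: "pair_graph G" and H: "pair_graph H"
  shows "isomorphic G H \<longleftrightarrow> digraph_iso (with_proj G) (with_proj H)"
proof -
  interpret G: pair_graph G by fact
  interpret H: pair_graph H by fact
  show ?thesis
  proof
    assume "isomorphic G H"
    then obtain f where f: "bij_betw f (pverts G) (pverts H)"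
      "\<And>u v. u \<in> pverts G \<Longrightarrow> v \<in> pverts G \<Longrightarrow> (u, v) \<in> parcs G \<longleftrightarrow> (f u, f v) \<in> parcs H"
      by (auto simp: isomorphic_def graph_isomorphism_def)
    define h where "h = \<lparr> iso_verts = f, iso_arcs = map_prod f f, iso_head = snd, iso_tail = fst \<rparr>"
    have inj: "inj_on f (pverts G)" using f(1) by (simp add: bij_betw_def)
    have "inj_on (map_prod f f) (parcs G)"
      by (rule inj_on_subset[OF map_prod_inj_on[OF inj inj]]) (auto dest: G.in_arcsD1 G.in_arcsD2)
    then have "pre_digraph.digraph_isomorphism (with_proj G) h"
      using inj G.wf_digraph by (auto simp: pre_digraph.digraph_isomorphism_def h_def)
    moreover have "map_prod f f ` parcs G = parcs H"
    proof (intro equalityI subsetI)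
      fix e assume "e \<in> map_prod f f ` parcs G"
      then obtain u v where "(u, v) \<in> parcs G" "e = (f u, f v)" by auto
      then show "e \<in> parcs H" using f(2)[of u v] G.in_arcsD1[of u v] G.in_arcsD2[of u v] by simp
    next
      fix e assume e: "e \<in> parcs H"
      obtain x y where xy: "e = (x, y)" by (cases e)
      then obtain u v where "u \<in> pverts G" "v \<in> pverts G" "x = f u" "y = f v"
        using e H.in_arcsD1[of x y] H.in_arcsD2[of x y] bij_betw_imp_surj_on[OF f(1)] by blast
      then have "(u, v) \<in> parcs G" "e = map_prod f f (u, v)" using f(2)[of u v] e xy by simp_all
      then show "e \<in> map_prod f f ` parcs G" by (rule rev_image_eqI)
    qed
    then have "with_proj H = app_iso h (with_proj G)"
      using f(1) by (simp add: app_iso_def h_def with_proj_def bij_betw_def)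
    ultimately show "digraph_iso (with_proj G) (with_proj H)" by (auto simp: digraph_iso_def)
  next
    assume "digraph_iso (with_proj G) (with_proj H)"
    then obtain h where h: "pre_digraph.digraph_isomorphism (with_proj G) h"
      and eq: "with_proj H = app_iso h (with_proj G)" by (auto simp: digraph_iso_def)
    have H': "pverts H = iso_verts h ` pverts G" "parcs H = iso_arcs h ` parcs G"
      "iso_tail h = fst" "iso_head h = snd"
      using eq by (simp_all add: app_iso_def with_proj_def)
    have inj: "inj_on (iso_verts h) (pverts G)"
      using h by (simp add: pre_digraph.digraph_isomorphism_def)
    have arc: "iso_arcs h (u, v) = (iso_verts h u, iso_verts h v)" if "(u, v) \<in> parcs G" for u v
    proof -
      have "iso_verts h (fst (u, v)) = iso_tail h (iso_arcs h (u, v)) \<and>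
          iso_verts h (snd (u, v)) = iso_head h (iso_arcs h (u, v))"
        using h that unfolding pre_digraph.digraph_isomorphism_def with_proj_simps by blast
      then show ?thesis using H'(3,4) by (simp add: prod_eq_iff)
    qed
    have "(u, v) \<in> parcs G \<longleftrightarrow> (iso_verts h u, iso_verts h v) \<in> parcs H"
      if "u \<in> pverts G" "v \<in> pverts G" for u v
    proof
      assume "(iso_verts h u, iso_verts h v) \<in> parcs H"
      then obtain a b where ab: "(a, b) \<in> parcs G" "iso_arcs h (a, b) = (iso_verts h u, iso_verts h v)"
        unfolding H'(2) by (metis imageE surj_pair)
      have "a = u" "b = v"
        using arc[OF ab(1)] ab(2) inj_on_eq_iff[OF inj G.in_arcsD1[OF ab(1)] that(1)]
          inj_on_eq_iff[OF inj G.in_arcsD2[OF ab(1)] that(2)] by simp_all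
      then show "(u, v) \<in> parcs G" using ab(1) by simp
    next
      assume uv: "(u, v) \<in> parcs G"
      then show "(iso_verts h u, iso_verts h v) \<in> parcs H"
        unfolding H'(2) arc[OF uv, symmetric] by (rule imageI)
    qed
    then show "isomorphic G H"
      using inj H'(1) unfolding isomorphic_def graph_isomorphism_def bij_betw_def by blast
  qed
qed


section \<open>Independence of the types chosen for algebras and graphs\<close>

text \<open>
  The C*-subalgebra generated by the finitely many entries of a magic unitary is separable, hence
  has at most continuum many elements and embeds as a set into the reals.
\<close>

definition transport_cstar :: "'x star_algebra \<Rightarrow> 'x set \<Rightarrow> ('x \<Rightarrow> 'y) \<Rightarrow> 'y star_algebra" where
  "transport_cstar A C f = (let g = inv_into C f in
     \<lparr> carrier = f ` C, mult = (\<lambda>u v. f (g u \<otimes>\<^bsub>A\<^esub> g v)), one = f \<one>\<^bsub>A\<^esub>,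
       zero = f \<zero>\<^bsub>A\<^esub>, add = (\<lambda>u v. f (g u \<oplus>\<^bsub>A\<^esub> g v)),
       smult = (\<lambda>c u. f (c \<odot>\<^bsub>A\<^esub> g u)), star = (\<lambda>u. f (star A (g u))),
       nrm = (\<lambda>u. nrm A (g u)) \<rparr>)"

lemma complex_ring_simps:
  "carrier complex_ring = UNIV" "c \<otimes>\<^bsub>complex_ring\<^esub> d = c * d" "\<one>\<^bsub>complex_ring\<^esub> = 1"
  "\<zero>\<^bsub>complex_ring\<^esub> = 0" "c \<oplus>\<^bsub>complex_ring\<^esub> d = c + d"
  by (simp_all add: ring_of_type_algebra_def)

locale closed_cstar_subset = unital_cstar_algebra A for A :: "'x star_algebra" (structure) +
  fixes C :: "'x set"
  assumes sub: "C \<subseteq> carrier A"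
    and one_C: "\<one> \<in> C" and zero_C: "\<zero> \<in> C"
    and add_C: "\<And>x y. x \<in> C \<Longrightarrow> y \<in> C \<Longrightarrow> x \<oplus> y \<in> C"
    and mult_C: "\<And>x y. x \<in> C \<Longrightarrow> y \<in> C \<Longrightarrow> x \<otimes> y \<in> C"
    and smult_C: "\<And>c x. x \<in> C \<Longrightarrow> c \<odot> x \<in> C"
    and star_C: "\<And>x. x \<in> C \<Longrightarrow> star A x \<in> C"
    and limit_C: "\<And>s x. (\<And>n. s n \<in> C) \<Longrightarrow> x \<in> carrier A \<Longrightarrow>
           (\<lambda>n. nrm A (s n \<ominus> x)) \<longlonglongrightarrow> 0 \<Longrightarrow> x \<in> C"

context unital_cstar_algebra begin

lemmas smult_laws =
  smult_closed[unfolded complex_ring_simps, OF UNIV_I]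
  smult_l_distr[unfolded complex_ring_simps, OF UNIV_I UNIV_I]
  smult_r_distr[unfolded complex_ring_simps, OF UNIV_I]
  smult_assoc1[unfolded complex_ring_simps, OF UNIV_I UNIV_I]
  smult_one[unfolded complex_ring_simps]

lemma smult_0: "x \<in> carrier A \<Longrightarrow> 0 \<odot> x = \<zero>"
  using smult_laws(2)[of x 0 0] smult_laws(1)[of x 0]
  by (metis add.r_cancel_one' add_0_right)

lemma smult_uminus: "x \<in> carrier A \<Longrightarrow> (-1) \<odot> x = \<ominus> x"
  using smult_laws(2)[of x "-1" 1] smult_laws(1)[of x "-1"] smult_laws(5)[of x] smult_0[of x]
  by (metis add.left_inverse minus_equality)

lemma nrm_uminus: "x \<in> carrier A \<Longrightarrow> nrm A (\<ominus> x) = nrm A x"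
  using nrm_smult[of x "-1"] smult_uminus[of x] by simp

lemma nrm_diff_triangle:
  assumes "x \<in> carrier A" "y \<in> carrier A" "z \<in> carrier A"
  shows "nrm A (x \<ominus> z) \<le> nrm A (x \<ominus> y) + nrm A (y \<ominus> z)"
proof -
  have "x \<ominus> z = (x \<ominus> y) \<oplus> (y \<ominus> z)" using assms by algebra
  then show ?thesis using nrm_triangle[of "x \<ominus> y" "y \<ominus> z"] assms by simp
qed

lemma nrm_diff_commute:
  assumes "x \<in> carrier A" "y \<in> carrier A"
  shows "nrm A (x \<ominus> y) = nrm A (y \<ominus> x)"
proof -
  have "x \<ominus> y = \<ominus> (y \<ominus> x)" using assms by algebra
  then show ?thesis using nrm_uminus[of "y \<ominus> x"] assms by simp
qed

lemma nrm_star_le: assumes "x \<in> carrier A" shows "nrm A x \<le> nrm A (star A x)"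
proof (cases "nrm A x = 0")
  case True
  then show ?thesis using nrm_nonneg[OF star_closed[OF assms]] by simp
next
  case False
  have "nrm A x * nrm A x \<le> nrm A (star A x) * nrm A x"
    using cstar_identity[OF assms] nrm_mult[OF star_closed[OF assms] assms]
    by (simp add: power2_eq_square)
  then show ?thesis using False nrm_nonneg[OF assms] by (simp add: mult_le_cancel_right)
qed

lemma nrm_star: assumes "x \<in> carrier A" shows "nrm A (star A x) = nrm A x"
  using nrm_star_le[OF assms] nrm_star_le[OF star_closed[OF assms]] star_star[OF assms] by simp

lemma star_uminus: "x \<in> carrier A \<Longrightarrow> star A (\<ominus> x) = \<ominus> star A x"
  using star_smult[of x "-1"] by (simp add: smult_uminus star_closed)

end

lemma transport_cstar:
  fixes A :: "'x star_algebra" (structure)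
  assumes C: "closed_cstar_subset A C" and inj: "inj_on f C"
  shows "unital_cstar_algebra (transport_cstar A C f)"
proof -
  interpret closed_cstar_subset A C by fact
  define B where "B = transport_cstar A C f"
  define g where "g = inv_into C f"
  have g[simp]: "g (f x) = x" if "x \<in> C" for x using that inj by (simp add: g_def)
  have B: "carrier B = f ` C" "\<And>u v. u \<otimes>\<^bsub>B\<^esub> v = f (g u \<otimes> g v)" "\<one>\<^bsub>B\<^esub> = f \<one>"
    "\<zero>\<^bsub>B\<^esub> = f \<zero>" "\<And>u v. u \<oplus>\<^bsub>B\<^esub> v = f (g u \<oplus> g v)"
    "\<And>c u. c \<odot>\<^bsub>B\<^esub> u = f (c \<odot> g u)" "\<And>u. star B u = f (star A (g u))"
    "\<And>u. nrm B u = nrm A (g u)"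
    by (simp_all add: B_def transport_cstar_def Let_def g_def)
  note cl[simp] = one_C zero_C add_C mult_C smult_C star_C
  have inA[simp]: "x \<in> carrier A" if "x \<in> C" for x using sub that by blast
  have neg[simp]: "\<ominus> x \<in> C" if "x \<in> C" for x using smult_C[OF that, of "-1"] smult_uminus that by simp
  have ag: "abelian_group B"
  proof (rule abelian_groupI, goal_cases)
    case (6 x)
    then obtain a where a: "a \<in> C" "x = f a" by (auto simp: B)
    then show ?case by (intro bexI[of _ "f (\<ominus> a)"]) (auto simp: B l_neg)
  qed (auto simp: B a_ac)
  interpret B: abelian_group B by fact
  have uminus: "\<ominus>\<^bsub>B\<^esub> f x = f (\<ominus> x)" if "x \<in> C" for x
    by (rule B.minus_equality) (use that in \<open>auto simp: B l_neg\<close>)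
  have minus: "f x \<ominus>\<^bsub>B\<^esub> f y = f (x \<ominus> y)" if "x \<in> C" "y \<in> C" for x y
    using that by (simp add: B.minus_eq minus_eq uminus B(5))
  have mod: "module complex_ring B"
    by (rule moduleI) (auto simp: ag cring_from_type_algebra B complex_ring_simps smult_laws)
  have mon: "monoid B"
    by (rule monoidI) (auto simp: B m_assoc)
  have rng: "ring B"
    by (rule ringI) (auto simp: ag mon B l_distr r_distr)
  have "unital_cstar_algebra B"
  proof (intro unital_cstar_algebra.intro unital_cstar_algebra_axioms.intro mod rng, goal_cases)
    case (9 x)
    then show ?case by (auto simp: B nrm_eq_0_iff dest: inj_onD[OF inj])
  next
    case (14 s)
    define t where "t n = g (s n)" for n
    have t: "t n \<in> C" "s n = f (t n)" for n using 14(1)[of n] by (auto simp: B t_def)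
    have "\<exists>x\<in>carrier A. (\<lambda>n. nrm A (t n \<ominus> x)) \<longlonglongrightarrow> 0"
    proof (rule complete)
      fix e :: real assume "0 < e"
      from 14(2)[OF this] show "\<exists>N. \<forall>m\<ge>N. \<forall>n\<ge>N. nrm A (t m \<ominus> t n) < e"
        using t by (simp add: minus B minus_eq)
    qed (use t in auto)
    then obtain x where x: "x \<in> carrier A" "(\<lambda>n. nrm A (t n \<ominus> x)) \<longlonglongrightarrow> 0" by blast
    then have "x \<in> C" using limit_C t(1) by blast
    then show ?case using x(2) t by (intro bexI[of _ "f x"]) (simp_all add: minus B minus_eq)
  qed (auto simp: B smult_mult_left smult_mult_right star_star star_add star_smult
         star_mult nrm_nonneg nrm_smult cstar_identity intro!: nrm_triangle nrm_mult inA)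
  then show ?thesis by (simp add: B_def)
qed

lemma transport_finsum:
  fixes A :: "'x star_algebra" (structure)
  assumes C: "closed_cstar_subset A C" and inj: "inj_on f C"
    and "finite I" and "\<And>i. i \<in> I \<Longrightarrow> h i \<in> C"
  shows "(\<Oplus>\<^bsub>transport_cstar A C f\<^esub>i\<in>I. f (h i)) = f (\<Oplus>\<^bsub>A\<^esub>i\<in>I. h i) \<and>
    (\<Oplus>\<^bsub>A\<^esub>i\<in>I. h i) \<in> C"
proof -
  interpret closed_cstar_subset A C by fact
  interpret B: unital_cstar_algebra "transport_cstar A C f"
    using transport_cstar[OF C inj] .
  show ?thesis using assms(3,4)
  proof (induction I)
    case empty
    show ?case
      by (simp only: B.finsum_empty finsum_empty) (simp add: zero_C transport_cstar_def Let_def)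
  next
    case (insert i I)
    then have h: "h \<in> I \<rightarrow> carrier A" "h i \<in> carrier A" "h i \<in> C" using sub by auto
    have h': "(\<lambda>i. f (h i)) \<in> I \<rightarrow> carrier (transport_cstar A C f)"
      "f (h i) \<in> carrier (transport_cstar A C f)"
      using insert.prems by (auto simp: transport_cstar_def Let_def)
    have ih: "(\<Oplus>\<^bsub>transport_cstar A C f\<^esub>i\<in>I. f (h i)) = f (\<Oplus>\<^bsub>A\<^esub>i\<in>I. h i)"
      "(\<Oplus>\<^bsub>A\<^esub>i\<in>I. h i) \<in> C"
      using insert by auto
    have "(\<Oplus>\<^bsub>transport_cstar A C f\<^esub>i\<in>insert i I. f (h i)) =
        f (h i) \<oplus>\<^bsub>transport_cstar A C f\<^esub> f (\<Oplus>\<^bsub>A\<^esub>i\<in>I. h i)"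
      using insert.hyps h' ih by (simp add: B.finsum_insert)
    also have "\<dots> = f (h i \<oplus> (\<Oplus>\<^bsub>A\<^esub>i\<in>I. h i))"
      using ih(2) h(3) inj by (simp add: transport_cstar_def Let_def)
    finally show ?case using insert.hyps h ih by (simp add: finsum_insert add_C)
  qed
qed

lemma transport_finsum':
  fixes A :: "'x star_algebra" (structure)
  assumes C: "closed_cstar_subset A C" and inj: "inj_on f C"
    and I: "finite I" "\<And>i. i \<in> I \<Longrightarrow> h i \<in> C" "\<And>i. i \<in> I \<Longrightarrow> h' i = f (h i)"
  shows "(\<Oplus>\<^bsub>transport_cstar A C f\<^esub>i\<in>I. h' i) = f (\<Oplus>\<^bsub>A\<^esub>i\<in>I. h i)"
proof -
  interpret B: unital_cstar_algebra "transport_cstar A C f"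
    using transport_cstar[OF C inj] .
  have "(\<Oplus>\<^bsub>transport_cstar A C f\<^esub>i\<in>I. h' i) = (\<Oplus>\<^bsub>transport_cstar A C f\<^esub>i\<in>I. f (h i))"
    by (rule B.finsum_cong') (use I in \<open>auto simp: transport_cstar_def Let_def\<close>)
  then show ?thesis using transport_finsum[OF C inj I(1,2)] by simp
qed

lemma transport_quantum_isomorphism:
  fixes A :: "'x star_algebra" (structure)
  assumes C: "closed_cstar_subset A C" and inj: "inj_on f C"
    and q: "quantum_isomorphism A G H U"
    and U: "\<And>i j. i \<in> pverts H \<Longrightarrow> j \<in> pverts G \<Longrightarrow> U i j \<in> C"
  shows "quantum_isomorphism (transport_cstar A C f) G H (\<lambda>i j. f (U i j))"
proof -
  interpret closed_cstar_subset A C by fact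
  let ?B = "transport_cstar A C f"
  have fin: "finite (pverts G)" "finite (pverts H)"
    using q by (auto simp: quantum_isomorphism_def magic_unitary_def)
  have [simp]: "inv_into C f (f x) = x" if "x \<in> C" for x using that inj by simp
  have B: "carrier ?B = f ` C" "\<And>x y. x \<in> C \<Longrightarrow> y \<in> C \<Longrightarrow> f x \<otimes>\<^bsub>?B\<^esub> f y = f (x \<otimes> y)"
    "\<And>x. x \<in> C \<Longrightarrow> star ?B (f x) = f (star A x)" "\<one>\<^bsub>?B\<^esub> = f \<one>"
    by (simp_all add: transport_cstar_def Let_def)
  have smB: "c \<odot>\<^bsub>?B\<^esub> f (U i j) = f (c \<odot> U i j)" if "i \<in> pverts H" "j \<in> pverts G" for c i j
    using U[OF that] by (simp add: transport_cstar_def Let_def)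
  note fs = transport_finsum'[OF C inj]
  have "magic_unitary ?B (pverts H) (pverts G) (\<lambda>i j. f (U i j))"
    unfolding magic_unitary_def
  proof (intro conjI ballI)
    fix j assume "j \<in> pverts G"
    then show "(\<Oplus>\<^bsub>?B\<^esub>k\<in>pverts H. f (U k j)) = \<one>\<^bsub>?B\<^esub>"
      using q U fin
      by (subst fs[where h = "\<lambda>k. U k j"]) (auto simp: quantum_isomorphism_def magic_unitary_def B)
  next
    fix i assume "i \<in> pverts H"
    then show "(\<Oplus>\<^bsub>?B\<^esub>k\<in>pverts G. f (U i k)) = \<one>\<^bsub>?B\<^esub>"
      using q U fin
      by (subst fs[where h = "\<lambda>k. U i k"]) (auto simp: quantum_isomorphism_def magic_unitary_def B)
  qed (use q U in \<open>auto simp: quantum_isomorphism_def magic_unitary_def B\<close>)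
  moreover have "(\<Oplus>\<^bsub>?B\<^esub>k\<in>pverts G. adjacency G k j \<odot>\<^bsub>?B\<^esub> f (U i k)) =
        (\<Oplus>\<^bsub>?B\<^esub>k\<in>pverts H. adjacency H i k \<odot>\<^bsub>?B\<^esub> f (U k j))"
    if "i \<in> pverts H" "j \<in> pverts G" for i j
  proof -
    have "(\<Oplus>\<^bsub>?B\<^esub>k\<in>pverts G. adjacency G k j \<odot>\<^bsub>?B\<^esub> f (U i k)) =
        f (\<Oplus>\<^bsub>A\<^esub>k\<in>pverts G. adjacency G k j \<odot> U i k)"
      by (rule fs) (use fin that U smult_C smB in auto)
    also have "\<dots> = f (\<Oplus>\<^bsub>A\<^esub>k\<in>pverts H. adjacency H i k \<odot> U k j)"
      using q that by (simp add: quantum_isomorphism_def)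
    also have "\<dots> = (\<Oplus>\<^bsub>?B\<^esub>k\<in>pverts H. adjacency H i k \<odot>\<^bsub>?B\<^esub> f (U k j))"
      by (rule fs[symmetric]) (use fin that U smult_C smB in auto)
    finally show ?thesis .
  qed
  ultimately show ?thesis using q unfolding quantum_isomorphism_def by blast
qed

lemma small_factor:
  fixes e K :: real
  assumes "0 < e" "0 < K"
  shows "\<exists>\<delta>>0. \<delta> \<le> 1 \<and> \<delta> * K \<le> e"
proof (intro exI[of _ "min 1 (e / K)"] conjI)
  have "min 1 (e / K) * K \<le> (e / K) * K" using assms by (intro mult_right_mono) auto
  then show "min 1 (e / K) * K \<le> e" using assms by simp
qed (use assms in auto)

context unital_cstar_algebra begin

inductive_set gen :: "complex set \<Rightarrow> 'x set \<Rightarrow> 'x set" for Q S where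
  gen_base: "x \<in> S \<Longrightarrow> x \<in> gen Q S"
| gen_one: "\<one> \<in> gen Q S"
| gen_zero: "\<zero> \<in> gen Q S"
| gen_add: "x \<in> gen Q S \<Longrightarrow> y \<in> gen Q S \<Longrightarrow> x \<oplus> y \<in> gen Q S"
| gen_mult: "x \<in> gen Q S \<Longrightarrow> y \<in> gen Q S \<Longrightarrow> x \<otimes> y \<in> gen Q S"
| gen_smult: "c \<in> Q \<Longrightarrow> x \<in> gen Q S \<Longrightarrow> c \<odot> x \<in> gen Q S"
| gen_star: "x \<in> gen Q S \<Longrightarrow> star A x \<in> gen Q S"

lemma gen_subset: assumes "S \<subseteq> carrier A" shows "gen Q S \<subseteq> carrier A"
proof
  fix x assume "x \<in> gen Q S"
  then show "x \<in> carrier A"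
    by induction (use assms in \<open>auto simp: star_closed smult_laws(1)\<close>)
qed

lemma countable_gen:
  assumes "countable Q" "countable S"
  shows "countable (gen Q S)"
proof -
  define step where "step T = T \<union> (\<lambda>(x, y). x \<oplus> y) ` (T \<times> T) \<union> (\<lambda>(x, y). x \<otimes> y) ` (T \<times> T)
    \<union> (\<lambda>(c, x). c \<odot> x) ` (Q \<times> T) \<union> star A ` T" for T
  define lev where "lev n = (step ^^ n) (insert \<one> (insert \<zero> S))" for n
  have lev_Suc: "lev (Suc n) = step (lev n)" for n by (simp add: lev_def)
  have "countable (lev n)" for n
  proof (induction n)
    case 0
    then show ?case using assms by (simp add: lev_def)
  next
    case (Suc n)
    then show ?case using assms by (simp add: lev_Suc step_def)
  qed
  then have ctb: "countable (\<Union>n. lev n)" by simp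
  have mono: "lev m \<subseteq> lev n" if "m \<le> n" for m n
    using that by (rule lift_Suc_mono_le[rotated]) (auto simp: lev_Suc step_def)
  have "x \<in> (\<Union>n. lev n)" if "x \<in> gen Q S" for x
    using that
  proof induction
    case (gen_base x) then show ?case by (auto simp: lev_def intro!: exI[of _ 0])
  next
    case gen_one then show ?case by (auto simp: lev_def intro!: exI[of _ 0])
  next
    case gen_zero then show ?case by (auto simp: lev_def intro!: exI[of _ 0])
  next
    case (gen_add x y)
    then obtain m n where "x \<in> lev m" "y \<in> lev n" by auto
    then have "x \<in> lev (max m n)" "y \<in> lev (max m n)"
      using mono[of m "max m n"] mono[of n "max m n"] by auto
    then have "x \<oplus> y \<in> lev (Suc (max m n))" by (auto simp: lev_Suc step_def)
    then show ?case by blast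
  next
    case (gen_mult x y)
    then obtain m n where "x \<in> lev m" "y \<in> lev n" by auto
    then have "x \<in> lev (max m n)" "y \<in> lev (max m n)"
      using mono[of m "max m n"] mono[of n "max m n"] by auto
    then have "x \<otimes> y \<in> lev (Suc (max m n))" by (auto simp: lev_Suc step_def)
    then show ?case by blast
  next
    case (gen_smult c x)
    then obtain n where "x \<in> lev n" by auto
    then have "c \<odot> x \<in> lev (Suc n)" using gen_smult by (auto simp: lev_Suc step_def)
    then show ?case by blast
  next
    case (gen_star x)
    then obtain n where "x \<in> lev n" by auto
    then have "star A x \<in> lev (Suc n)" by (auto simp: lev_Suc step_def)
    then show ?case by blast
  qed
  then have "gen Q S \<subseteq> (\<Union>n. lev n)" by blast
  then show ?thesis using ctb by (rule countable_subset)
qed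

definition nrm_closure :: "'x set \<Rightarrow> 'x set" where
  "nrm_closure D = {x \<in> carrier A. \<forall>e>0. \<exists>d\<in>D. nrm A (x \<ominus> d) < e}"

lemma closed_closure_gen:
  assumes S: "S \<subseteq> carrier A" and dense: "\<And>c e. 0 < e \<Longrightarrow> \<exists>q\<in>Q. cmod (c - q) < e"
  shows "closed_cstar_subset A (nrm_closure (gen Q S)) \<and> S \<subseteq> nrm_closure (gen Q S)"
proof -
  let ?D = "gen Q S"
  have D: "d \<in> carrier A" if "d \<in> ?D" for d using gen_subset[OF S] that by blast
  have D_sub: "x \<in> nrm_closure ?D" if "x \<in> ?D" for x
    unfolding nrm_closure_def
  proof (intro CollectI conjI allI impI)
    fix e :: real assume "0 < e"
    then show "\<exists>d\<in>?D. nrm A (x \<ominus> d) < e"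
      using that D[OF that] nrm_eq_0_iff[of \<zero>] by (intro bexI[of _ x]) (auto simp: minus_eq r_neg)
  qed (use that D in auto)
  have "closed_cstar_subset A (nrm_closure ?D)"
  proof (intro closed_cstar_subset.intro closed_cstar_subset_axioms.intro unital_cstar_algebra_axioms)
    show "nrm_closure ?D \<subseteq> carrier A" by (auto simp: nrm_closure_def)
    show "\<one> \<in> nrm_closure ?D" by (intro D_sub gen_one)
    show "\<zero> \<in> nrm_closure ?D" by (intro D_sub gen_zero)
  next
    fix x y assume xy: "x \<in> nrm_closure ?D" "y \<in> nrm_closure ?D"
    then have car: "x \<in> carrier A" "y \<in> carrier A" by (auto simp: nrm_closure_def)
    show "x \<oplus> y \<in> nrm_closure ?D"
      unfolding nrm_closure_def
    proof (intro CollectI conjI allI impI)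
      fix e :: real assume "0 < e"
      then have "0 < e / 2" by simp
      then obtain a b where ab: "a \<in> ?D" "b \<in> ?D" "nrm A (x \<ominus> a) < e / 2" "nrm A (y \<ominus> b) < e / 2"
        using xy unfolding nrm_closure_def by blast
      have car': "a \<in> carrier A" "b \<in> carrier A" using ab D by auto
      have "(x \<oplus> y) \<ominus> (a \<oplus> b) = (x \<ominus> a) \<oplus> (y \<ominus> b)" using car car' by algebra
      then have "nrm A ((x \<oplus> y) \<ominus> (a \<oplus> b)) < e"
        using nrm_triangle[of "x \<ominus> a" "y \<ominus> b"] ab car car' by simp
      then show "\<exists>d\<in>?D. nrm A (x \<oplus> y \<ominus> d) < e" using gen_add ab by blast
    qed (use car in auto)
    show "x \<otimes> y \<in> nrm_closure ?D"
      unfolding nrm_closure_def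
    proof (intro CollectI conjI allI impI)
      fix e :: real assume e: "0 < e"
      have nn: "0 \<le> nrm A x" "0 \<le> nrm A y" using car nrm_nonneg by auto
      then obtain \<delta> where \<delta>: "0 < \<delta>" "\<delta> \<le> 1" "\<delta> * (nrm A x + nrm A y + 2) \<le> e"
        using small_factor[OF e, of "nrm A x + nrm A y + 2"] by auto
      obtain a b where ab: "a \<in> ?D" "b \<in> ?D" "nrm A (x \<ominus> a) < \<delta>" "nrm A (y \<ominus> b) < \<delta>"
        using xy \<delta>(1) unfolding nrm_closure_def by blast
      have car': "a \<in> carrier A" "b \<in> carrier A" using ab D by auto
      have "a = x \<oplus> (a \<ominus> x)" using car car' by algebra
      then have na: "nrm A a \<le> nrm A x + 1"
        using nrm_triangle[of x "a \<ominus> x"] car car' nrm_diff_commute[of a x] ab \<delta> by simp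
      have "(x \<otimes> y) \<ominus> (a \<otimes> b) = ((x \<ominus> a) \<otimes> y) \<oplus> (a \<otimes> (y \<ominus> b))" using car car' by algebra
      then have "nrm A ((x \<otimes> y) \<ominus> (a \<otimes> b)) \<le> nrm A ((x \<ominus> a) \<otimes> y) + nrm A (a \<otimes> (y \<ominus> b))"
        using nrm_triangle[of "(x \<ominus> a) \<otimes> y" "a \<otimes> (y \<ominus> b)"] car car' by simp
      also have "\<dots> \<le> nrm A (x \<ominus> a) * nrm A y + nrm A a * nrm A (y \<ominus> b)"
        using nrm_mult[of "x \<ominus> a" y] nrm_mult[of a "y \<ominus> b"] car car' by simp
      also have "\<dots> \<le> \<delta> * nrm A y + (nrm A x + 1) * \<delta>"
        using ab na nn nrm_nonneg[of "y \<ominus> b"] car car' \<delta>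
        by (intro add_mono mult_right_mono mult_mono) auto
      also have "\<dots> < e"
        using \<delta> by (simp add: algebra_simps)
      finally show "\<exists>d\<in>?D. nrm A (x \<otimes> y \<ominus> d) < e" using gen_mult ab by blast
    qed (use car in auto)
  next
    fix c x assume x: "x \<in> nrm_closure ?D"
    then have car: "x \<in> carrier A" by (auto simp: nrm_closure_def)
    show "c \<odot> x \<in> nrm_closure ?D"
      unfolding nrm_closure_def
    proof (intro CollectI conjI allI impI)
      fix e :: real assume e: "0 < e"
      have nn: "0 \<le> nrm A x" "0 \<le> cmod c" using car nrm_nonneg by auto
      then have pos: "0 < nrm A x + cmod c + 2" by linarith
      obtain \<delta> where \<delta>: "0 < \<delta>" "\<delta> \<le> 1" "\<delta> * (nrm A x + cmod c + 2) \<le> e"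
        using small_factor[OF e pos] by blast
      obtain q where q: "q \<in> Q" "cmod (c - q) < \<delta>" using dense[OF \<delta>(1)] by blast
      obtain a where a: "a \<in> ?D" "nrm A (x \<ominus> a) < \<delta>"
        using x \<delta> unfolding nrm_closure_def by blast
      have car': "a \<in> carrier A" using a D by auto
      have nq: "cmod q \<le> cmod c + 1" using q \<delta> norm_triangle_ineq4[of c "c - q"] by simp
      have "(c - q) \<odot> x \<oplus> q \<odot> x = c \<odot> x" using smult_laws(2)[OF car, of "c - q" q] by simp
      moreover have "q \<odot> (x \<ominus> a) = q \<odot> x \<ominus> q \<odot> a"
        using car car' by (simp add: minus_eq smult_laws(3) smult_uminus[symmetric]
           smult_laws(1) smult_laws(4)[symmetric])
      moreover have "((c - q) \<odot> x \<oplus> q \<odot> x) \<ominus> q \<odot> a = (c - q) \<odot> x \<oplus> (q \<odot> x \<ominus> q \<odot> a)"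
        using car car' by (simp add: minus_eq a_assoc smult_laws(1))
      ultimately have "c \<odot> x \<ominus> q \<odot> a = ((c - q) \<odot> x) \<oplus> (q \<odot> (x \<ominus> a))"
        by simp
      then have "nrm A (c \<odot> x \<ominus> q \<odot> a) \<le> nrm A ((c - q) \<odot> x) + nrm A (q \<odot> (x \<ominus> a))"
        using nrm_triangle[of "(c - q) \<odot> x" "q \<odot> (x \<ominus> a)"] car car' by (simp add: smult_laws(1))
      also have "\<dots> = cmod (c - q) * nrm A x + cmod q * nrm A (x \<ominus> a)"
        using car car' by (simp add: nrm_smult)
      also have "\<dots> \<le> \<delta> * nrm A x + (cmod c + 1) * \<delta>"
        using q a nq nn nrm_nonneg[of "x \<ominus> a"] car car' \<delta>
        by (intro add_mono mult_right_mono mult_mono) auto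
      also have "\<dots> < e"
        using \<delta> by (simp add: algebra_simps)
      finally show "\<exists>d\<in>?D. nrm A (c \<odot> x \<ominus> d) < e" using gen_smult q a by blast
    qed (use car in \<open>auto simp: smult_laws(1)\<close>)
  next
    fix x assume x: "x \<in> nrm_closure ?D"
    then have car: "x \<in> carrier A" by (auto simp: nrm_closure_def)
    show "star A x \<in> nrm_closure ?D"
      unfolding nrm_closure_def
    proof (intro CollectI conjI allI impI)
      fix e :: real assume e: "0 < e"
      then obtain a where a: "a \<in> ?D" "nrm A (x \<ominus> a) < e"
        using x unfolding nrm_closure_def by blast
      have car': "a \<in> carrier A" using a(1) D by blast
      have "star A x \<ominus> star A a = star A (x \<ominus> a)"
        using car car' by (simp add: minus_eq star_add star_uminus)
      then have "nrm A (star A x \<ominus> star A a) < e"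
        using a(2) nrm_star[OF minus_closed[OF car car']] by simp
      then show "\<exists>d\<in>?D. nrm A (star A x \<ominus> d) < e" using gen_star[OF a(1)] by blast
    qed (use car in \<open>auto simp: star_closed\<close>)
  next
    fix s x
    assume s: "\<And>n. s n \<in> nrm_closure ?D" and x: "x \<in> carrier A"
      and lim: "(\<lambda>n. nrm A (s n \<ominus> x)) \<longlonglongrightarrow> 0"
    show "x \<in> nrm_closure ?D"
      unfolding nrm_closure_def
    proof (intro CollectI conjI allI impI x)
      fix e :: real assume e: "0 < e"
      have "\<forall>\<^sub>F n in sequentially. nrm A (s n \<ominus> x) < e / 2"
        using order_tendstoD(2)[OF lim, of "e / 2"] e by simp
      then obtain n where n: "nrm A (s n \<ominus> x) < e / 2"
        using eventually_happens'[OF sequentially_bot] by blast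
      have sn: "s n \<in> carrier A" using s[of n] by (auto simp: nrm_closure_def)
      obtain a where a: "a \<in> ?D" "nrm A (s n \<ominus> a) < e / 2"
        using s[of n] half_gt_zero[OF e] unfolding nrm_closure_def by blast
      have "nrm A (x \<ominus> a) < e"
        using nrm_diff_triangle[OF x sn D[OF a(1)]] nrm_diff_commute[OF x sn] a n by simp
      then show "\<exists>d\<in>?D. nrm A (x \<ominus> d) < e" using a by blast
    qed
  qed
  then show ?thesis using D_sub gen_base by blast
qed

lemma inj_nrm_closure:
  assumes "D \<subseteq> carrier A" "countable D"
  shows "\<exists>f :: 'x \<Rightarrow> real. inj_on f (nrm_closure D)"
proof -
  define code where "code x = {(n, k). n \<in> to_nat_on D ` D \<and>
     nrm A (x \<ominus> from_nat_into D n) < 1 / real (Suc k)}" for x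
  have "inj_on code (nrm_closure D)"
  proof (rule inj_onI)
    fix x y assume xy: "x \<in> nrm_closure D" "y \<in> nrm_closure D" "code x = code y"
    then have car: "x \<in> carrier A" "y \<in> carrier A" by (auto simp: nrm_closure_def)
    have small: "nrm A (x \<ominus> y) \<le> e" if e: "0 < e" for e
    proof -
      obtain k where k: "1 / real (Suc k) < e / 2"
        by (rule nat_approx_posE[OF half_gt_zero[OF e]])
      obtain d where d: "d \<in> D" "nrm A (x \<ominus> d) < 1 / real (Suc k)"
        using xy(1) by (auto simp: nrm_closure_def dest!: spec[of _ "1 / real (Suc k)"])
      then have "(to_nat_on D d, k) \<in> code x" using assms by (simp add: code_def)
      then have "(to_nat_on D d, k) \<in> code y" using xy(3) by simp
      then have "nrm A (y \<ominus> d) < 1 / real (Suc k)"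
        using d(1) assms(2) by (simp add: code_def)
      moreover have "d \<in> carrier A" using d(1) assms(1) by blast
      ultimately show ?thesis
        using nrm_diff_triangle[of x d y] nrm_diff_commute[of d y] car d(2) k by simp
    qed
    have "nrm A (x \<ominus> y) = 0"
      using field_le_epsilon[of "nrm A (x \<ominus> y)" 0] small nrm_nonneg[OF minus_closed[OF car]]
      by (intro order_antisym) auto
    then show "x = y" using nrm_eq_0_iff[of "x \<ominus> y"] car by simp
  qed
  moreover obtain h :: "nat set \<Rightarrow> real" where h: "inj h"
    using nat_sets_eqpoll_reals unfolding eqpoll_def bij_betw_def by blast
  moreover have "inj (image prod_encode)"
    by (simp add: inj_on_image inj_prod_encode)
  ultimately have "inj_on (h \<circ> (image prod_encode \<circ> code)) (nrm_closure D)"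
    by (intro comp_inj_on) (auto intro: inj_on_subset)
  then show ?thesis by blast
qed

end

lemma quantum_isomorphicI:
  fixes A :: "'x star_algebra"
  assumes A: "unital_cstar_algebra A" and ne: "\<one>\<^bsub>A\<^esub> \<noteq> \<zero>\<^bsub>A\<^esub>"
    and q: "quantum_isomorphism A G H U"
  shows "quantum_isomorphic G H"
proof -
  interpret unital_cstar_algebra A by fact
  define S where "S = (\<Union>i\<in>pverts H. U i ` pverts G)"
  have S: "S \<subseteq> carrier A" "countable S"
    using q by (auto simp: S_def quantum_isomorphism_def magic_unitary_def intro: countable_finite)
  obtain Q :: "complex set"
    where Q: "countable Q" "\<And>V. open V \<Longrightarrow> V \<noteq> {} \<Longrightarrow> \<exists>q\<in>Q. q \<in> V"
    using countable_dense_exists by blast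
  have dense: "\<exists>q\<in>Q. cmod (c - q) < e" if "0 < e" for c e
    using Q(2)[of "ball c e"] that by (auto simp: dist_norm)
  define C where "C = nrm_closure (gen Q S)"
  have C: "closed_cstar_subset A C" "S \<subseteq> C"
    using closed_closure_gen[OF S(1) dense] by (auto simp: C_def)
  obtain f :: "'x \<Rightarrow> real" where f: "inj_on f C"
    using inj_nrm_closure[OF gen_subset[OF S(1)] countable_gen[OF Q(1) S(2)]] C_def by blast
  have "quantum_isomorphism (transport_cstar A C f) G H (\<lambda>i j. f (U i j))"
    by (rule transport_quantum_isomorphism[OF C(1) f q]) (use C(2) in \<open>auto simp: S_def\<close>)
  moreover have "\<one>\<^bsub>transport_cstar A C f\<^esub> \<noteq> \<zero>\<^bsub>transport_cstar A C f\<^esub>"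
    using ne f closed_cstar_subset.one_C[OF C(1)] closed_cstar_subset.zero_C[OF C(1)]
    by (auto simp: transport_cstar_def Let_def dest: inj_onD)
  ultimately show ?thesis
    using transport_cstar[OF C(1) f] unfolding quantum_isomorphic_def by blast
qed

lemma quantum_isomorphic_relabel:
  assumes q: "quantum_isomorphic G H"
    and g: "graph_isomorphism g G' G" and h: "graph_isomorphism h H' H"
  shows "quantum_isomorphic G' H'"
proof -
  obtain A :: "real star_algebra" and U
    where A: "unital_cstar_algebra A" "\<one>\<^bsub>A\<^esub> \<noteq> \<zero>\<^bsub>A\<^esub>" and q: "quantum_isomorphism A G H U"
    using q by (auto simp: quantum_isomorphic_def)
  interpret unital_cstar_algebra A by fact
  have U: "U i j \<in> carrier A" if "i \<in> pverts H" "j \<in> pverts G" for i j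
    using q that by (auto simp: quantum_isomorphism_def magic_unitary_def)
  have gb: "bij_betw g (pverts G') (pverts G)" and hb: "bij_betw h (pverts H') (pverts H)"
    using g h by (auto simp: graph_isomorphism_def)
  have gv: "g j \<in> pverts G" if "j \<in> pverts G'" for j using gb that by (auto simp: bij_betw_def)
  have hv: "h i \<in> pverts H" if "i \<in> pverts H'" for i using hb that by (auto simp: bij_betw_def)
  have gadj: "adjacency G' u v = adjacency G (g u) (g v)" if "u \<in> pverts G'" "v \<in> pverts G'" for u v
    using g that by (simp add: graph_isomorphism_def adjacency_def)
  have hadj: "adjacency H' u v = adjacency H (h u) (h v)" if "u \<in> pverts H'" "v \<in> pverts H'" for u v
    using h that by (simp add: graph_isomorphism_def adjacency_def)
  have sum_g: "(\<Oplus>\<^bsub>A\<^esub>k\<in>pverts G'. F' k) = (\<Oplus>\<^bsub>A\<^esub>k\<in>pverts G. F k)"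
    if "\<And>k. k \<in> pverts G \<Longrightarrow> F k \<in> carrier A" "\<And>k. k \<in> pverts G' \<Longrightarrow> F' k = F (g k)" for F F'
  proof -
    have "(\<Oplus>\<^bsub>A\<^esub>k\<in>pverts G. F k) = (\<Oplus>\<^bsub>A\<^esub>k\<in>g ` pverts G'. F k)"
      using gb by (simp add: bij_betw_def)
    also have "\<dots> = (\<Oplus>\<^bsub>A\<^esub>k\<in>pverts G'. F (g k))"
      by (rule finsum_reindex) (use gb that gv in \<open>auto simp: bij_betw_def\<close>)
    also have "\<dots> = (\<Oplus>\<^bsub>A\<^esub>k\<in>pverts G'. F' k)"
      by (rule finsum_cong') (use that gv in auto)
    finally show ?thesis by simp
  qed
  have sum_h: "(\<Oplus>\<^bsub>A\<^esub>k\<in>pverts H'. F' k) = (\<Oplus>\<^bsub>A\<^esub>k\<in>pverts H. F k)"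
    if "\<And>k. k \<in> pverts H \<Longrightarrow> F k \<in> carrier A" "\<And>k. k \<in> pverts H' \<Longrightarrow> F' k = F (h k)" for F F'
  proof -
    have "(\<Oplus>\<^bsub>A\<^esub>k\<in>pverts H. F k) = (\<Oplus>\<^bsub>A\<^esub>k\<in>h ` pverts H'. F k)"
      using hb by (simp add: bij_betw_def)
    also have "\<dots> = (\<Oplus>\<^bsub>A\<^esub>k\<in>pverts H'. F (h k))"
      by (rule finsum_reindex) (use hb that hv in \<open>auto simp: bij_betw_def\<close>)
    also have "\<dots> = (\<Oplus>\<^bsub>A\<^esub>k\<in>pverts H'. F' k)"
      by (rule finsum_cong') (use that hv in auto)
    finally show ?thesis by simp
  qed
  have "quantum_isomorphism A G' H' (\<lambda>i j. U (h i) (g j))"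
    unfolding quantum_isomorphism_def magic_unitary_def
  proof (intro conjI ballI)
    show "card (pverts G') = card (pverts H')"
      using q bij_betw_same_card[OF gb] bij_betw_same_card[OF hb]
      by (simp add: quantum_isomorphism_def)
    show "finite (pverts G')" "finite (pverts H')"
      using q bij_betw_finite[OF gb] bij_betw_finite[OF hb]
      by (simp_all add: quantum_isomorphism_def magic_unitary_def)
  next
    fix j assume j: "j \<in> pverts G'"
    show "(\<Oplus>\<^bsub>A\<^esub>k\<in>pverts H'. U (h k) (g j)) = \<one>\<^bsub>A\<^esub>"
      using q gv[OF j] sum_h[of "\<lambda>k. U k (g j)" "\<lambda>k. U (h k) (g j)"] U
      by (simp add: quantum_isomorphism_def magic_unitary_def)
  next
    fix i assume i: "i \<in> pverts H'"
    show "(\<Oplus>\<^bsub>A\<^esub>k\<in>pverts G'. U (h i) (g k)) = \<one>\<^bsub>A\<^esub>"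
      using q hv[OF i] sum_g[of "\<lambda>k. U (h i) k" "\<lambda>k. U (h i) (g k)"] U
      by (simp add: quantum_isomorphism_def magic_unitary_def)
  next
    fix i j assume i: "i \<in> pverts H'" and j: "j \<in> pverts G'"
    have "(\<Oplus>\<^bsub>A\<^esub>k\<in>pverts G'. adjacency G' k j \<odot>\<^bsub>A\<^esub> U (h i) (g k)) =
        (\<Oplus>\<^bsub>A\<^esub>k\<in>pverts G. adjacency G k (g j) \<odot>\<^bsub>A\<^esub> U (h i) k)"
      by (rule sum_g) (use i j hv U gadj in \<open>auto simp: smult_laws(1)\<close>)
    also have "\<dots> = (\<Oplus>\<^bsub>A\<^esub>k\<in>pverts H. adjacency H (h i) k \<odot>\<^bsub>A\<^esub> U k (g j))"
      using q hv[OF i] gv[OF j] by (simp add: quantum_isomorphism_def)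
    also have "\<dots> = (\<Oplus>\<^bsub>A\<^esub>k\<in>pverts H'. adjacency H' i k \<odot>\<^bsub>A\<^esub> U (h k) (g j))"
      by (rule sum_h[symmetric]) (use i j gv U hadj in \<open>auto simp: smult_laws(1)\<close>)
    finally show "(\<Oplus>\<^bsub>A\<^esub>k\<in>pverts G'. adjacency G' k j \<odot>\<^bsub>A\<^esub> U (h i) (g k)) =
      (\<Oplus>\<^bsub>A\<^esub>k\<in>pverts H'. adjacency H' i k \<odot>\<^bsub>A\<^esub> U (h k) (g j))" .
  qed (use q gv hv in \<open>auto simp: quantum_isomorphism_def magic_unitary_def\<close>)
  then show ?thesis using A unfolding quantum_isomorphic_def by blast
qed

lemma graph_isomorphism_inv:
  assumes "graph_isomorphism f G H"
  shows "graph_isomorphism (inv_into (pverts G) f) H G"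
proof -
  have b: "bij_betw f (pverts G) (pverts H)" using assms by (simp add: graph_isomorphism_def)
  have "bij_betw (inv_into (pverts G) f) (pverts H) (pverts G)" using bij_betw_inv_into[OF b] .
  moreover note bij_betwE[OF this] bij_betw_inv_into_right[OF b]
  ultimately show ?thesis using assms unfolding graph_isomorphism_def by simp
qed

lemma graph_isomorphism_comp:
  assumes "graph_isomorphism f G H" "graph_isomorphism g H K"
  shows "graph_isomorphism (g \<circ> f) G K"
proof -
  have b: "bij_betw f (pverts G) (pverts H)" "bij_betw g (pverts H) (pverts K)"
    using assms by (simp_all add: graph_isomorphism_def)
  show ?thesis
    using assms bij_betw_trans[OF b] bij_betwE[OF b(1)] unfolding graph_isomorphism_def by simp
qed

lemma nat_copy:
  fixes G :: "'a pair_pre_digraph"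
  assumes G: "pair_graph G"
  obtains K :: "nat pair_pre_digraph" and f where "pair_graph K" "graph_isomorphism f K G"
proof -
  interpret pair_graph G by fact
  obtain f where f: "bij_betw f {..<card (pverts G)} (pverts G)"
    using ex_bij_betw_nat_finite[OF pair_finite_verts] by (auto simp: atLeast0LessThan)
  define K :: "nat pair_pre_digraph" where
    "K = \<lparr> pverts = {..<card (pverts G)},
       parcs = {(u, v). u < card (pverts G) \<and> v < card (pverts G) \<and> (f u, f v) \<in> parcs G} \<rparr>"
  have "finite (parcs K)"
    by (rule finite_subset[of _ "{..<card (pverts G)} \<times> {..<card (pverts G)}"]) (auto simp: K_def)
  moreover have "symmetric (with_proj K)"
    using arcs_symmetric by (auto simp: symmetric_def sym_def K_def)
  ultimately have "pair_graph K"
    by unfold_locales (auto simp: K_def dest: no_loops')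
  moreover have "graph_isomorphism f K G" using f by (auto simp: graph_isomorphism_def K_def)
  ultimately show ?thesis using that by blast
qed

lemma smallest_quantum_pair_le:
  fixes G :: "'a pair_pre_digraph" and H :: "'b pair_pre_digraph"
  assumes n: "smallest_quantum_pair_order n" and G: "pair_graph G" and H: "pair_graph H"
    and q: "quantum_isomorphic G H" and ni: "\<not> isomorphic G H"
  shows "n \<le> card (pverts G)"
proof -
  obtain G' :: "nat pair_pre_digraph" and g where g: "pair_graph G'" "graph_isomorphism g G' G"
    using nat_copy[OF G] .
  obtain H' :: "nat pair_pre_digraph" and h where h: "pair_graph H'" "graph_isomorphism h H' H"
    using nat_copy[OF H] .
  have "\<not> isomorphic G' H'"
  proof
    assume "isomorphic G' H'"
    then obtain f where "graph_isomorphism f G' H'" by (auto simp: isomorphic_def)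
    then have "graph_isomorphism (h \<circ> (f \<circ> inv_into (pverts G') g)) G H"
      using g h by (blast intro: graph_isomorphism_comp graph_isomorphism_inv)
    then show False using ni by (auto simp: isomorphic_def)
  qed
  moreover have "card (pverts G') = card (pverts G)" "card (pverts H') = card (pverts H)"
    using g h by (auto simp: graph_isomorphism_def bij_betw_same_card)
  moreover have "card (pverts G) = card (pverts H)"
    using q by (auto simp: quantum_isomorphic_def quantum_isomorphism_def)
  ultimately have "quantum_pair_of_order (card (pverts G))"
    using quantum_isomorphic_relabel[OF q g(2) h(2)] g h unfolding quantum_pair_of_order_def by metis
  then show ?thesis using n by (auto simp: smallest_quantum_pair_order_def)
qed

end

theory Submission
  imports Defs
begin

text \<open>
  Say that \<open>(a, b)\<close> and \<open>(i, j)\<close> are linked if \<open>u\<^sub>i\<^sub>a u\<^sub>j\<^sub>b \<noteq> 0\<close>, and that two binary functions are intertwined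
  if they agree on linked pairs. Equality and adjacency are intertwined, and counting the \<open>c\<close> for
  which \<open>(a, c)\<close> and \<open>(c, b)\<close> have prescribed values preserves intertwining; hence the generating
  series \<open>W\<^sub>x\<^sub>y\<close> of walks from \<open>x\<close> to \<open>y\<close> are intertwined. As \<open>c\<close> separates \<open>x\<close> from \<open>y\<close> iff
  \<open>W\<^sub>x\<^sub>y W\<^sub>c\<^sub>c = W\<^sub>x\<^sub>c W\<^sub>c\<^sub>y\<close>, so are the relation of lying in a common block and the number of vertices
  behind \<open>y\<close> as seen from \<open>x\<close>. Calling \<open>y\<close> the parent of \<open>x\<close> if they share a block and more than half of the
  graph lies behind \<open>y\<close> roots the block tree in an intertwined way. In a rooted block tree the sets of
  vertices of a block other than its root vertex are disjoint, so each linked pair of them yields a projection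
  in whose corner the two blocks are quantum isomorphic. If the graph is connected but not 2-connected,
  blocks are proper subgraphs, hence isomorphic by minimality of \<open>n\<close>, and an isomorphism of rooted block
  trees is assembled by counting the types of children. If the graph is disconnected, the same argument
  with connected components gives an isomorphism. Complements have the same quantum isomorphisms.
\<close>

section \<open>Projections in a C*-algebra\<close>

text \<open>A vertex may be linked to many vertices, so nothing can be transported along links one
  vertex at a time. What survives is counting: \<open>U i a \<otimes> U k c \<otimes> U j b\<close>
  sums to \<open>U i a \<otimes> U j b\<close> over \<open>c\<close> as well as over
  \<open>k\<close>, so counts over \<open>c\<close> agree with counts over \<open>k\<close>. This is
  the refinement of the two-dimensional Weisfeiler-Leman algorithm, and it yields only functions of
  two vertices. Separation involves three, hence the detour through walk series and through numbers
  of separating or separated vertices. The centre of a block tree may be a block or a cut vertex. A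
  majority condition treats both alike and needs one cardinality per pair of vertices. For the final
  matching, vertices are coloured by the connected components of the bipartite graph of nonzero
  entries of \<open>U\<close>: every invariant that agrees on linked vertices is a function of this
  colour, so equal colours supply all hypotheses at once. The algebras are abstract, with neither a
  Hilbert space nor an order at hand, so the orthogonality of projections with sum one has to come
  from the norm.\<close>

no_notation vwalk_join (infixr "\<oplus>" 65)

context unital_cstar_algebra
begin

lemma finsum_swap:
  assumes "finite S" "finite T" "\<And>a b. a \<in> S \<Longrightarrow> b \<in> T \<Longrightarrow> f a b \<in> carrier A"
  shows "(\<Oplus>a\<in>S. \<Oplus>b\<in>T. f a b) = (\<Oplus>b\<in>T. \<Oplus>a\<in>S. f a b)"
  using assms(1,3)
proof (induction S rule: finite_induct)
  case empty
  then show ?case by (simp add: add.finprod_one_eqI)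
next
  case (insert x S)
  have "(\<Oplus>a\<in>insert x S. \<Oplus>b\<in>T. f a b) = (\<Oplus>b\<in>T. f x b) \<oplus> (\<Oplus>a\<in>S. \<Oplus>b\<in>T. f a b)"
    by (rule finsum_insert) (use insert in \<open>auto intro!: finsum_closed\<close>)
  also have "\<dots> = (\<Oplus>b\<in>T. f x b) \<oplus> (\<Oplus>b\<in>T. \<Oplus>a\<in>S. f a b)" using insert by simp
  also have "\<dots> = (\<Oplus>b\<in>T. f x b \<oplus> (\<Oplus>a\<in>S. f a b))"
    by (rule finsum_addf[symmetric]) (use insert in \<open>auto intro!: finsum_closed\<close>)
  also have "\<dots> = (\<Oplus>b\<in>T. \<Oplus>a\<in>insert x S. f a b)"
    by (rule finsum_cong') (use insert in \<open>auto intro!: finsum_closed finsum_insert[symmetric]\<close>)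
  finally show ?case .
qed

lemma finsum_smult:
  assumes "finite S" "\<And>a. a \<in> S \<Longrightarrow> f a \<in> carrier A"
  shows "(\<Oplus>a\<in>S. c \<odot> f a) = c \<odot> (\<Oplus>a\<in>S. f a)"
  using assms
proof (induction S rule: finite_induct)
  case empty
  then show ?case using smult_r_null[of c] by (simp add: complex_ring_simps)
next
  case (insert x S)
  then have "(\<Oplus>a\<in>insert x S. c \<odot> f a) = c \<odot> f x \<oplus> (\<Oplus>a\<in>S. c \<odot> f a)"
    by (intro finsum_insert) (auto simp: smult_laws(1))
  moreover have "(\<Oplus>a\<in>insert x S. f a) = f x \<oplus> (\<Oplus>a\<in>S. f a)"
    by (intro finsum_insert) (use insert in auto)
  ultimately show ?case using insert by (simp add: smult_laws finsum_closed Pi_def)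
qed

lemma finsum_smult_left:
  assumes "finite S" "z \<in> carrier A"
  shows "(\<Oplus>a\<in>S. \<phi> a \<odot> z) = sum \<phi> S \<odot> z"
  using assms(1)
proof (induction S rule: finite_induct)
  case empty
  then show ?case using assms(2) by (simp add: smult_0)
next
  case (insert x S)
  then have "(\<Oplus>a\<in>insert x S. \<phi> a \<odot> z) = \<phi> x \<odot> z \<oplus> (\<Oplus>a\<in>S. \<phi> a \<odot> z)"
    by (intro finsum_insert) (auto simp: smult_laws(1) assms(2))
  then show ?case using insert by (simp add: smult_laws assms(2))
qed

lemma smult_left_cancel:
  assumes "z \<in> carrier A" "z \<noteq> \<zero>" "c \<odot> z = d \<odot> z"
  shows "c = d"
proof -
  have "(c - d) \<odot> z = c \<odot> z \<oplus> (-1) \<odot> (d \<odot> z)"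
    using smult_laws(2)[OF assms(1), of c "- d"] smult_laws(4)[OF assms(1), of "-1" d] by simp
  also have "\<dots> = \<zero>" using assms by (simp add: smult_uminus smult_laws(1) r_neg)
  finally have "cmod (c - d) * nrm A z = 0"
    using nrm_smult[OF assms(1), of "c - d"] nrm_eq_0_iff[of \<zero>] by simp
  then show ?thesis using nrm_eq_0_iff assms by simp
qed

text \<open>
  Think of \<open>w\<close> as a fractional matching with marginals \<open>x\<close> and \<open>y\<close>: quantities that agree along its
  support have the same weighted total on both sides. No positivity is involved.
\<close>

lemma finsum_eq_of_support:
  assumes fin: "finite S" "finite T"
    and w: "\<And>k c. k \<in> T \<Longrightarrow> c \<in> S \<Longrightarrow> w k c \<in> carrier A"
    and x: "\<And>c. c \<in> S \<Longrightarrow> (\<Oplus>k\<in>T. w k c) = x c"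
    and y: "\<And>k. k \<in> T \<Longrightarrow> (\<Oplus>c\<in>S. w k c) = y k"
    and eq: "\<And>k c. k \<in> T \<Longrightarrow> c \<in> S \<Longrightarrow> w k c \<noteq> \<zero> \<Longrightarrow> \<phi> c = \<psi> k"
  shows "(\<Oplus>c\<in>S. \<phi> c \<odot> x c) = (\<Oplus>k\<in>T. \<psi> k \<odot> y k)"
proof -
  have "(\<Oplus>c\<in>S. \<phi> c \<odot> x c) = (\<Oplus>c\<in>S. \<Oplus>k\<in>T. \<phi> c \<odot> w k c)"
    by (rule finsum_cong') (use fin w x in \<open>auto simp: finsum_smult smult_laws intro!: finsum_closed\<close>)
  also have "\<dots> = (\<Oplus>c\<in>S. \<Oplus>k\<in>T. \<psi> k \<odot> w k c)"
  proof (intro finsum_cong' refl)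
    fix c k assume ck: "c \<in> S" "k \<in> T"
    show "\<phi> c \<odot> w k c = \<psi> k \<odot> w k c"
      using eq[OF ck(2,1)] smult_r_null[of "\<phi> c"] smult_r_null[of "\<psi> k"]
      by (cases "w k c = \<zero>") (simp_all add: complex_ring_simps)
  qed (use w in \<open>auto simp: smult_laws intro!: finsum_closed\<close>)
  also have "\<dots> = (\<Oplus>k\<in>T. \<Oplus>c\<in>S. \<psi> k \<odot> w k c)"
    by (rule finsum_swap) (use fin w in \<open>auto simp: smult_laws\<close>)
  also have "\<dots> = (\<Oplus>k\<in>T. \<psi> k \<odot> y k)"
  proof (rule finsum_cong')
    show "(\<lambda>k. \<psi> k \<odot> y k) \<in> T \<rightarrow> carrier A"
      using w by (auto intro!: finsum_closed simp: smult_laws y[symmetric])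
  qed (use fin w y in \<open>auto simp: finsum_smult\<close>)
  finally show ?thesis .
qed

text \<open>With constant marginals both totals become multiples of the same nonzero element, so an
  identity in the algebra turns into one between numbers.\<close>

lemma sum_eq_of_support:
  fixes \<phi> :: "'b \<Rightarrow> complex"
  assumes fin: "finite S" "finite T"
    and "\<And>k c. k \<in> T \<Longrightarrow> c \<in> S \<Longrightarrow> w k c \<in> carrier A"
    and "\<And>c. c \<in> S \<Longrightarrow> (\<Oplus>k\<in>T. w k c) = z"
    and "\<And>k. k \<in> T \<Longrightarrow> (\<Oplus>c\<in>S. w k c) = z"
    and z: "z \<in> carrier A" "z \<noteq> \<zero>"
    and "\<And>k c. k \<in> T \<Longrightarrow> c \<in> S \<Longrightarrow> w k c \<noteq> \<zero> \<Longrightarrow> \<phi> c = \<psi> k"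
  shows "sum \<phi> S = sum \<psi> T"
proof (rule smult_left_cancel[OF z])
  have "(\<Oplus>c\<in>S. \<phi> c \<odot> z) = (\<Oplus>k\<in>T. \<psi> k \<odot> z)"
    by (rule finsum_eq_of_support) (fact assms)+
  then show "sum \<phi> S \<odot> z = sum \<psi> T \<odot> z" using fin z by (simp add: finsum_smult_left)
qed

lemma card_eq_of_support:
  assumes "finite S" "finite T"
    and "\<And>k c. k \<in> T \<Longrightarrow> c \<in> S \<Longrightarrow> w k c \<in> carrier A"
    and "\<And>c. c \<in> S \<Longrightarrow> (\<Oplus>k\<in>T. w k c) = z"
    and "\<And>k. k \<in> T \<Longrightarrow> (\<Oplus>c\<in>S. w k c) = z"
    and "z \<in> carrier A" "z \<noteq> \<zero>"
    and "\<And>k c. k \<in> T \<Longrightarrow> c \<in> S \<Longrightarrow> w k c \<noteq> \<zero> \<Longrightarrow> P c \<longleftrightarrow> P' k"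
  shows "card {c \<in> S. P c} = card {k \<in> T. P' k}"
proof -
  have "(\<Sum>c\<in>S. if P c then 1 else 0) = (\<Sum>k\<in>T. if P' k then 1 else (0::complex))"
    by (rule sum_eq_of_support[OF assms(1-7)]) (use assms(8) in auto)
  then have "complex_of_nat (card {c \<in> S. P c}) = of_nat (card {k \<in> T. P' k})"
    using assms(1,2) by (simp add: sum.If_cases Int_def)
  then show ?thesis by simp
qed

section \<open>Norm estimates for projections\<close>

definition projection :: "'x \<Rightarrow> bool" where
  "projection p \<longleftrightarrow> p \<in> carrier A \<and> p \<otimes> p = p \<and> star A p = p"

lemma nrm_le_1_of_square: "0 \<le> r \<Longrightarrow> r = r\<^sup>2 \<Longrightarrow> r \<le> (1::real)"
  by (metis mult_cancel_right1 order_refl power2_eq_square zero_le_one)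

lemma projection_nrm: "projection p \<Longrightarrow> nrm A p \<le> 1"
  using cstar_identity[of p] nrm_nonneg[of p] nrm_le_1_of_square[of "nrm A p"]
  by (auto simp: projection_def)

lemma star_zero: "star A \<zero> = \<zero>"
  using star_smult[of \<zero> 0] by (simp add: smult_0 star_closed)

lemma star_one: "star A \<one> = \<one>"
  using star_mult[of "star A \<one>" \<one>] by (simp add: star_star star_closed)

lemma projection_one_minus: "projection p \<Longrightarrow> projection (\<one> \<ominus> p)"
  unfolding projection_def
  by (auto simp: star_add star_uminus star_one minus_eq l_distr r_distr l_minus r_minus r_neg)

lemma nrm_average:
  assumes "x \<in> carrier A" "y \<in> carrier A" "nrm A x \<le> 1" "nrm A y \<le> 1"
  shows "nrm A ((1/2) \<odot> (x \<otimes> x) \<oplus> (1/2) \<odot> (y \<otimes> y)) \<le> 1"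
proof -
  have "nrm A (x \<otimes> x) \<le> 1" "nrm A (y \<otimes> y) \<le> 1"
    using assms nrm_mult[of x x] nrm_mult[of y y] nrm_nonneg[of x] nrm_nonneg[of y]
    by (auto intro: order_trans mult_le_one)
  then show ?thesis
    using nrm_triangle[of "(1/2) \<odot> (x \<otimes> x)" "(1/2) \<odot> (y \<otimes> y)"] assms
    by (simp add: smult_laws nrm_smult)
qed

text \<open>
  A projection \<open>p\<close> is an extreme point among the selfadjoint contractions of its corner. If \<open>p + z x\<close> is a
  contraction for \<open>z\<close> and \<open>\<i> z\<close>, then so is \<open>p + (1 + \<i>) z x\<close>, being the average of the squares of these two;
  hence the set of admissible \<open>z\<close> is unbounded.
\<close>

lemma projection_extreme:
  assumes p: "projection p" and x: "x \<in> carrier A" "star A x = x" "p \<otimes> x = x" "x \<otimes> p = x"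
    and le: "nrm A (p \<oplus> x) \<le> 1" "nrm A (p \<ominus> x) \<le> 1"
  shows "x = \<zero>"
proof -
  have p': "p \<in> carrier A" "p \<otimes> p = p" "star A p = p" using p by (auto simp: projection_def)
  define e where "e z = p \<oplus> z \<odot> x" for z
  have e: "e z \<in> carrier A" for z using p' x by (simp add: e_def smult_laws)
  have ee: "e z \<otimes> e w = p \<oplus> ((z + w) \<odot> x \<oplus> (z * w) \<odot> (x \<otimes> x))" for z w
    using p' x
    by (simp add: e_def l_distr r_distr smult_laws(1-3) smult_laws(4)[symmetric]
        smult_mult_left smult_mult_right a_ac mult.commute)
  have half: "(1/2) \<odot> y \<oplus> (1/2) \<odot> y = y" if "y \<in> carrier A" for y
    using smult_laws(2)[OF that, of "1/2" "1/2"] smult_laws(5)[OF that] by simp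
  \<comment> \<open>The choice \<open>w = - z\<close> cancels the linear term, the choice
    \<open>w = \<i> * z\<close> the quadratic one.\<close>
  have av: "(1/2) \<odot> (e z \<otimes> e z) \<oplus> (1/2) \<odot> (e w \<otimes> e w) =
      p \<oplus> ((z + w) \<odot> x \<oplus> ((z * z + w * w) / 2) \<odot> (x \<otimes> x))" for z w
  proof -
    have "(1/2) \<odot> (e z \<otimes> e z) \<oplus> (1/2) \<odot> (e w \<otimes> e w) =
      ((1/2) \<odot> p \<oplus> (1/2) \<odot> p) \<oplus> ((z \<odot> x \<oplus> w \<odot> x)
        \<oplus> ((z * z / 2) \<odot> (x \<otimes> x) \<oplus> (w * w / 2) \<odot> (x \<otimes> x)))"
      unfolding ee using p' x smult_laws(4)[of x "1/2" "z+z"] smult_laws(4)[of x "1/2" "w+w"]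
        smult_laws(4)[of "x \<otimes> x" "1/2" "z * z"] smult_laws(4)[of "x \<otimes> x" "1/2" "w * w"]
      by (simp add: smult_laws(1,3) a_ac)
    also have "\<dots> = p \<oplus> ((z + w) \<odot> x \<oplus> ((z * z + w * w) / 2) \<odot> (x \<otimes> x))"
      using half[OF p'(1)] smult_laws(2)[of x z w] smult_laws(2)[of "x \<otimes> x" "z*z/2" "w*w/2"] x
      by (simp add: add_divide_distrib)
    finally show ?thesis .
  qed
  define S where "S = {z. nrm A (e z) \<le> 1}"
  have "1 \<in> S" using le x by (simp add: S_def e_def smult_laws)
  have "-1 \<in> S" using le x by (simp add: S_def e_def smult_uminus minus_eq)
  have pm: "nrm A (p \<oplus> x \<otimes> x) \<le> 1"
    using nrm_average[OF e e, of 1 "-1"] av[of 1 "-1"] \<open>1 \<in> S\<close> \<open>-1 \<in> S\<close> x p'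
    by (simp add: S_def smult_0 smult_laws)
  \<comment> \<open>For imaginary \<open>z\<close> the adjoint of \<open>e z\<close> is
    \<open>e (- z)\<close>, so the C*-identity turns the bound on
    \<open>p \<oplus> x \<otimes> x\<close> into one on \<open>e z\<close>.\<close>
  have "(nrm A (e z))\<^sup>2 \<le> 1" if "z = \<i> \<or> z = - \<i>" for z
  proof -
    have "star A (e z) = e (- z)"
      using that p' x by (auto simp: e_def star_add star_smult smult_laws)
    then have "star A (e z) \<otimes> e z = p \<oplus> x \<otimes> x"
      using ee[of "- z" z] that x by (auto simp: smult_0 smult_laws)
    then show ?thesis using cstar_identity[OF e, of z] pm by simp
  qed
  then have "nrm A (e z) \<le> 1" if "z = \<i> \<or> z = - \<i>" for z
    using that nrm_nonneg[OF e, of z] abs_square_le_1[of "nrm A (e z)"] by simp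
  then have "\<i> \<in> S" "- \<i> \<in> S" by (simp_all add: S_def)
  have step: "(1 + \<i>) * z \<in> S" if "z \<in> S" "\<i> * z \<in> S" for z
  proof -
    have "(1/2) \<odot> (e z \<otimes> e z) \<oplus> (1/2) \<odot> (e (\<i> * z) \<otimes> e (\<i> * z)) = e ((1 + \<i>) * z)"
      unfolding av using x p' by (simp add: e_def smult_0 smult_laws(1) algebra_simps)
    then show ?thesis
      using nrm_average[OF e e, of z "\<i> * z"] that by (simp add: S_def)
  qed
  \<comment> \<open>All four multiples by powers of \<open>\<i>\<close> are carried along because
    \<open>step\<close> needs \<open>z\<close> together with \<open>\<i> * z\<close>.\<close>
  have all: "(1 + \<i>) ^ m \<in> S \<and> - ((1 + \<i>) ^ m) \<in> S \<and> \<i> * (1 + \<i>) ^ m \<in> S \<and> - (\<i> * (1 + \<i>) ^ m) \<in> S" for m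
  proof (induction m)
    case 0
    then show ?case using \<open>1 \<in> S\<close> \<open>-1 \<in> S\<close> \<open>\<i> \<in> S\<close> \<open>- \<i> \<in> S\<close> by simp
  next
    case (Suc m)
    let ?z = "(1 + \<i>) ^ m"
    show ?case
      using step[of ?z] step[of "- ?z"] step[of "\<i> * ?z"] step[of "- (\<i> * ?z)"] Suc
      by (simp add: algebra_simps mult.assoc[symmetric])
  qed
  have bound: "cmod (1 + \<i>) ^ m * nrm A x \<le> 2" for m
  proof -
    let ?z = "(1 + \<i>) ^ m"
    have "?z \<odot> x = e ?z \<ominus> p" unfolding e_def minus_eq using x p' smult_laws(1)[of x ?z]
      by (metis a_ac(2) add.inv_closed add.m_closed minus_eq r_neg1 a_minus_def a_assoc a_comm r_neg r_zero)
    then have "nrm A (?z \<odot> x) \<le> nrm A (e ?z) + nrm A p"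
      using nrm_triangle[of "e ?z" "\<ominus> p"] e[of ?z] p' nrm_uminus[of p] by (simp add: minus_eq)
    then show ?thesis using all[of m] projection_nrm[OF p] nrm_smult[OF x(1), of ?z]
      by (simp add: S_def norm_power)
  qed
  have "1 < cmod (1 + \<i>)" by (simp add: cmod_def)
  have "nrm A x = 0"
  proof (rule ccontr)
    assume "nrm A x \<noteq> 0"
    then have pos: "0 < nrm A x" using nrm_nonneg[OF x(1)] by simp
    obtain m where "2 / nrm A x < cmod (1 + \<i>) ^ m"
      using real_arch_pow[OF \<open>1 < cmod (1 + \<i>)\<close>] by blast
    then have "2 < cmod (1 + \<i>) ^ m * nrm A x" using pos by (simp add: pos_divide_less_eq)
    then show False using bound[of m] by simp
  qed
  then show ?thesis using nrm_eq_0_iff x by simp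
qed

lemma projection_compress_nrm:
  assumes "projection p" "projection q"
  shows "nrm A (p \<otimes> q \<otimes> p) \<le> 1"
proof -
  have pq: "p \<in> carrier A" "q \<in> carrier A" using assms by (auto simp: projection_def)
  have "nrm A (p \<otimes> q) \<le> 1"
    using nrm_mult[OF pq] projection_nrm[OF assms(1)] projection_nrm[OF assms(2)] nrm_nonneg[OF pq(2)]
    by (auto intro: order_trans mult_le_one)
  then show ?thesis
    using nrm_mult[of "p \<otimes> q" p] projection_nrm[OF assms(1)] nrm_nonneg pq
    by (auto intro: order_trans mult_le_one)
qed

lemma nrm_finsum_le:
  assumes "finite S" "\<And>a. a \<in> S \<Longrightarrow> f a \<in> carrier A" "\<And>a. a \<in> S \<Longrightarrow> nrm A (f a) \<le> 1"
  shows "nrm A (\<Oplus>a\<in>S. f a) \<le> real (card S)"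
  using assms
proof (induction S rule: finite_induct)
  case empty
  then show ?case using nrm_eq_0_iff[of \<zero>] by simp
next
  case (insert x S)
  have "nrm A (\<Oplus>a\<in>insert x S. f a) = nrm A (f x \<oplus> (\<Oplus>a\<in>S. f a))"
    by (subst finsum_insert) (use insert in auto)
  also have "\<dots> \<le> nrm A (f x) + nrm A (\<Oplus>a\<in>S. f a)"
    by (rule nrm_triangle) (use insert in \<open>auto intro!: finsum_closed\<close>)
  also have "\<dots> \<le> 1 + real (card S)"
    using insert by (intro add_mono) auto
  finally show ?case using insert by simp
qed

text \<open>Compressed by \<open>p = P j\<close>, the members other than \<open>P j\<close> sum to
  zero. That they vanish is not deduced from positivity: \<open>p\<close> plus and minus a small
  multiple of the compression \<open>a i\<close> are shown to be contractions, so
  \<open>projection_extreme\<close> gives \<open>a i = \<zero>\<close>. Since \<open>a i\<close> is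
  \<open>P i \<otimes> p\<close> multiplied by its adjoint, the C*-identity finishes.\<close>

lemma projection_partition_orthogonal:
  assumes fin: "finite I" and P: "\<And>i. i \<in> I \<Longrightarrow> projection (P i)"
    and one: "(\<Oplus>i\<in>I. P i) = \<one>" and ij: "i \<in> I" "j \<in> I" "i \<noteq> j"
  shows "P i \<otimes> P j = \<zero>"
proof -
  have c: "P k \<in> carrier A" "P k \<otimes> P k = P k" "star A (P k) = P k" if "k \<in> I" for k
    using P[OF that] by (auto simp: projection_def)
  define p where "p = P j"
  note p = c[OF ij(2), folded p_def]
  define a where "a k = p \<otimes> P k \<otimes> p" for k
  have a: "a k \<in> carrier A" if "k \<in> I" for k using c p that by (simp add: a_def)
  define J where "J = I - {j, i}"
  have J: "finite J" "J \<subseteq> I" "I = insert j (insert i J)" "i \<notin> J" "j \<notin> insert i J"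
    using fin ij by (auto simp: J_def)
  \<comment> \<open>A sum of \<open>card J + 1\<close> contractions has norm at most
    \<open>N\<close>; in both sums below \<open>p\<close> occurs \<open>N\<close> times, so division
    by \<open>N\<close> leaves \<open>p\<close> plus or minus a multiple of
    \<open>a i\<close>.\<close>
  define N where "N = card J + 1"
  have "p = p \<otimes> \<one> \<otimes> p" using p by simp
  also have "\<dots> = (\<Oplus>k\<in>I. a k)"
    unfolding one[symmetric] a_def using fin c p
    by (simp add: finsum_rdistr finsum_ldistr Pi_def)
  also have "\<dots> = a j \<oplus> (a i \<oplus> (\<Oplus>k\<in>J. a k))"
    unfolding J(3) using J ij a by (subst finsum_insert, simp, simp, auto simp: subset_iff)
  also have "a j = p" using p by (simp add: a_def p_def)
  finally have "p \<oplus> \<zero> = p \<oplus> (a i \<oplus> (\<Oplus>k\<in>J. a k))" using p by simp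
  then have z: "a i \<oplus> (\<Oplus>k\<in>J. a k) = \<zero>"
    using p a ij J by (subst (asm) add.l_cancel) (auto intro!: finsum_closed simp: subset_iff)
  have pa: "nrm A (p \<ominus> a k) \<le> 1" "p \<ominus> a k \<in> carrier A" if "k \<in> I" for k
  proof -
    have "p \<ominus> a k = p \<otimes> (\<one> \<ominus> P k) \<otimes> p"
      using c[OF that] p by (simp add: a_def minus_eq l_distr r_distr l_minus r_minus)
    then show "nrm A (p \<ominus> a k) \<le> 1"
      using projection_compress_nrm[OF P[OF ij(2)] projection_one_minus[OF P[OF that]]]
      by (simp add: p_def)
    show "p \<ominus> a k \<in> carrier A" using p a that by simp
  qed
  \<comment> \<open>The sign turns here: the compressions over \<open>J\<close> add up to minus
    \<open>a i\<close>, so contractions of the form \<open>p \<ominus> a k\<close> produce plus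
    \<open>a i\<close>.\<close>
  have sumJ: "(\<Oplus>k\<in>J. p \<ominus> a k) = of_nat (card J) \<odot> p \<oplus> a i"
  proof -
    have "(\<Oplus>k\<in>J. p \<ominus> a k) = (\<Oplus>k\<in>J. 1 \<odot> p \<oplus> (-1) \<odot> a k)"
      using p a J by (intro finsum_cong') (auto simp: minus_eq smult_laws smult_uminus subset_iff)
    also have "\<dots> = of_nat (card J) \<odot> p \<oplus> (-1) \<odot> (\<Oplus>k\<in>J. a k)"
      using p a J finsum_smult_left[OF J(1) p(1), of "\<lambda>_. 1"] finsum_smult[OF J(1), of a "-1"]
      by (subst finsum_addf) (auto simp: smult_laws subset_iff)
    also have "(-1) \<odot> (\<Oplus>k\<in>J. a k) = a i"
      using z a ij J by (subst smult_uminus) (auto intro!: finsum_closed minus_equality simp: subset_iff)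
    finally show ?thesis .
  qed
  define x where "x = (1 / of_nat N) \<odot> a i"
  have x: "x \<in> carrier A" "star A x = x" "p \<otimes> x = x" "x \<otimes> p = x"
  proof -
    have "star A (a i) = a i" "p \<otimes> a i = a i" "a i \<otimes> p = a i"
      using p c[OF ij(1)] by (auto simp: a_def star_mult m_assoc) (auto simp: m_assoc[symmetric])
    then show "x \<in> carrier A" "star A x = x" "p \<otimes> x = x" "x \<otimes> p = x"
      using a[OF ij(1)] p by (auto simp: x_def smult_laws star_smult smult_mult_left smult_mult_right)
  qed
  have N: "N \<noteq> 0" by (simp add: N_def)
  have inv: "(1 / of_nat N) \<odot> (of_nat N \<odot> y) = y" if "y \<in> carrier A" for y
    using smult_laws(4)[OF that, of "1 / of_nat N" "of_nat N"] smult_laws(5)[OF that] N by simp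
  have scale: "nrm A (p \<oplus> (1 / of_nat N) \<odot> b) \<le> 1"
    if b: "b \<in> carrier A" "nrm A (p \<oplus> (of_nat (card J) \<odot> p \<oplus> b)) \<le> N" for b
  proof -
    have "p \<oplus> (of_nat (card J) \<odot> p \<oplus> b) = of_nat N \<odot> p \<oplus> b"
      using p b smult_laws(2)[OF p(1), of 1 "of_nat (card J)"] smult_laws(5)[OF p(1)]
      by (simp add: N_def smult_laws(1) a_assoc)
    then have "(1 / of_nat N) \<odot> (p \<oplus> (of_nat (card J) \<odot> p \<oplus> b)) = p \<oplus> (1 / of_nat N) \<odot> b"
      using inv[OF p(1)] b p by (simp add: smult_laws(1,3))
    then have "nrm A (p \<oplus> (1 / of_nat N) \<odot> b) =
        (1 / N) * nrm A (p \<oplus> (of_nat (card J) \<odot> p \<oplus> b))"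
      using nrm_smult[of "p \<oplus> (of_nat (card J) \<odot> p \<oplus> b)" "1 / of_nat N"] p b
      by (simp add: smult_laws(1) norm_divide)
    also have "\<dots> \<le> (1 / N) * N" using b by (intro mult_left_mono) auto
    finally show ?thesis using N by simp
  qed
  have "nrm A (p \<oplus> x) \<le> 1"
    unfolding x_def
  proof (rule scale[OF a[OF ij(1)]])
    have "nrm A (of_nat (card J) \<odot> p \<oplus> a i) \<le> card J"
      using nrm_finsum_le[OF J(1), of "\<lambda>k. p \<ominus> a k"] pa J(2) sumJ by auto
    then show "nrm A (p \<oplus> (of_nat (card J) \<odot> p \<oplus> a i)) \<le> N"
      using nrm_triangle[of p "of_nat (card J) \<odot> p \<oplus> a i"] p a[OF ij(1)] projection_nrm[OF P[OF ij(2)]]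
      by (simp add: smult_laws p_def[symmetric] N_def)
  qed
  moreover have "nrm A (p \<oplus> (1 / of_nat N) \<odot> (\<ominus> a i)) \<le> 1"
  proof (rule scale)
    have "p \<oplus> (of_nat (card J) \<odot> p \<oplus> \<ominus> a i) = of_nat (card J) \<odot> p \<oplus> (p \<ominus> a i)"
      using p a[OF ij(1)] by (simp add: minus_eq smult_laws a_ac)
    moreover have "nrm A (of_nat (card J) \<odot> p) \<le> card J"
      using projection_nrm[OF P[OF ij(2)]] p nrm_nonneg[OF p(1)]
      by (simp add: nrm_smult p_def[symmetric] mult_left_le)
    ultimately show "nrm A (p \<oplus> (of_nat (card J) \<odot> p \<oplus> \<ominus> a i)) \<le> N"
      using nrm_triangle[of "of_nat (card J) \<odot> p" "p \<ominus> a i"] pa[OF ij(1)] p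
      by (simp add: smult_laws N_def)
  qed (use a[OF ij(1)] in simp)
  moreover have "(1 / of_nat N) \<odot> (\<ominus> a i) = \<ominus> x"
    using a[OF ij(1)] smult_laws(4)[of "a i" "1 / of_nat N" "-1"] smult_laws(4)[of "a i" "-1" "1 / of_nat N"]
    by (simp add: x_def smult_uminus[symmetric] smult_laws(1))
  ultimately have "x = \<zero>"
    using projection_extreme[OF P[OF ij(2)], folded p_def, of x] x by (simp add: minus_eq)
  then have "a i = \<zero>"
    using a[OF ij(1)] N nrm_smult[of "a i" "1 / of_nat N"] nrm_eq_0_iff[of "a i"] nrm_eq_0_iff[of x]
    by (auto simp: x_def)
  moreover have "star A (P i \<otimes> p) \<otimes> (P i \<otimes> p) = a i"
    using p c[OF ij(1)] by (simp add: a_def star_mult m_assoc)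
      (simp add: m_assoc[symmetric])
  ultimately have "nrm A (P i \<otimes> p) = 0"
    using cstar_identity[of "P i \<otimes> p"] p c[OF ij(1)] nrm_eq_0_iff[of \<zero>] by simp
  then show ?thesis using nrm_eq_0_iff[of "P i \<otimes> p"] p c[OF ij(1)] by (simp add: p_def)
qed

end

section \<open>Intertwined functions\<close>

locale quantum_iso = unital_cstar_algebra A for A :: "'x star_algebra" (structure) +
  fixes G :: "'g pair_pre_digraph" and H :: "'h pair_pre_digraph" and U :: "'h \<Rightarrow> 'g \<Rightarrow> 'x"
  assumes one_neq_zero: "\<one> \<noteq> \<zero>" and quantum_isomorphism: "quantum_isomorphism A G H U"
begin

lemma fin: "finite (pverts G)" "finite (pverts H)"
  using quantum_isomorphism by (auto simp: quantum_isomorphism_def magic_unitary_def)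

lemma card_eq: "card (pverts G) = card (pverts H)"
  using quantum_isomorphism by (auto simp: quantum_isomorphism_def)

lemma U_projection: "i \<in> pverts H \<Longrightarrow> a \<in> pverts G \<Longrightarrow> projection (U i a)"
  using quantum_isomorphism
  by (auto simp: quantum_isomorphism_def magic_unitary_def projection_def)

lemma U:
  assumes "i \<in> pverts H" "a \<in> pverts G"
  shows "U i a \<in> carrier A" "U i a \<otimes> U i a = U i a" "star A (U i a) = U i a"
  using U_projection[OF assms] by (auto simp: projection_def)

lemma col_sum: "a \<in> pverts G \<Longrightarrow> (\<Oplus>k\<in>pverts H. U k a) = \<one>"
  and row_sum: "i \<in> pverts H \<Longrightarrow> (\<Oplus>c\<in>pverts G. U i c) = \<one>"
  using quantum_isomorphism by (auto simp: quantum_isomorphism_def magic_unitary_def)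

lemma col_orthogonal:
  "\<lbrakk>a \<in> pverts G; i \<in> pverts H; j \<in> pverts H; i \<noteq> j\<rbrakk> \<Longrightarrow> U i a \<otimes> U j a = \<zero>"
  using projection_partition_orthogonal[OF fin(2), of "\<lambda>k. U k a"] U_projection col_sum by blast

lemma row_orthogonal:
  "\<lbrakk>i \<in> pverts H; a \<in> pverts G; b \<in> pverts G; a \<noteq> b\<rbrakk> \<Longrightarrow> U i a \<otimes> U i b = \<zero>"
  using projection_partition_orthogonal[OF fin(1), of "U i"] U_projection row_sum by blast

lemma mult_neq_zeroD:
  assumes "x \<in> carrier A" "y \<in> carrier A" "x \<otimes> y \<noteq> \<zero>"
  shows "x \<noteq> \<zero>" "y \<noteq> \<zero>"
  using assms by auto

lemma U_mult_commute_neq_zero: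
  assumes "i \<in> pverts H" "j \<in> pverts H" "a \<in> pverts G" "b \<in> pverts G" "U i a \<otimes> U j b \<noteq> \<zero>"
  shows "U j b \<otimes> U i a \<noteq> \<zero>"
  using assms star_mult[of "U j b" "U i a"] star_zero U by auto

lemma finsum_neq_zeroD:
  assumes "(\<Oplus>c\<in>S. f c) \<noteq> \<zero>"
  obtains c where "c \<in> S" "f c \<noteq> \<zero>"
  using assms add.finprod_one_eqI[of S f] by blast

lemma col_expand:
  assumes "x \<in> carrier A" "c \<in> pverts G"
  shows "(\<Oplus>k\<in>pverts H. x \<otimes> U k c) = x" "(\<Oplus>k\<in>pverts H. U k c \<otimes> x) = x"
  using finsum_rdistr[of "pverts H" x "\<lambda>k. U k c"] finsum_ldistr[of "pverts H" x "\<lambda>k. U k c"]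
    assms fin U col_sum by (auto simp: Pi_def)

lemma row_expand:
  assumes "x \<in> carrier A" "k \<in> pverts H"
  shows "(\<Oplus>c\<in>pverts G. x \<otimes> U k c) = x" "(\<Oplus>c\<in>pverts G. U k c \<otimes> x) = x"
  using finsum_rdistr[of "pverts G" x "U k"] finsum_ldistr[of "pverts G" x "U k"]
    assms fin U row_sum by (auto simp: Pi_def)

lemma row_neq_zero: "i \<in> pverts H \<Longrightarrow> \<exists>a\<in>pverts G. U i a \<noteq> \<zero>"
proof -
  assume "i \<in> pverts H"
  then have "(\<Oplus>c\<in>pverts G. U i c) \<noteq> \<zero>" using row_sum one_neq_zero by simp
  then show ?thesis by (rule finsum_neq_zeroD) blast
qed

text \<open>The way from \<open>G\<close> to \<open>H\<close>: because every pair of vertices of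
  \<open>H\<close> is linked to some pair, an intertwined property of all pairs of \<open>G\<close>
  holds for all pairs of \<open>H\<close>.\<close>

lemma row_pair_neq_zero:
  assumes "i \<in> pverts H" "j \<in> pverts H"
  shows "\<exists>a\<in>pverts G. \<exists>b\<in>pverts G. U i a \<otimes> U j b \<noteq> \<zero>"
proof -
  obtain a where a: "a \<in> pverts G" "U i a \<noteq> \<zero>" using row_neq_zero[OF assms(1)] by blast
  then have "(\<Oplus>b\<in>pverts G. U i a \<otimes> U j b) \<noteq> \<zero>" using row_expand(1)[of "U i a" j] U assms by simp
  then show ?thesis using a(1) by (elim finsum_neq_zeroD) blast
qed

definition intertwined :: "('g \<Rightarrow> 'g \<Rightarrow> 't) \<Rightarrow> ('h \<Rightarrow> 'h \<Rightarrow> 't) \<Rightarrow> bool" where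
  "intertwined T T' \<longleftrightarrow> (\<forall>a\<in>pverts G. \<forall>b\<in>pverts G. \<forall>i\<in>pverts H. \<forall>j\<in>pverts H.
     U i a \<otimes> U j b \<noteq> \<zero> \<longrightarrow> T a b = T' i j)"

lemma intertwinedD:
  "\<lbrakk>intertwined T T'; U i a \<otimes> U j b \<noteq> \<zero>; i \<in> pverts H; j \<in> pverts H; a \<in> pverts G; b \<in> pverts G\<rbrakk>
   \<Longrightarrow> T a b = T' i j"
  by (simp add: intertwined_def)

lemma intertwined_diag:
  "\<lbrakk>intertwined T T'; U i a \<noteq> \<zero>; i \<in> pverts H; a \<in> pverts G\<rbrakk> \<Longrightarrow> T a a = T' i i"
  using intertwinedD[of T T' i a i a] U by simp

lemma intertwined_eq: "intertwined (=) (=)"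
  unfolding intertwined_def
proof (intro ballI impI)
  fix a b i j
  assume "a \<in> pverts G" "b \<in> pverts G" "i \<in> pverts H" "j \<in> pverts H" "U i a \<otimes> U j b \<noteq> \<zero>"
  then show "(a = b) = (i = j)" using col_orthogonal[of a i j] row_orthogonal[of i a b] by auto
qed

lemma intertwined_converse: "intertwined T T' \<Longrightarrow> intertwined (\<lambda>a b. T b a) (\<lambda>i j. T' j i)"
  unfolding intertwined_def using U_mult_commute_neq_zero by blast

lemma intertwined_fst:
  assumes "\<And>i a. i \<in> pverts H \<Longrightarrow> a \<in> pverts G \<Longrightarrow> U i a \<noteq> \<zero> \<Longrightarrow> \<kappa> a = \<kappa>' i"
  shows "intertwined (\<lambda>a b. \<kappa> a) (\<lambda>i j. \<kappa>' i)"
  unfolding intertwined_def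
  using assms mult_neq_zeroD[OF U(1) U(1)] by metis

lemma intertwined_snd:
  assumes "\<And>i a. i \<in> pverts H \<Longrightarrow> a \<in> pverts G \<Longrightarrow> U i a \<noteq> \<zero> \<Longrightarrow> \<kappa> a = \<kappa>' i"
  shows "intertwined (\<lambda>a b. \<kappa> b) (\<lambda>i j. \<kappa>' j)"
  unfolding intertwined_def
  using assms mult_neq_zeroD[OF U(1) U(1)] by metis

text \<open>Multiplying the matrix identity by \<open>U i a\<close> on the left and by
  \<open>U j b\<close> on the right isolates one term on each side, by row and column orthogonality.
  What remains are two scalar multiples of \<open>U i a \<otimes> U j b\<close>.\<close>

lemma intertwined_adjacent: "intertwined (\<lambda>a b. (a, b) \<in> parcs G) (\<lambda>i j. (i, j) \<in> parcs H)"
  unfolding intertwined_def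
proof (intro ballI impI)
  fix a b i j
  assume v: "a \<in> pverts G" "b \<in> pverts G" "i \<in> pverts H" "j \<in> pverts H"
    and nz: "U i a \<otimes> U j b \<noteq> \<zero>"
  note cl = U(1)[OF v(3,1)] U(1)[OF v(4,2)]
  have "U i a \<otimes> (\<Oplus>k\<in>pverts G. adjacency G k b \<odot> U i k) = (\<Oplus>k\<in>pverts G. U i a \<otimes> (adjacency G k b \<odot> U i k))"
    using finsum_rdistr[OF fin(1) cl(1)] v U by (auto simp: smult_laws)
  also have "\<dots> = (\<Oplus>k\<in>pverts G. if a = k then adjacency G k b \<odot> U i k else \<zero>)"
    using v U row_orthogonal[of i a] smult_r_null
    by (intro finsum_cong') (auto simp: smult_mult_right smult_laws complex_ring_simps)
  also have "\<dots> = adjacency G a b \<odot> U i a"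
    using add.finprod_singleton[OF v(1) fin(1), of "\<lambda>k. adjacency G k b \<odot> U i k"] v U
    by (simp add: smult_laws Pi_def)
  finally have l: "U i a \<otimes> (\<Oplus>k\<in>pverts G. adjacency G k b \<odot> U i k) = adjacency G a b \<odot> U i a" .
  have "(\<Oplus>k\<in>pverts H. adjacency H i k \<odot> U k b) \<otimes> U j b = (\<Oplus>k\<in>pverts H. (adjacency H i k \<odot> U k b) \<otimes> U j b)"
    using finsum_ldistr[OF fin(2) cl(2)] v U by (auto simp: smult_laws)
  also have "\<dots> = (\<Oplus>k\<in>pverts H. if j = k then adjacency H i k \<odot> U k b else \<zero>)"
    using v U col_orthogonal[of b _ j] smult_r_null
    by (intro finsum_cong') (auto simp: smult_mult_left smult_laws complex_ring_simps)
  also have "\<dots> = adjacency H i j \<odot> U j b"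
    using add.finprod_singleton[OF v(4) fin(2), of "\<lambda>k. adjacency H i k \<odot> U k b"] v U
    by (simp add: smult_laws Pi_def)
  finally have r: "(\<Oplus>k\<in>pverts H. adjacency H i k \<odot> U k b) \<otimes> U j b = adjacency H i j \<odot> U j b" .
  have "adjacency G a b \<odot> (U i a \<otimes> U j b) = (adjacency G a b \<odot> U i a) \<otimes> U j b"
    using cl by (simp add: smult_mult_left)
  also have "\<dots> = U i a \<otimes> ((\<Oplus>k\<in>pverts G. adjacency G k b \<odot> U i k) \<otimes> U j b)"
    unfolding l[symmetric] using cl v U by (subst m_assoc) (auto intro!: finsum_closed simp: smult_laws)
  also have "(\<Oplus>k\<in>pverts G. adjacency G k b \<odot> U i k) = (\<Oplus>k\<in>pverts H. adjacency H i k \<odot> U k b)"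
    using quantum_isomorphism v by (simp add: quantum_isomorphism_def)
  also have "U i a \<otimes> ((\<Oplus>k\<in>pverts H. adjacency H i k \<odot> U k b) \<otimes> U j b) = adjacency H i j \<odot> (U i a \<otimes> U j b)"
    unfolding r using cl by (simp add: smult_mult_right)
  finally have "adjacency G a b = adjacency H i j"
    using smult_left_cancel[OF _ nz] cl by simp
  then show "((a, b) \<in> parcs G) = ((i, j) \<in> parcs H)" by (auto simp: adjacency_def split: if_splits)
qed

text \<open>The weight \<open>U i a \<otimes> U k c \<otimes> U j b\<close> is nonzero only if its
  first two and its last two factors have nonzero products, so \<open>T\<close> and \<open>S\<close>
  agree along its support.\<close>

lemma intertwined_sum:
  fixes \<phi> :: "'r \<Rightarrow> 't \<Rightarrow> 's \<Rightarrow> nat"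
  assumes R: "intertwined R R'" and T: "intertwined T T'" and S: "intertwined S S'"
  shows "intertwined (\<lambda>a b. \<Sum>c\<in>pverts G. \<phi> (R a b) (T a c) (S c b))
    (\<lambda>i j. \<Sum>k\<in>pverts H. \<phi> (R' i j) (T' i k) (S' k j))"
  unfolding intertwined_def
proof (intro ballI impI)
  fix a b i j
  assume v: "a \<in> pverts G" "b \<in> pverts G" "i \<in> pverts H" "j \<in> pverts H"
    and nz: "U i a \<otimes> U j b \<noteq> \<zero>"
  note cl = U(1)[OF v(3,1)] U(1)[OF v(4,2)]
  have "(\<Sum>c\<in>pverts G. complex_of_nat (\<phi> (R a b) (T a c) (S c b))) =
      (\<Sum>k\<in>pverts H. complex_of_nat (\<phi> (R' i j) (T' i k) (S' k j)))"
  proof (rule sum_eq_of_support[OF fin, where w = "\<lambda>k c. U i a \<otimes> U k c \<otimes> U j b" and z = "U i a \<otimes> U j b"])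
    fix c assume c: "c \<in> pverts G"
    show "(\<Oplus>k\<in>pverts H. U i a \<otimes> U k c \<otimes> U j b) = U i a \<otimes> U j b"
      using finsum_ldistr[OF fin(2) cl(2), of "\<lambda>k. U i a \<otimes> U k c"] col_expand(1)[OF cl(1) c] cl c U
      by (simp add: Pi_def)
  next
    fix k assume k: "k \<in> pverts H"
    show "(\<Oplus>c\<in>pverts G. U i a \<otimes> U k c \<otimes> U j b) = U i a \<otimes> U j b"
      using finsum_ldistr[OF fin(1) cl(2), of "\<lambda>c. U i a \<otimes> U k c"] row_expand(1)[OF cl(1) k] cl k U
      by (simp add: Pi_def)
  next
    fix k c assume kc: "k \<in> pverts H" "c \<in> pverts G" "U i a \<otimes> U k c \<otimes> U j b \<noteq> \<zero>"
    have "U i a \<otimes> U k c \<noteq> \<zero>" "U k c \<otimes> U j b \<noteq> \<zero>"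
      using kc(3) cl U(1)[OF kc(1,2)] by (auto simp: m_assoc[of "U i a"]) (metis l_null m_assoc)
    then have "T a c = T' i k" "S c b = S' k j" "R a b = R' i j"
      using intertwinedD[OF T] intertwinedD[OF S] intertwinedD[OF R nz] v kc by auto
    then show "complex_of_nat (\<phi> (R a b) (T a c) (S c b)) = of_nat (\<phi> (R' i j) (T' i k) (S' k j))"
      by simp
  qed (use cl U nz in auto)
  then show "(\<Sum>c\<in>pverts G. \<phi> (R a b) (T a c) (S c b)) = (\<Sum>k\<in>pverts H. \<phi> (R' i j) (T' i k) (S' k j))"
    by (simp flip: of_nat_sum)
qed

lemma intertwined_card:
  assumes R: "intertwined R R'" and T: "intertwined T T'" and S: "intertwined S S'"
  shows "intertwined (\<lambda>a b. card {c \<in> pverts G. Q (R a b) (T a c) (S c b)})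
    (\<lambda>i j. card {k \<in> pverts H. Q (R' i j) (T' i k) (S' k j)})"
  using intertwined_sum[OF assms, of "\<lambda>r t s. if Q r t s then 1 else 0"] fin
  by (simp add: sum.If_cases Int_def)

lemma card_eq_of_invariant:
  assumes "\<And>i a. i \<in> pverts H \<Longrightarrow> a \<in> pverts G \<Longrightarrow> U i a \<noteq> \<zero> \<Longrightarrow> P a \<longleftrightarrow> P' i"
  shows "card {a \<in> pverts G. P a} = card {i \<in> pverts H. P' i}"
  by (rule card_eq_of_support[OF fin, of U \<one>]) (use assms U col_sum row_sum one_neq_zero in auto)

end

section \<open>Corners and induced subgraphs\<close>

definition induced :: "'a pair_pre_digraph \<Rightarrow> 'a set \<Rightarrow> 'a pair_pre_digraph" where
  "induced G S = \<lparr> pverts = S, parcs = {(u, v) \<in> parcs G. u \<in> S \<and> v \<in> S} \<rparr>"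

lemma induced_simps [simp]:
  "pverts (induced G S) = S" "(u, v) \<in> parcs (induced G S) \<longleftrightarrow> (u, v) \<in> parcs G \<and> u \<in> S \<and> v \<in> S"
  by (auto simp: induced_def)

lemma pair_graph_induced:
  assumes "pair_graph G" "S \<subseteq> pverts G"
  shows "pair_graph (induced G S)"
proof -
  interpret pair_graph G by fact
  have "parcs (induced G S) \<subseteq> parcs G" by (auto simp: induced_def)
  then have "finite (parcs (induced G S))" "finite S"
    using finite_subset[OF _ pair_finite_arcs] finite_subset[OF assms(2) pair_finite_verts] by simp_all
  moreover have "symmetric (with_proj (induced G S))"
    using arcs_symmetric by (auto simp: symmetric_def sym_def)
  ultimately show ?thesis
    by unfold_locales (auto simp: induced_def dest: no_loops')
qed

context unital_cstar_algebra
begin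

definition corner :: "'x \<Rightarrow> 'x star_algebra" where
  "corner p = A\<lparr> carrier := {x \<in> carrier A. p \<otimes> x = x \<and> x \<otimes> p = x}, one := p \<rparr>"

lemma corner_simps:
  "carrier (corner p) = {x \<in> carrier A. p \<otimes> x = x \<and> x \<otimes> p = x}" "\<one>\<^bsub>corner p\<^esub> = p"
  "\<zero>\<^bsub>corner p\<^esub> = \<zero>" "x \<otimes>\<^bsub>corner p\<^esub> y = x \<otimes> y" "x \<oplus>\<^bsub>corner p\<^esub> y = x \<oplus> y"
  "c \<odot>\<^bsub>corner p\<^esub> x = c \<odot> x" "star (corner p) x = star A x" "nrm (corner p) x = nrm A x"
  by (simp_all add: corner_def)

lemma corner_cstar:
  assumes p: "projection p"
  shows "unital_cstar_algebra (corner p)"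
proof -
  let ?B = "corner p"
  have p': "p \<in> carrier A" "p \<otimes> p = p" "star A p = p" using p by (auto simp: projection_def)
  have assoc: "p \<otimes> (x \<otimes> y) = x \<otimes> y" "(x \<otimes> y) \<otimes> p = x \<otimes> y"
    if "x \<in> carrier ?B" "y \<in> carrier ?B" for x y
    using that p' m_assoc[of p x y] m_assoc[of x y p] by (auto simp: corner_simps)
  have ag: "abelian_group ?B"
  proof (rule abelian_groupI, goal_cases)
    case (6 x)
    then show ?case using p'
      by (intro bexI[of _ "\<ominus> x"]) (auto simp: corner_simps l_neg l_minus r_minus)
  qed (use p' in \<open>auto simp: corner_simps a_ac l_distr r_distr\<close>)
  interpret B: abelian_group ?B by fact
  have uminus: "\<ominus>\<^bsub>?B\<^esub> x = \<ominus> x" if "x \<in> carrier ?B" for x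
    by (rule B.minus_equality) (use that p' in \<open>auto simp: corner_simps l_neg l_minus r_minus\<close>)
  have minus: "x \<ominus>\<^bsub>?B\<^esub> y = x \<ominus> y" if "x \<in> carrier ?B" "y \<in> carrier ?B" for x y
    using that uminus[OF that(2)] by (simp add: B.minus_eq minus_eq corner_simps)
  have mod: "module complex_ring ?B"
    by (rule moduleI)
      (use p' in \<open>auto simp: ag cring_from_type_algebra corner_simps complex_ring_simps smult_laws
         smult_mult_left smult_mult_right\<close>)
  have mon: "monoid ?B"
    by (rule monoidI) (use p' assoc in \<open>auto simp: corner_simps m_assoc\<close>)
  have rng: "ring ?B"
    by (rule ringI) (use p' in \<open>auto simp: ag mon corner_simps l_distr r_distr\<close>)
  have cl: "x \<in> carrier A" if "x \<in> carrier ?B" for x using that by (simp add: corner_simps)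
  show ?thesis
  proof (intro unital_cstar_algebra.intro unital_cstar_algebra_axioms.intro mod rng, goal_cases)
    case (3 x)
    then show ?case using star_mult[of p x] star_mult[of x p] p' by (auto simp: corner_simps star_closed)
  next
    case (14 s)
    have s: "s n \<in> carrier ?B" for n using 14(1) .
    have "\<exists>x\<in>carrier A. (\<lambda>n. nrm A (s n \<ominus> x)) \<longlonglongrightarrow> 0"
    proof (rule complete)
      fix e :: real assume "0 < e"
      from 14(2)[OF this] show "\<exists>N. \<forall>m\<ge>N. \<forall>n\<ge>N. nrm A (s m \<ominus> s n) < e"
        using s by (simp add: minus corner_simps(8))
    qed (use s cl in auto)
    then obtain x where x: "x \<in> carrier A" "(\<lambda>n. nrm A (s n \<ominus> x)) \<longlonglongrightarrow> 0" by blast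
    \<comment> \<open>Multiplication by \<open>p\<close> does not increase the norm, so
      \<open>p \<otimes> x\<close> and \<open>x \<otimes> p\<close> are limits of the same sequence
      as \<open>x\<close>. Hence the corner is closed.\<close>
    have small: "y = x" if y: "y \<in> carrier A" "\<And>n. nrm A (s n \<ominus> y) \<le> nrm A (s n \<ominus> x)" for y
    proof -
      have "nrm A (y \<ominus> x) \<le> 2 * nrm A (s n \<ominus> x)" for n
        using nrm_diff_triangle[of y "s n" x] nrm_diff_commute[of y "s n"] y(2)[of n] y(1) x(1) cl[OF s[of n]]
        by simp
      moreover have "(\<lambda>n. 2 * nrm A (s n \<ominus> x)) \<longlonglongrightarrow> 0" using tendsto_mult_right_zero[OF x(2), of 2] by simp
      ultimately have "nrm A (y \<ominus> x) \<le> 0"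
        by (intro LIMSEQ_le_const[where X = "\<lambda>n. 2 * nrm A (s n \<ominus> x)"]) auto
      then have "nrm A (y \<ominus> x) = 0" using nrm_nonneg[of "y \<ominus> x"] x y by simp
      then show ?thesis using nrm_eq_0_iff[of "y \<ominus> x"] x y by simp
    qed
    have le: "nrm A p * nrm A z \<le> nrm A z" "nrm A z * nrm A p \<le> nrm A z" if "z \<in> carrier A" for z
      using projection_nrm[OF p] nrm_nonneg[OF that] nrm_nonneg[OF p'(1)]
      by (simp_all add: mult_left_le mult_left_le_one_le)
    have "p \<otimes> x = x"
    proof (rule small)
      fix n
      have "s n \<ominus> p \<otimes> x = p \<otimes> (s n \<ominus> x)"
        using s[of n] x p' by (simp add: corner_simps minus_eq r_distr r_minus)
      then show "nrm A (s n \<ominus> p \<otimes> x) \<le> nrm A (s n \<ominus> x)"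
        using nrm_mult[of p "s n \<ominus> x"] le(1)[of "s n \<ominus> x"] x p' cl[OF s[of n]] by simp
    qed (use x p' in simp)
    moreover have "x \<otimes> p = x"
    proof (rule small)
      fix n
      have "s n \<ominus> x \<otimes> p = (s n \<ominus> x) \<otimes> p"
        using s[of n] x p' by (simp add: corner_simps minus_eq l_distr l_minus)
      then show "nrm A (s n \<ominus> x \<otimes> p) \<le> nrm A (s n \<ominus> x)"
        using nrm_mult[of "s n \<ominus> x" p] le(2)[of "s n \<ominus> x"] x p' cl[OF s[of n]] by simp
    qed (use x p' in simp)
    ultimately have "x \<in> carrier ?B" using x by (simp add: corner_simps)
    then show ?case using x(2) s by (intro bexI[of _ x]) (simp_all add: minus corner_simps(8))
  qed (use p' assoc in \<open>auto simp: corner_simps smult_mult_left smult_mult_right star_star star_add star_smult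
         star_mult nrm_nonneg nrm_eq_0_iff nrm_smult cstar_identity intro!: nrm_triangle nrm_mult\<close>)
qed

lemma finsum_corner:
  assumes p: "projection p" and "finite S" "\<And>a. a \<in> S \<Longrightarrow> f a \<in> carrier (corner p)"
  shows "(\<Oplus>\<^bsub>corner p\<^esub>a\<in>S. f a) = (\<Oplus>a\<in>S. f a)"
proof -
  interpret B: unital_cstar_algebra "corner p" using corner_cstar[OF p] .
  show ?thesis using assms(2,3)
  proof (induction S rule: finite_induct)
    case empty
    then show ?case by (simp add: B.finsum_empty corner_simps(3))
  next
    case (insert x S)
    have "(\<Oplus>\<^bsub>corner p\<^esub>a\<in>insert x S. f a) = f x \<oplus>\<^bsub>corner p\<^esub> (\<Oplus>\<^bsub>corner p\<^esub>a\<in>S. f a)"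
      by (rule B.finsum_insert) (use insert in auto)
    also have "\<dots> = f x \<oplus> (\<Oplus>a\<in>S. f a)" using insert by (simp add: corner_simps(5))
    also have "\<dots> = (\<Oplus>a\<in>insert x S. f a)"
      by (rule finsum_insert[symmetric]) (use insert in \<open>auto simp: corner_simps(1)\<close>)
    finally show ?case .
  qed
qed

lemma finsum_mono_neutral:
  assumes "finite T" "S \<subseteq> T" "\<And>a. a \<in> T \<Longrightarrow> f a \<in> carrier A" "\<And>a. a \<in> T - S \<Longrightarrow> f a = \<zero>"
  shows "(\<Oplus>a\<in>S. f a) = (\<Oplus>a\<in>T. f a)"
  by (rule add.finprod_mono_neutral_cong_left) (use assms in auto)

end

context quantum_iso
begin

text \<open>In the corner of \<open>p\<close> the part of \<open>U\<close> indexed by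
  \<open>S'\<close> and \<open>S\<close> becomes a magic unitary: commutation makes the entries
  \<open>p \<otimes> U i a\<close> projections, and the vanishing of the mixed entries lets the
  truncated rows and columns still sum to \<open>p\<close>.\<close>

lemma quantum_isomorphic_induced:
  assumes p: "projection p" "p \<noteq> \<zero>"
    and S: "S \<subseteq> pverts G" "S' \<subseteq> pverts H"
    and comm: "\<And>i a. i \<in> S' \<Longrightarrow> a \<in> S \<Longrightarrow> p \<otimes> U i a = U i a \<otimes> p"
    and zero: "\<And>i a. i \<in> pverts H \<Longrightarrow> a \<in> pverts G \<Longrightarrow> (i \<in> S') \<noteq> (a \<in> S) \<Longrightarrow> p \<otimes> U i a = \<zero>"
  shows "quantum_isomorphic (induced G S) (induced H S')"
proof -
  let ?B = "corner p"
  define w where "w i a = p \<otimes> U i a" for i a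
  have p': "p \<in> carrier A" "p \<otimes> p = p" "star A p = p" using p by (auto simp: projection_def)
  have v: "i \<in> S' \<Longrightarrow> i \<in> pverts H" "a \<in> S \<Longrightarrow> a \<in> pverts G" for i a using S by auto
  have fS: "finite S" "finite S'" using S fin finite_subset by auto
  have w: "w i a \<in> carrier ?B" "w i a \<otimes> w i a = w i a" "star A (w i a) = w i a"
    if "i \<in> S'" "a \<in> S" for i a
  proof -
    note u = U[OF v(1)[OF that(1)] v(2)[OF that(2)]] and cm = comm[OF that]
    have wp: "w i a \<otimes> p = w i a" using u p' cm m_assoc[of p "U i a" p] m_assoc[of p p "U i a"]
      by (simp add: w_def)
    then show "w i a \<in> carrier ?B" using u p' m_assoc[of p p "U i a"] by (simp add: corner_simps w_def)
    have "w i a \<otimes> w i a = (w i a \<otimes> p) \<otimes> U i a" unfolding w_def using u p' by (simp add: m_assoc)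
    also have "\<dots> = w i a" unfolding wp using u p' by (simp add: w_def m_assoc)
    finally show "w i a \<otimes> w i a = w i a" .
    show "star A (w i a) = w i a" using u p' cm by (simp add: w_def star_mult)
  qed
  have wA: "w i a \<in> carrier A" "p \<otimes> w i a = w i a" "w i a \<otimes> p = w i a" if "i \<in> S'" "a \<in> S" for i a
    using w(1)[OF that] by (auto simp: corner_simps)
  have col: "(\<Oplus>i\<in>S'. w i a) = p" if "a \<in> S" for a
    using finsum_mono_neutral[OF fin(2) S(2), of "\<lambda>i. w i a"] col_expand(1)[OF p'(1), of a]
      zero[OF _ v(2)[OF that]] U[OF _ v(2)[OF that]] p' that v(2)[OF that] by (auto simp: w_def)
  have row: "(\<Oplus>a\<in>S. w i a) = p" if "i \<in> S'" for i
    using finsum_mono_neutral[OF fin(1) S(1), of "\<lambda>a. w i a"] row_expand(1)[OF p'(1), of i]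
      zero[OF v(1)[OF that]] U[OF v(1)[OF that]] p' that v(1)[OF that] by (auto simp: w_def)
  \<comment> \<open>Rows and columns of \<open>w\<close> all sum to the same nonzero
    \<open>p\<close>, which forces \<open>S\<close> and \<open>S'\<close> to have equal
    size.\<close>
  have "card {a \<in> S. True} = card {i \<in> S'. True}"
    by (rule card_eq_of_support[OF fS, of w p]) (use wA col row p p' in auto)
  then have card: "card S = card S'" by simp
  have "quantum_isomorphism ?B (induced G S) (induced H S') w"
    unfolding quantum_isomorphism_def magic_unitary_def induced_simps
  proof (intro conjI ballI)
    show "finite S" "finite S'" by (fact fS)+
    show "card S = card S'" by (fact card)
  next
    fix a assume "a \<in> S"
    then show "(\<Oplus>\<^bsub>?B\<^esub>k\<in>S'. w k a) = \<one>\<^bsub>?B\<^esub>"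
      by (subst finsum_corner[OF p(1) fS(2)]) (use w col in \<open>auto simp: corner_simps(2)\<close>)
  next
    fix i assume "i \<in> S'"
    then show "(\<Oplus>\<^bsub>?B\<^esub>k\<in>S. w i k) = \<one>\<^bsub>?B\<^esub>"
      by (subst finsum_corner[OF p(1) fS(1)]) (use w row in \<open>auto simp: corner_simps(2)\<close>)
  next
    fix i b assume ib: "i \<in> S'" "b \<in> S"
    have sm: "c \<odot> w k a \<in> carrier ?B" if "k \<in> S'" "a \<in> S" for c k a
      using wA[OF that] p' by (simp add: corner_simps smult_laws smult_mult_left smult_mult_right)
    have support: "adjacency (induced G S) a b = adjacency (induced H S') i k"
      if ak: "k \<in> S'" "a \<in> S" and nz: "w i a \<otimes> w k b \<noteq> \<zero>" for a k
    proof -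
      have "w i a \<otimes> w k b = (p \<otimes> U i a) \<otimes> (U k b \<otimes> p)"
        using comm[OF ak(1) ib(2)] by (simp add: w_def)
      also have "\<dots> = p \<otimes> (U i a \<otimes> U k b) \<otimes> p"
        using p' U[OF v(1)[OF ib(1)] v(2)[OF ak(2)]] U[OF v(1)[OF ak(1)] v(2)[OF ib(2)]]
        by (simp add: m_assoc)
      finally have "U i a \<otimes> U k b \<noteq> \<zero>" using nz p' by auto
      then have "((a, b) \<in> parcs G) = ((i, k) \<in> parcs H)"
        using intertwinedD[OF intertwined_adjacent] v ib ak by blast
      then show ?thesis using ib ak by (simp add: adjacency_def)
    qed
    have "(\<Oplus>\<^bsub>?B\<^esub>a\<in>S. adjacency (induced G S) a b \<odot>\<^bsub>?B\<^esub> w i a) = (\<Oplus>a\<in>S. adjacency (induced G S) a b \<odot> w i a)"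
      unfolding corner_simps(6) by (rule finsum_corner[OF p(1) fS(1)]) (use sm ib in auto)
    also have "\<dots> = (\<Oplus>k\<in>S'. adjacency (induced H S') i k \<odot> w k b)"
    proof (rule finsum_eq_of_support[OF fS, where w = "\<lambda>k a. w i a \<otimes> w k b"])
      show "w i a \<otimes> w k b \<in> carrier A" if "k \<in> S'" "a \<in> S" for k a using wA that ib by simp
      show "(\<Oplus>k\<in>S'. w i a \<otimes> w k b) = w i a" if "a \<in> S" for a
        using finsum_rdistr[OF fS(2) wA(1)[OF ib(1) that], of "\<lambda>k. w k b"] col[OF ib(2)] wA ib that by auto
      show "(\<Oplus>a\<in>S. w i a \<otimes> w k b) = w k b" if "k \<in> S'" for k
        using finsum_ldistr[OF fS(1) wA(1)[OF that ib(2)], of "w i"] row[OF ib(1)] wA ib that by auto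
    qed (fact support)
    also have "\<dots> = (\<Oplus>\<^bsub>?B\<^esub>k\<in>S'. adjacency (induced H S') i k \<odot>\<^bsub>?B\<^esub> w k b)"
      unfolding corner_simps(6) by (rule finsum_corner[OF p(1) fS(2), symmetric]) (use sm ib in auto)
    finally show "(\<Oplus>\<^bsub>?B\<^esub>a\<in>S. adjacency (induced G S) a b \<odot>\<^bsub>?B\<^esub> w i a) =
      (\<Oplus>\<^bsub>?B\<^esub>k\<in>S'. adjacency (induced H S') i k \<odot>\<^bsub>?B\<^esub> w k b)" .
  qed (use w in \<open>auto simp: corner_simps(4,7)\<close>)
  then show ?thesis using quantum_isomorphicI[OF corner_cstar[OF p(1)]] p(2) by (simp add: corner_simps)
qed

end

context unital_cstar_algebra
begin

lemma star_finsum: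
  assumes "finite S" "\<And>a. a \<in> S \<Longrightarrow> f a \<in> carrier A"
  shows "star A (\<Oplus>a\<in>S. f a) = (\<Oplus>a\<in>S. star A (f a))"
  using assms
proof (induction S rule: finite_induct)
  case empty
  then show ?case by (simp add: star_zero)
next
  case (insert x S)
  have "star A (\<Oplus>a\<in>insert x S. f a) = star A (f x \<oplus> (\<Oplus>a\<in>S. f a))"
    by (subst finsum_insert) (use insert in auto)
  also have "\<dots> = star A (f x) \<oplus> (\<Oplus>a\<in>S. star A (f a))"
    using insert by (subst star_add) (auto intro!: finsum_closed)
  also have "\<dots> = (\<Oplus>a\<in>insert x S. star A (f a))"
    by (rule finsum_insert[symmetric]) (use insert star_closed in auto)
  finally show ?case .
qed

end

context quantum_iso
begin

section \<open>The projection attached to a class of vertices\<close>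

context
  fixes E :: "'g \<Rightarrow> 'g \<Rightarrow> bool" and E' :: "'h \<Rightarrow> 'h \<Rightarrow> bool" and i :: 'h
  assumes E: "intertwined E E'"
    and E_sym: "\<And>a b. a \<in> pverts G \<Longrightarrow> b \<in> pverts G \<Longrightarrow> E a b \<Longrightarrow> E b a"
    and E'_refl: "E' i i"
    and E'_class: "\<And>k l. k \<in> pverts H \<Longrightarrow> l \<in> pverts H \<Longrightarrow> E' i k \<Longrightarrow> E' k l \<longleftrightarrow> E' i l"
    and i: "i \<in> pverts H"
begin

text \<open>The event that \<open>a\<close> is sent into the class of \<open>i\<close>. By
  \<open>class_projection_cong\<close> it depends only on the class of \<open>a\<close>.\<close>

definition class_projection :: "'g \<Rightarrow> 'x" where
  "class_projection a = (\<Oplus>k\<in>{k \<in> pverts H. E' i k}. U k a)"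

lemma class_projection_closed: "a \<in> pverts G \<Longrightarrow> class_projection a \<in> carrier A"
  using U by (auto simp: class_projection_def intro!: finsum_closed)

lemma class_projection_star: "a \<in> pverts G \<Longrightarrow> star A (class_projection a) = class_projection a"
  unfolding class_projection_def using U fin
  by (subst star_finsum) (auto intro!: finsum_cong')

lemma class_projection_mult_expand:
  assumes "a \<in> pverts G" "x \<in> carrier A"
  shows "class_projection a \<otimes> x = (\<Oplus>k\<in>{k \<in> pverts H. E' i k}. U k a \<otimes> x)"
  unfolding class_projection_def using assms U fin by (intro finsum_ldistr) auto

text \<open>The value \<open>R' l k\<close> is the same for all \<open>l\<close> in the class of
  \<open>i\<close>, so one mismatch annihilates every summand.\<close>

lemma class_projection_mult_zero:
  assumes "intertwined R R'" and "a \<in> pverts G" "b \<in> pverts G" "k \<in> pverts H"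
    and "\<And>l. l \<in> pverts H \<Longrightarrow> E' i l \<Longrightarrow> R' l k \<longleftrightarrow> R' i k"
    and "R a b \<noteq> R' i k"
  shows "class_projection a \<otimes> U k b = \<zero>" "U k b \<otimes> class_projection a = \<zero>"
proof -
  have "U l a \<otimes> U k b = \<zero>" if "l \<in> pverts H" "E' i l" for l
    using intertwinedD[OF assms(1), of l a k b] assms that by blast
  then show *: "class_projection a \<otimes> U k b = \<zero>"
    using assms U by (subst class_projection_mult_expand) (auto intro!: add.finprod_one_eqI)
  have "star A (class_projection a \<otimes> U k b) = U k b \<otimes> class_projection a"
    using assms U class_projection_closed class_projection_star by (simp add: star_mult)
  then show "U k b \<otimes> class_projection a = \<zero>" using * star_zero by simp
qed

lemma class_projection_mult_U:
  assumes "a \<in> pverts G" "k \<in> pverts H" "E' i k"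
  shows "class_projection a \<otimes> U k a = U k a" "U k a \<otimes> class_projection a = U k a"
proof -
  have "class_projection a \<otimes> U k a = (\<Oplus>l\<in>{k \<in> pverts H. E' i k}. if k = l then U l a else \<zero>)"
    using assms U col_orthogonal[of a _ k]
    by (subst class_projection_mult_expand) (auto intro!: finsum_cong')
  also have "\<dots> = U k a"
    using add.finprod_singleton[of k "{k \<in> pverts H. E' i k}" "\<lambda>l. U l a"] assms U fin by auto
  finally show *: "class_projection a \<otimes> U k a = U k a" .
  have "star A (class_projection a \<otimes> U k a) = U k a \<otimes> class_projection a"
    using assms U class_projection_closed class_projection_star by (simp add: star_mult)
  then show "U k a \<otimes> class_projection a = U k a" using * assms U by simp
qed

text \<open>Expand the left factor along the whole column of \<open>b\<close>. The terms with
  \<open>k\<close> outside the class vanish because \<open>E a b\<close> holds, and the remaining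
  ones form the right factor.\<close>

lemma class_projection_absorb:
  assumes ab: "a \<in> pverts G" "b \<in> pverts G" "E a b"
  shows "class_projection a \<otimes> class_projection b = class_projection a"
proof -
  note cl = class_projection_closed[OF ab(1)] class_projection_closed[OF ab(2)]
  have "class_projection a \<otimes> U k b = \<zero>" if "k \<in> pverts H" "\<not> E' i k" for k
    by (rule class_projection_mult_zero(1)[OF E]) (use ab that E'_class in auto)
  then have "(\<Oplus>k\<in>{k \<in> pverts H. E' i k}. class_projection a \<otimes> U k b) =
      (\<Oplus>k\<in>pverts H. class_projection a \<otimes> U k b)"
    by (intro finsum_mono_neutral) (use fin cl U ab in auto)
  also have "\<dots> = class_projection a" using col_expand(1)[OF cl(1) ab(2)] .
  finally show ?thesis
    unfolding class_projection_def[of b] using cl U fin ab by (subst finsum_rdistr) auto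
qed

lemma class_projection_cong:
  assumes ab: "a \<in> pverts G" "b \<in> pverts G" "E a b"
  shows "class_projection a = class_projection b"
proof -
  have "class_projection a = star A (class_projection a \<otimes> class_projection b)"
    using class_projection_absorb[OF ab] class_projection_star ab by simp
  also have "\<dots> = class_projection b \<otimes> class_projection a"
    using ab class_projection_closed class_projection_star by (simp add: star_mult)
  also have "\<dots> = class_projection b" using class_projection_absorb[OF ab(2,1) E_sym] ab by simp
  finally show ?thesis .
qed

text \<open>Besides the class, \<open>Z'\<close> may cut out one further vertex; for a block this is
  the root vertex, which other blocks share. Entries inside the class commute with the projection
  because it depends only on the class, mixed entries are annihilated by it, and the entry at the
  further vertex dominates it.\<close>

lemma quantum_isomorphic_class:
  assumes Z: "intertwined Z Z'"
    and Z'_class: "\<And>k l. k \<in> pverts H \<Longrightarrow> l \<in> pverts H \<Longrightarrow> E' i k \<Longrightarrow> Z' k l \<longleftrightarrow> Z' i l"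
    and unique: "\<And>k l. k \<in> pverts H \<Longrightarrow> l \<in> pverts H \<Longrightarrow> Z' i k \<Longrightarrow> Z' i l \<Longrightarrow>
      \<not> E' i k \<Longrightarrow> \<not> E' i l \<Longrightarrow> k = l"
    and a: "a \<in> pverts G" and nz: "U i a \<noteq> \<zero>" and E_refl: "E a a"
  shows "quantum_isomorphic (induced G {b \<in> pverts G. Z a b}) (induced H {k \<in> pverts H. Z' i k})"
proof (rule quantum_isomorphic_induced[where p = "class_projection a"])
  note cl = class_projection_closed[OF a]
  show "projection (class_projection a)"
    using class_projection_absorb[OF a a E_refl] class_projection_star[OF a] cl by (simp add: projection_def)
  show "class_projection a \<noteq> \<zero>"
    using class_projection_mult_U(1)[OF a i E'_refl] nz U i a by auto
  show "{b \<in> pverts G. Z a b} \<subseteq> pverts G" "{k \<in> pverts H. Z' i k} \<subseteq> pverts H" by auto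
  show "class_projection a \<otimes> U k b = \<zero>"
    if "k \<in> pverts H" "b \<in> pverts G" "(k \<in> {k \<in> pverts H. Z' i k}) \<noteq> (b \<in> {b \<in> pverts G. Z a b})" for k b
    by (rule class_projection_mult_zero(1)[OF Z]) (use that a Z'_class in auto)
  show "class_projection a \<otimes> U k b = U k b \<otimes> class_projection a"
    if "k \<in> {k \<in> pverts H. Z' i k}" "b \<in> {b \<in> pverts G. Z a b}" for k b
  proof -
    have kb: "k \<in> pverts H" "b \<in> pverts G" "Z' i k" "Z a b" using that by auto
    consider "E a b \<noteq> E' i k" | "E a b" "E' i k" | "\<not> E a b" "\<not> E' i k" by blast
    then show ?thesis
    proof cases
      case 1
      have "class_projection a \<otimes> U k b = \<zero>" "U k b \<otimes> class_projection a = \<zero>"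
        by (rule class_projection_mult_zero[OF E]; use 1 kb a E'_class in auto)+
      then show ?thesis by simp
    next
      case 2
      then show ?thesis
        using class_projection_cong[OF a kb(2)] class_projection_mult_U[OF kb(2,1)] by simp
    next
      case 3
      \<comment> \<open>Both \<open>b\<close> and \<open>k\<close> lie beyond the class here. By
        \<open>unique\<close> no other entry in the column of \<open>b\<close> meets the projection,
        so \<open>U k b\<close> acts on it as the identity.\<close>
      have "class_projection a \<otimes> U m b = \<zero>" if m: "m \<in> pverts H" "m \<noteq> k" for m
      proof (cases "E' i m")
        case True
        show ?thesis by (rule class_projection_mult_zero(1)[OF E]) (use True 3 m kb a E'_class in auto)
      next
        case False
        show ?thesis
          by (rule class_projection_mult_zero(1)[OF Z]) (use False 3 m kb a Z'_class unique in auto)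
      qed
      then have "(\<Oplus>m\<in>{k}. class_projection a \<otimes> U m b) = (\<Oplus>m\<in>pverts H. class_projection a \<otimes> U m b)"
        by (intro finsum_mono_neutral) (use fin cl U kb in auto)
      also have "\<dots> = class_projection a" using col_expand(1)[OF cl kb(2)] .
      finally have *: "class_projection a \<otimes> U k b = class_projection a"
        using cl U kb by simp
      have "star A (class_projection a \<otimes> U k b) = U k b \<otimes> class_projection a"
        using U kb cl class_projection_star[OF a] by (simp add: star_mult)
      then show ?thesis using * class_projection_star[OF a] by simp
    qed
  qed
qed

end

end

section \<open>Walks and separation\<close>

primrec walk_count :: "'a set \<Rightarrow> 'a rel \<Rightarrow> nat \<Rightarrow> 'a \<Rightarrow> 'a \<Rightarrow> nat" where
  "walk_count V R 0 x y = (if x = y then 1 else 0)"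
| "walk_count V R (Suc m) x y = (\<Sum>z\<in>V. if (x, z) \<in> R then walk_count V R m z y else 0)"

text \<open>Products of series correspond to concatenation of walks, and over the integers nonzero
  series can be cancelled.\<close>

definition walk_series :: "'a set \<Rightarrow> 'a rel \<Rightarrow> 'a \<Rightarrow> 'a \<Rightarrow> int fps" where
  "walk_series V R x y = Abs_fps (\<lambda>m. int (walk_count V R m x y))"

lemma walk_series_unfold:
  "walk_series V R x y = (if x = y then 1 else 0) +
     fps_X * (\<Sum>z\<in>V. if (x, z) \<in> R then walk_series V R z y else 0)"
proof (rule fps_ext)
  fix m
  show "fps_nth (walk_series V R x y) m = fps_nth ((if x = y then 1 else 0) +
     fps_X * (\<Sum>z\<in>V. if (x, z) \<in> R then walk_series V R z y else 0)) m"
    by (cases m) (auto simp: walk_series_def fps_sum_nth of_nat_sum intro!: sum.cong)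
qed

lemma walk_series_neq_0_iff:
  assumes V: "finite V" and R: "R \<subseteq> V \<times> V"
  shows "walk_series V R x y \<noteq> 0 \<longleftrightarrow> (x, y) \<in> R\<^sup>*"
proof -
  have "walk_count V R m x y \<noteq> 0 \<longleftrightarrow> (x, y) \<in> R ^^ m" for m
  proof (induction m arbitrary: x)
    case (Suc m)
    have "walk_count V R (Suc m) x y \<noteq> 0 \<longleftrightarrow> (\<exists>z\<in>V. (x, z) \<in> R \<and> (z, y) \<in> R ^^ m)"
      using V Suc by (auto simp: sum_eq_0_iff split: if_splits)
    also have "\<dots> \<longleftrightarrow> (x, y) \<in> R ^^ Suc m"
      using R by (auto simp: relpow_commute[symmetric])
    finally show ?case .
  qed auto
  then show ?thesis by (auto simp: walk_series_def fps_eq_iff rtrancl_power)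
qed

definition avoiding :: "'a rel \<Rightarrow> 'a \<Rightarrow> 'a rel" where
  "avoiding R c = {(u, v) \<in> R. u \<noteq> c \<and> v \<noteq> c}"

text \<open>Splitting a walk at its first visit to \<open>c\<close>, with both sides multiplied by the series of closed walks at \<open>c\<close>.\<close>

lemma walk_series_first_visit:
  assumes V: "finite V" "c \<in> V" and y: "y \<noteq> c"
  shows "walk_series V R x y * walk_series V R c c =
    walk_series V (avoiding R c) x y * walk_series V R c c + walk_series V R x c * walk_series V R c y"
proof -
  let ?W = "walk_series V R" and ?F = "walk_series V (avoiding R c)"
  \<comment> \<open>The difference of the two sides vanishes at \<open>c\<close> and satisfies a
    homogeneous recursion with a factor \<open>fps_X\<close> elsewhere, so its coefficients vanish
    one after the other.\<close>
  define D where "D x = ?W x y * ?W c c - (?F x y * ?W c c + ?W x c * ?W c y)" for x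
  have Fc: "?F c y = 0" by (subst walk_series_unfold) (use y in \<open>auto simp: avoiding_def\<close>)
  then have Dc: "D c = 0" by (simp add: D_def)
  have D: "D x = fps_X * (\<Sum>z\<in>V. if (x, z) \<in> R then D z else 0)" if x: "x \<noteq> c" for x
  proof -
    have F: "(\<Sum>z\<in>V. if (x, z) \<in> avoiding R c then ?F z y else 0) = (\<Sum>z\<in>V. if (x, z) \<in> R then ?F z y else 0)"
      by (rule sum.cong) (use x Fc in \<open>auto simp: avoiding_def\<close>)
    have "D x = fps_X * ((\<Sum>z\<in>V. if (x, z) \<in> R then ?W z y else 0) * ?W c c
        - ((\<Sum>z\<in>V. if (x, z) \<in> R then ?F z y else 0) * ?W c c
          + (\<Sum>z\<in>V. if (x, z) \<in> R then ?W z c else 0) * ?W c y))"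
      unfolding D_def walk_series_unfold[of V R x y] walk_series_unfold[of V R x c]
        walk_series_unfold[of V "avoiding R c" x y] F
      using x by (simp add: algebra_simps)
    also have "\<dots> = fps_X * (\<Sum>z\<in>V. if (x, z) \<in> R then D z else 0)"
      unfolding sum_distrib_right sum.distrib[symmetric] sum_subtractf[symmetric] D_def
      by (intro arg_cong2[where f = "(*)"] sum.cong refl) auto
    finally show ?thesis .
  qed
  have "fps_nth (D x) m = 0" for m
  proof (induction m arbitrary: x)
    case 0
    show ?case
    proof (cases "x = c")
      case False
      then show ?thesis by (subst D) simp_all
    qed (simp add: Dc)
  next
    case (Suc m)
    show ?case
    proof (cases "x = c")
      case False
      then show ?thesis using Suc by (subst D) (simp_all add: fps_sum_nth sum.neutral)
    qed (simp add: Dc)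
  qed
  then have "D x = 0" by (simp add: fps_eq_iff)
  then show ?thesis by (simp add: D_def)
qed

text \<open>The endpoints count as separating because the product identity for \<open>c\<close>
  holds trivially when \<open>c\<close> is an endpoint.\<close>

definition separates :: "'a rel \<Rightarrow> 'a \<Rightarrow> 'a \<Rightarrow> 'a \<Rightarrow> bool" where
  "separates R c x y \<longleftrightarrow> x = c \<or> y = c \<or> (x, y) \<notin> (avoiding R c)\<^sup>*"

text \<open>The two products differ by the series of walks avoiding \<open>c\<close> times that of
  closed walks at \<open>c\<close>. The latter begins with the empty walk, so it is nonzero and
  cancels.\<close>

lemma separates_iff_walk_series:
  assumes V: "finite V" "c \<in> V" and R: "R \<subseteq> V \<times> V"
  shows "separates R c x y \<longleftrightarrow>
    walk_series V R x y * walk_series V R c c = walk_series V R x c * walk_series V R c y"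
proof (cases "x = c \<or> y = c")
  case True
  then show ?thesis by (auto simp: separates_def mult.commute)
next
  case False
  have "fps_nth (walk_series V R c c) 0 = 1" by (simp add: walk_series_def)
  then have nz: "walk_series V R c c \<noteq> 0" by auto
  have "avoiding R c \<subseteq> V \<times> V" using R by (auto simp: avoiding_def)
  then have "separates R c x y \<longleftrightarrow> walk_series V (avoiding R c) x y = 0"
    using False walk_series_neq_0_iff[OF V(1), of "avoiding R c" x y] by (auto simp: separates_def)
  then show ?thesis
    using False nz walk_series_first_visit[OF V, of y R x] by auto
qed

section \<open>The rooted block tree\<close>

text \<open>In a connected graph this is the relation of lying in a common block; adjacent vertices
  always do.\<close>

definition bonded :: "'a set \<Rightarrow> 'a rel \<Rightarrow> 'a \<Rightarrow> 'a \<Rightarrow> bool" where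
  "bonded V R x y \<longleftrightarrow> x \<noteq> y \<and> (\<forall>c\<in>V. c \<noteq> x \<longrightarrow> c \<noteq> y \<longrightarrow> \<not> separates R c x y)"

text \<open>The vertex \<open>y\<close> lies behind itself, which makes the majority in
  \<open>parent_of_separated\<close> strict.\<close>

definition behind :: "'a set \<Rightarrow> 'a rel \<Rightarrow> 'a \<Rightarrow> 'a \<Rightarrow> 'a set" where
  "behind V R x y = {z \<in> V. separates R y x z}"

text \<open>
  Two bonded vertices lie in exactly one block. The vertex of a block behind which, seen from the
  block, lies more than half of the graph is the parent of all other vertices of the block. At most
  one block has no such vertex, so this roots the block tree.
\<close>

definition parent :: "'a set \<Rightarrow> 'a rel \<Rightarrow> 'a \<Rightarrow> 'a \<Rightarrow> bool" where
  "parent V R x y \<longleftrightarrow> bonded V R x y \<and> card V < 2 * card (behind V R x y)"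

text \<open>In a connected graph the classes are the blocks without their root vertices, the whole
  block if one has no root vertex, and the single vertex that is the parent of everything bonded to
  it, if there is one.\<close>

definition sibling :: "'a set \<Rightarrow> 'a rel \<Rightarrow> 'a \<Rightarrow> 'a \<Rightarrow> bool" where
  "sibling V R x y \<longleftrightarrow> x = y \<or> bonded V R x y \<and> \<not> parent V R x y \<and> \<not> parent V R y x"

definition block_set :: "'a set \<Rightarrow> 'a rel \<Rightarrow> 'a \<Rightarrow> 'a \<Rightarrow> 'a set" where
  "block_set V R x y = {z \<in> V. z = x \<or> z = y \<or> bonded V R x z \<and> bonded V R y z}"

text \<open>The only block through \<open>x\<close> whose root vertex is not \<open>x\<close>, or
  just \<open>{x}\<close> if there is none.\<close>

definition hood :: "'a set \<Rightarrow> 'a rel \<Rightarrow> 'a \<Rightarrow> 'a set" where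
  "hood V R x = {z \<in> V. sibling V R x z \<or> parent V R x z}"

locale connected_rel =
  fixes V :: "'a set" and R :: "'a rel"
  assumes finV: "finite V" and RV: "R \<subseteq> V \<times> V" and symR: "sym R" and irreflR: "irrefl R"
    and conn: "\<And>x y. x \<in> V \<Longrightarrow> y \<in> V \<Longrightarrow> (x, y) \<in> R\<^sup>*"
begin

abbreviation "sep \<equiv> separates R"
abbreviation "bond \<equiv> bonded V R"
abbreviation "par \<equiv> parent V R"
abbreviation "sib \<equiv> sibling V R"

lemma sym_avoiding: "sym ((avoiding R c)\<^sup>*)"
  using symR by (intro sym_rtrancl) (auto simp: avoiding_def sym_def)

lemma sep_sym: "sep c x y \<longleftrightarrow> sep c y x"
  using sym_avoiding[of c] by (auto simp: separates_def sym_def)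

lemma sep_trans: "sep c x z \<Longrightarrow> sep c x y \<or> sep c y z"
  unfolding separates_def by (meson rtrancl_trans)

lemma sep_refl: "sep c x x \<longleftrightarrow> x = c"
  by (auto simp: separates_def)

lemma sep_end [simp]: "sep c x c" "sep c c x"
  by (auto simp: separates_def)

lemma not_sep_edge: "(x, y) \<in> R \<Longrightarrow> x \<noteq> c \<Longrightarrow> y \<noteq> c \<Longrightarrow> \<not> sep c x y"
  by (auto simp: separates_def avoiding_def)

text \<open>A walk from \<open>w\<close> towards \<open>y\<close> reaches one of \<open>y\<close>
  and \<open>z\<close> first, and up to there it avoids the other.\<close>

lemma first_hit:
  assumes "w \<in> V" "y \<in> V" "w \<noteq> y" "w \<noteq> z" "y \<noteq> z" "sep z w y"
  shows "\<not> sep y w z"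
proof -
  have "w \<noteq> y \<longrightarrow> w \<noteq> z \<longrightarrow> \<not> sep z w y \<or> \<not> sep y w z" if "(w, y) \<in> R\<^sup>*" for w
    using that
  proof (induction rule: converse_rtrancl_induct)
    case (step w v)
    show ?case
    proof (intro impI)
      assume w: "w \<noteq> y" "w \<noteq> z"
      show "\<not> sep z w y \<or> \<not> sep y w z"
      proof (cases "v = y \<or> v = z")
        case True
        then show ?thesis using not_sep_edge[OF step(1)] w assms(5) by auto
      next
        case False
        then show ?thesis
          using step(3) not_sep_edge[OF step(1)] w sep_trans[of z w y v] sep_trans[of y w z v] by blast
      qed
    qed
  qed simp
  then show ?thesis using conn assms by blast
qed

lemma bond_sym: "bond x y \<longleftrightarrow> bond y x"
  using sep_sym by (auto simp: bonded_def)

lemma bondD: "bond x y \<Longrightarrow> c \<in> V \<Longrightarrow> c \<noteq> x \<Longrightarrow> c \<noteq> y \<Longrightarrow> \<not> sep c x y"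
  by (auto simp: bonded_def)

lemma bond_neq: "bond x y \<Longrightarrow> x \<noteq> y"
  by (auto simp: bonded_def)

lemma bond_edge: "(x, y) \<in> R \<Longrightarrow> bond x y"
  using not_sep_edge irreflR by (auto simp: bonded_def irrefl_def)

text \<open>Any separator of \<open>x\<close> and \<open>z\<close> other than \<open>y\<close> would
  already separate one of the two bonded pairs.\<close>

lemma bond_trans:
  assumes "bond x y" "bond y z" "x \<noteq> z" "\<not> bond x z"
  shows "sep y x z"
proof -
  obtain c where c: "c \<in> V" "c \<noteq> x" "c \<noteq> z" "sep c x z" using assms by (auto simp: bonded_def)
  then show ?thesis using sep_trans[of c x z y] bondD[OF assms(1), of c] bondD[OF assms(2), of c] by blast
qed

lemma bond_trans':
  assumes "bond x y" "bond y z" "x \<noteq> z" "\<not> sep y x z"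
  shows "bond x z"
  using bond_trans assms by blast

lemma behind_cong: "\<not> sep y x z \<Longrightarrow> behind V R x y = behind V R z y"
  using sep_trans sep_sym unfolding behind_def by blast

lemma behind_subset: "behind V R x y \<subseteq> V"
  by (auto simp: behind_def)

lemma finite_behind: "finite (behind V R x y)"
  using finite_subset[OF behind_subset finV] .

lemma not_both_majority:
  assumes "S \<subseteq> V" "T \<subseteq> V" "S \<inter> T = {}" "card V < 2 * card S" "card V < 2 * card T"
  shows False
proof -
  have "card S + card T = card (S \<union> T)"
    using assms finV finite_subset by (intro card_Un_disjoint[symmetric]) auto
  also have "\<dots> \<le> card V" using assms finV by (intro card_mono) auto
  finally show False using assms by simp
qed

lemma parentD: "par x y \<Longrightarrow> bond x y"
  by (simp add: parent_def)

text \<open>From a common vertex one of \<open>y\<close> and \<open>z\<close> is reached first,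
  without meeting the other. As both are bonded to \<open>x\<close>, the walk can be continued to
  \<open>x\<close>, still avoiding the other.\<close>

lemma behind_disjoint:
  assumes v: "x \<in> V" "y \<in> V" "z \<in> V" and b: "bond x y" "bond x z" "y \<noteq> z"
  shows "behind V R x y \<inter> behind V R x z = {}"
proof (rule ccontr)
  assume "\<not> ?thesis"
  then obtain w where w: "w \<in> V" "sep y x w" "sep z x w" by (auto simp: behind_def)
  have "w \<noteq> y" "w \<noteq> z"
    using w b v bondD[OF b(1), of z] bondD[OF b(2), of y] bond_neq[OF b(1)] bond_neq[OF b(2)] by auto
  then have "\<not> sep z w y \<or> \<not> sep y w z" using first_hit[of w y z] w v b by auto
  moreover have "\<not> sep z y x" "\<not> sep y z x"
    using bondD[OF b(1), of z] bondD[OF b(2), of y] v b bond_neq[OF b(1)] bond_neq[OF b(2)] sep_sym by metis+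
  ultimately have "\<not> sep z w x \<or> \<not> sep y w x" using sep_trans by blast
  then show False using w sep_sym by blast
qed

lemma parent_unique:
  assumes "x \<in> V" "y \<in> V" "z \<in> V" "par x y" "par x z"
  shows "y = z"
  using not_both_majority[OF behind_subset behind_subset behind_disjoint[of x y z]] assms
  by (auto simp: parent_def)

lemma parent_asym:
  assumes v: "x \<in> V" "y \<in> V" and p: "par x y"
  shows "\<not> par y x"
proof
  assume "par y x"
  moreover have "behind V R x y \<inter> behind V R y x = {}"
  proof (rule ccontr)
    assume "\<not> ?thesis"
    then obtain w where w: "w \<in> V" "sep y x w" "sep x y w" by (auto simp: behind_def)
    have "x \<noteq> y" using bond_neq[OF parentD[OF p]] .
    then have "w \<noteq> x" "w \<noteq> y" using w sep_refl by auto
    then show False using first_hit[of w x y] w v \<open>x \<noteq> y\<close> sep_sym by metis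
  qed
  ultimately show False
    using not_both_majority[OF behind_subset behind_subset, of x y y x] p by (auto simp: parent_def)
qed

text \<open>What lies behind \<open>y\<close> as seen from \<open>x\<close> and as seen from
  \<open>z\<close> covers the graph and overlaps in \<open>y\<close>, so the two cardinalities sum
  to more than \<open>card V\<close> and one exceeds half of it. Thus at most one block at
  \<open>y\<close> is not rooted at \<open>y\<close>.\<close>

lemma parent_of_separated:
  assumes v: "x \<in> V" "y \<in> V" "z \<in> V" and b: "bond x y" "bond z y" and s: "sep y x z"
  shows "par x y \<or> par z y"
proof -
  have "V \<subseteq> behind V R x y \<union> behind V R z y"
    using s sep_trans sep_sym unfolding behind_def by blast
  then have "V = behind V R x y \<union> behind V R z y" using behind_subset by blast
  moreover have "card (behind V R x y) + card (behind V R z y) =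
      card (behind V R x y \<union> behind V R z y) + card (behind V R x y \<inter> behind V R z y)"
    using finite_behind by (intro card_Un_Int)
  moreover have "y \<in> behind V R x y \<inter> behind V R z y" using v by (auto simp: behind_def)
  then have "0 < card (behind V R x y \<inter> behind V R z y)" using finite_behind card_gt_0_iff by blast
  ultimately show ?thesis using b by (auto simp: parent_def)
qed

lemma parent_transfer:
  assumes "x \<in> V" "y \<in> V" "z \<in> V" "par x y" "bond z x" "bond z y"
  shows "par z y"
proof -
  have "\<not> sep y x z" using bondD[of x z y] assms bond_neq parentD bond_sym by metis
  then show ?thesis using behind_cong[of y x z] assms by (simp add: parent_def)
qed

lemma sibling_sym: "sib x y \<longleftrightarrow> sib y x"
  using bond_sym by (auto simp: sibling_def)

lemma sibling_bond: "sib x y \<Longrightarrow> x \<noteq> y \<Longrightarrow> bond x y"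
  by (auto simp: sibling_def)

text \<open>If \<open>x\<close> and \<open>z\<close> were not bonded, \<open>y\<close> would
  separate them and so be the parent of one of them.\<close>

lemma sibling_trans:
  assumes v: "x \<in> V" "y \<in> V" "z \<in> V" and s: "sib x y" "sib y z"
  shows "sib x z"
proof (cases "x = y \<or> y = z \<or> x = z")
  case False
  then have b: "bond x y" "bond y z" "\<not> par x y" "\<not> par y x" "\<not> par y z" "\<not> par z y"
    using s by (auto simp: sibling_def)
  then have "bond x z"
    using bond_trans'[of x y z] parent_of_separated[OF v, of] bond_sym False by blast
  moreover have "\<not> par x z" using parent_transfer[of x z y] v b \<open>bond x z\<close> bond_sym by blast
  moreover have "\<not> par z x" using parent_transfer[of z x y] v b \<open>bond x z\<close> bond_sym by blast
  ultimately show ?thesis by (simp add: sibling_def)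
qed (use s in \<open>auto simp: sibling_def\<close>)

lemma sibling_parent:
  assumes v: "x \<in> V" "y \<in> V" "z \<in> V" and s: "sib x z" and p: "par x y"
  shows "par z y"
proof (cases "x = z")
  case False
  then have b: "bond z x" "\<not> par x z" "\<not> par z x" "bond x y"
    using s bond_sym parentD[OF p] by (auto simp: sibling_def)
  have "z \<noteq> y" using b p by auto
  have "\<not> par y x" using parent_asym[OF v(1,2) p] .
  then have "bond z y"
    using bond_trans'[OF b(1,4) \<open>z \<noteq> y\<close>] parent_of_separated[of z x y] b v bond_sym by blast
  then show ?thesis using parent_transfer[OF v p b(1)] by simp
qed (use p in simp)

text \<open>Seen from its parent, what lies behind a vertex is the part of the graph below it, and
  this grows strictly on the way up. It provides the measure for recursion along
  \<open>parent\<close>.\<close>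

lemma parent_parent_card:
  assumes v: "x \<in> V" "y \<in> V" "w \<in> V" and p: "par x y" "par y w"
  shows "card (behind V R y x) < card (behind V R w y)"
proof (rule psubset_card_mono[OF finite_behind])
  have b: "bond x y" "bond y w" using p parentD by auto
  have neq: "x \<noteq> y" "y \<noteq> w" "x \<noteq> w" using bond_neq[OF b(1)] bond_neq[OF b(2)] parent_asym[OF v(1,2) p(1)] p(2) by auto
  have "\<not> bond x w"
  proof
    assume "bond x w"
    then have "par x w" using parent_transfer[of y w x] v p b by blast
    then show False using parent_unique[OF v p(1)] neq by simp
  qed
  then have s: "sep y x w" using bond_trans[OF b neq(3)] by simp
  have "sep y w z" if z: "z \<in> V" "sep x y z" for z
  proof (rule ccontr)
    assume n: "\<not> sep y w z"
    have "\<not> sep y z x"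
    proof (cases "z = x")
      case True
      then show ?thesis using neq sep_refl by auto
    next
      case False
      have "z \<noteq> y" using z neq sep_refl[of x y] by auto
      then show ?thesis using first_hit[of z y x] z(1) z(2) v(1,2) False neq sep_sym[of x y z] by blast
    qed
    then show False using n s sep_trans sep_sym by blast
  qed
  moreover have "y \<in> behind V R w y" "y \<notin> behind V R y x" using v neq sep_refl[of x y] by (auto simp: behind_def)
  ultimately show "behind V R y x \<subset> behind V R w y" by (auto simp: behind_def)
qed

text \<open>A bijection that preserves siblings and parents therefore preserves blocks.\<close>

lemma bond_iff: "bond x y \<longleftrightarrow> x \<noteq> y \<and> (sib x y \<or> par x y \<or> par y x)"
  using bond_neq parentD bond_sym unfolding sibling_def by blast

text \<open>If \<open>z\<close> and \<open>w\<close> were not bonded, \<open>x\<close> would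
  separate them; but both are bonded to \<open>y\<close>, and so connected to it without
  \<open>x\<close>.\<close>

lemma block_set_cong:
  assumes v: "x \<in> V" "y \<in> V" and b: "bond x y" and zw: "z \<in> block_set V R x y" "w \<in> block_set V R x y" "z \<noteq> w"
  shows "bond z w"
proof (rule ccontr)
  assume n: "\<not> bond z w"
  have "z \<noteq> x \<and> z \<noteq> y \<and> w \<noteq> x \<and> w \<noteq> y"
    using n zw b bond_sym by (auto simp: block_set_def)
  then have b': "bond z x" "bond x w" "bond z y" "bond y w" using zw bond_sym by (auto simp: block_set_def)
  then have "sep x z w" using bond_trans n zw by blast
  then show False
    using sep_trans[of x z w y] bondD[OF b'(3), of x] bondD[OF b'(4), of x] v bond_neq[OF b] bond_neq[OF b'(1)] bond_neq[OF b'(2)]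
    by blast
qed

lemma sibling_or_parent_eq_block:
  assumes v: "x \<in> V" "y \<in> V" and b: "bond x y" and n: "\<not> par y x"
  shows "block_set V R x y = hood V R x"
proof (intro equalityI subsetI)
  fix z assume z: "z \<in> block_set V R x y"
  then have zV: "z \<in> V" by (simp add: block_set_def)
  have "\<not> par z x" if "z \<noteq> x" "z \<noteq> y"
    using parent_transfer[of z x y] z zV that v b n bond_sym by (auto simp: block_set_def)
  then show "z \<in> hood V R x"
    using z b n zV by (auto simp: hood_def block_set_def sibling_def)
next
  fix z assume "z \<in> hood V R x"
  then have z: "z \<in> V" "sib x z \<or> par x z" by (auto simp: hood_def)
  show "z \<in> block_set V R x y"
  proof (cases "z = x \<or> z = y")
    case False
    then have bz: "bond x z" using z parentD sibling_bond by blast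
    have "bond y z"
    proof (cases "par x y")
      case True
      then have "sib x z" using z parent_unique[OF v(1,2) z(1)] False by blast
      then show ?thesis using sibling_parent[OF v z(1) _ True] parentD bond_sym by blast
    next
      case F: False
      then have s: "sib x y" using b n by (simp add: sibling_def)
      show ?thesis
        using z(2)
      proof
        assume "sib x z"
        then show ?thesis using sibling_trans[of y x z] s sibling_sym v z sibling_bond False by blast
      next
        assume "par x z"
        then show ?thesis using sibling_parent[OF v(1) z(1) v(2) s] parentD by blast
      qed
    qed
    then show ?thesis using z bz by (simp add: block_set_def)
  qed (use z v in \<open>auto simp: block_set_def\<close>)
qed

lemma block_set_sym: "block_set V R x y = block_set V R y x"
  by (auto simp: block_set_def)

text \<open>By \<open>parent_asym\<close> at least one of \<open>x\<close> and \<open>y\<close> is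
  not the parent of the other and so is not the root vertex of their block.\<close>

lemma block_set_eq_hood:
  assumes "x \<in> V" "y \<in> V" "bond x y"
  obtains a where "a \<in> V" "block_set V R x y = hood V R a"
  using sibling_or_parent_eq_block[OF assms] sibling_or_parent_eq_block[OF assms(2,1)]
    parent_asym[of x y] bond_sym[of x y] block_set_sym[of x y] assms by metis

end

section \<open>Walks that stay in a block or leave it\<close>

context connected_rel
begin

text \<open>If \<open>w\<close> were not bonded to some \<open>z\<close> of the block,
  \<open>s\<close> would separate them; but \<open>t\<close> is bonded to both and links them
  without \<open>s\<close>.\<close>

lemma block_set_absorb:
  assumes v: "x \<in> V" "y \<in> V" "w \<in> V" and b: "bond x y"
    and st: "s \<in> block_set V R x y" "t \<in> block_set V R x y" "s \<noteq> t" "bond w s" "bond w t"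
  shows "w \<in> block_set V R x y"
proof -
  have stV: "s \<in> V" "t \<in> V" using st by (auto simp: block_set_def)
  have "bond z w" if z: "z \<in> block_set V R x y" "z \<noteq> w" for z
  proof (rule ccontr)
    assume n: "\<not> bond z w"
    then have neq: "z \<noteq> s" "z \<noteq> t" using st bond_sym by auto
    then have bz: "bond z s" "bond z t" using block_set_cong[OF v(1,2) b] z st by auto
    have "sep s z w" using bond_trans[of z s w] bz st n z bond_sym by blast
    then show False
      using sep_trans[of s z w t] bondD[OF bz(2) stV(1)] bondD[OF st(5) stV(1)] neq st(3) bond_neq[OF st(4)] sep_sym
      by metis
  qed
  moreover have "x \<in> block_set V R x y" "y \<in> block_set V R x y" using v by (auto simp: block_set_def)
  ultimately show ?thesis using v(3) unfolding block_set_def by blast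
qed

text \<open>Otherwise \<open>w\<close> would be bonded to \<open>t\<close>: no vertex other than
  \<open>s\<close> can separate them, since \<open>s\<close> is bonded to both. Being bonded to two
  vertices of the block, \<open>w\<close> would then belong to it.\<close>

lemma leave_block_set:
  assumes v: "x \<in> V" "y \<in> V" and b: "bond x y"
    and s: "s \<in> block_set V R x y" and w: "w \<notin> block_set V R x y" "(s, w) \<in> R"
    and t: "t \<in> block_set V R x y" "t \<noteq> s"
  shows "sep s w t"
proof (rule ccontr)
  assume n: "\<not> sep s w t"
  have V: "s \<in> V" "t \<in> V" "w \<in> V" using s t w RV by (auto simp: block_set_def)
  have st: "bond s t" using block_set_cong[OF v b s t(1)] t(2) by auto
  have sw: "bond s w" using bond_edge w by auto
  have "bond w t"
    unfolding bonded_def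
  proof (intro conjI ballI impI)
    show "w \<noteq> t" using w t by auto
    fix d assume d: "d \<in> V" "d \<noteq> w" "d \<noteq> t"
    show "\<not> sep d w t"
    proof (cases "d = s")
      case False
      then show ?thesis
        using bondD[OF st d(1)] bondD[OF sw d(1)] d sep_trans[of d w t s] sep_sym[of d w s] by blast
    qed (use n in simp)
  qed
  then show False using block_set_absorb[OF v V(3) b s t(1)] t sw bond_sym w by auto
qed

text \<open>The bound on the length allows the induction in \<open>block_set_convex\<close> to
  resume at the return to \<open>u\<close>.\<close>

lemma relpow_visit:
  assumes "(w, v) \<in> P ^^ k" "P \<subseteq> R"
  shows "(w, v) \<in> (avoiding R u)\<^sup>* \<or> (\<exists>k'\<le>k. (u, v) \<in> P ^^ k')"
  using assms(1)
proof (induction k arbitrary: w)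
  case (Suc k)
  then obtain z where z: "(w, z) \<in> P" "(z, v) \<in> P ^^ k" by (meson relpow_Suc_D2)
  show ?case
  proof (cases "w = u")
    case True
    then show ?thesis using Suc.prems by blast
  next
    case w: False
    show ?thesis
    proof (cases "z = u")
      case True
      then show ?thesis using z(2) le_SucI[of k k] by blast
    next
      case False
      then have "(w, z) \<in> avoiding R u" using z w assms(2) by (auto simp: avoiding_def)
      then show ?thesis using Suc.IH[OF z(2)] by (meson converse_rtrancl_into_rtrancl le_SucI)
    qed
  qed
qed simp

text \<open>A walk that leaves a block comes back through the vertex at which it has left.\<close>

lemma block_set_convex:
  assumes v: "x \<in> V" "y \<in> V" and b: "bond x y" and P: "P \<subseteq> R"
    and uv: "u \<in> block_set V R x y" "t \<in> block_set V R x y" "(u, t) \<in> P\<^sup>*"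
  shows "(u, t) \<in> (P \<inter> block_set V R x y \<times> block_set V R x y)\<^sup>*"
proof -
  let ?K = "block_set V R x y"
  obtain m where "(u, t) \<in> P ^^ m" using uv(3)[unfolded rtrancl_power] by auto
  then show ?thesis using uv(1)
  proof (induction m arbitrary: u rule: less_induct)
    case (less m)
    show ?case
    proof (cases "u = t")
      case False
      then obtain k where m: "m = Suc k" using less.prems(1) by (cases m) auto
      then obtain w where w: "(u, w) \<in> P" "(w, t) \<in> P ^^ k" using less.prems(1) by (meson relpow_Suc_D2)
      show ?thesis
      proof (cases "w \<in> ?K")
        case True
        then have "(w, t) \<in> (P \<inter> ?K \<times> ?K)\<^sup>*" using less.IH[of k w] m w by auto
        then show ?thesis using w True less.prems(2) by (auto intro: converse_rtrancl_into_rtrancl)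
      next
        case F: False
        have "(u, w) \<in> R" using w P by auto
        then have "sep u w t" using leave_block_set[OF v b less.prems(2) F _ uv(2)] False by auto
        moreover have "w \<noteq> u" using F less.prems(2) by auto
        ultimately have "(w, t) \<notin> (avoiding R u)\<^sup>*" using False by (auto simp: separates_def)
        then obtain k' where "k' \<le> k" "(u, t) \<in> P ^^ k'" using relpow_visit[OF w(2) P, of u] by auto
        then show ?thesis using less.IH[of k' u] m less.prems(2) by auto
      qed
    qed simp
  qed
qed

text \<open>If the walk meets \<open>v\<close>, take for \<open>w\<close> the vertex after its last
  visit.\<close>

lemma last_visit:
  assumes "(a, x) \<in> R\<^sup>*" "x \<noteq> v"
  shows "\<not> sep v a x \<or> (\<exists>w. (v, w) \<in> R \<and> \<not> sep v w x)"
  using assms(1)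
proof (induction rule: converse_rtrancl_induct)
  case base
  then show ?case using assms(2) sep_refl by auto
next
  case (step a b)
  show ?case
  proof (cases "\<not> sep v b x \<and> a \<noteq> v")
    case True
    then have "b \<noteq> v" by auto
    then show ?thesis using not_sep_edge[OF step(1), of v] True sep_trans[of v a x b] by blast
  next
    case False
    then show ?thesis using step by auto
  qed
qed

text \<open>The right side speaks of bonds only, so a bijection that preserves bonds preserves cut
  vertices, even if it does not preserve edges.\<close>

lemma cut_iff_bond:
  assumes "v \<in> V"
  shows "(\<exists>x\<in>V. \<exists>y\<in>V. x \<noteq> v \<and> y \<noteq> v \<and> sep v x y) \<longleftrightarrow>
    (\<exists>x\<in>V. \<exists>y\<in>V. bond v x \<and> bond v y \<and> x \<noteq> y \<and> \<not> bond x y)"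
proof
  assume "\<exists>x\<in>V. \<exists>y\<in>V. x \<noteq> v \<and> y \<noteq> v \<and> sep v x y"
  then obtain x y where xy: "x \<in> V" "y \<in> V" "x \<noteq> v" "y \<noteq> v" "sep v x y" by blast
  obtain w where w: "(v, w) \<in> R" "\<not> sep v w x"
    using last_visit[OF conn[OF assms xy(1)] xy(3)] by auto
  obtain z where z: "(v, z) \<in> R" "\<not> sep v z y"
    using last_visit[OF conn[OF assms xy(2)] xy(4)] by auto
  have s: "sep v w z"
    using xy w z sep_trans[of v x y w] sep_trans[of v w y z] sep_sym[of v x w] by blast
  have "w \<noteq> v" "z \<noteq> v" using w z by auto
  then have "w \<noteq> z" "\<not> bond w z" using s sep_refl[of v w] bondD[of w z v] assms by auto
  moreover have "w \<in> V" "z \<in> V" using w z RV by auto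
  ultimately show "\<exists>x\<in>V. \<exists>y\<in>V. bond v x \<and> bond v y \<and> x \<noteq> y \<and> \<not> bond x y"
    using bond_edge w z by blast
next
  assume "\<exists>x\<in>V. \<exists>y\<in>V. bond v x \<and> bond v y \<and> x \<noteq> y \<and> \<not> bond x y"
  then show "\<exists>x\<in>V. \<exists>y\<in>V. x \<noteq> v \<and> y \<noteq> v \<and> sep v x y"
    using bond_trans bond_sym bond_neq by metis
qed

end

section \<open>Connectedness and components in terms of reachability\<close>

context
  fixes G :: "'a pair_pre_digraph"
  assumes G: "pair_graph G"
begin

interpretation G: pair_graph G by fact

lemma parcs_subset: "parcs G \<subseteq> pverts G \<times> pverts G"
  using G.in_arcsD1 G.in_arcsD2 by auto

lemma reachable_in_pverts: "(u, v) \<in> (parcs G)\<^sup>* \<Longrightarrow> u \<in> pverts G \<Longrightarrow> v \<in> pverts G"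
  by (induction rule: rtrancl_induct) (use parcs_subset in auto)

lemma sym_parcs: "sym (parcs G)"
  by (rule symI) (rule G.arcs_symmetric)

lemma irrefl_parcs: "irrefl (parcs G)"
  using G.no_loops' by (auto simp: irrefl_def)

lemma graph_connected_iff:
  "graph_connected G \<longleftrightarrow> pverts G \<noteq> {} \<and> (\<forall>u\<in>pverts G. \<forall>v\<in>pverts G. (u, v) \<in> (parcs G)\<^sup>*)"
proof -
  have "symcl (parcs G) = parcs G"
    using symD[OF sym_parcs] by (fastforce simp: symcl_def)
  moreover have "(u, v) \<in> rtrancl_on (pverts G) (parcs G) \<longleftrightarrow> (u, v) \<in> (parcs G)\<^sup>*"
    if "u \<in> pverts G" for u v
  proof
    assume "(u, v) \<in> (parcs G)\<^sup>*"
    then show "(u, v) \<in> rtrancl_on (pverts G) (parcs G)"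
      using that parcs_subset reachable_in_pverts by (intro rtrancl_consistent_rtrancl_on) auto
  qed (rule rtrancl_on_rtranclI)
  ultimately show ?thesis unfolding graph_connected_def connected_conv by simp
qed

lemma delete_vertex_eq_induced: "delete_vertex G v = induced G (pverts G - {v})"
  using parcs_subset by (auto simp: delete_vertex_def induced_def)

lemma pair_graph_delete_vertex: "pair_graph (delete_vertex G v)"
  unfolding delete_vertex_eq_induced by (rule pair_graph_induced[OF G]) auto

lemma delete_vertex_simps:
  "pverts (delete_vertex G v) = pverts G - {v}" "parcs (delete_vertex G v) = avoiding (parcs G) v"
  by (auto simp: delete_vertex_def avoiding_def)

lemma num_components_eq: "num_components G = card ((\<lambda>u. {v. (u, v) \<in> (parcs G)\<^sup>*}) ` pverts G)"
proof -
  have reach: "u \<rightarrow>\<^sup>*\<^bsub>with_proj G\<^esub> v \<longleftrightarrow> u \<in> pverts G \<and> (u, v) \<in> (parcs G)\<^sup>*" for u v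
  proof
    assume "u \<in> pverts G \<and> (u, v) \<in> (parcs G)\<^sup>*"
    then show "u \<rightarrow>\<^sup>*\<^bsub>with_proj G\<^esub> v"
      unfolding reachable_def using parcs_subset reachable_in_pverts
      by (auto intro!: rtrancl_consistent_rtrancl_on)
  next
    assume "u \<rightarrow>\<^sup>*\<^bsub>with_proj G\<^esub> v"
    then show "u \<in> pverts G \<and> (u, v) \<in> (parcs G)\<^sup>*"
      unfolding reachable_def by (auto dest: rtrancl_on_rtranclI in_rtrancl_on_in_F)
  qed
  have s: "sym ((parcs G)\<^sup>*)" by (rule sym_rtrancl[OF sym_parcs])
  note inV = reachable_in_pverts
  have "G.sccs_verts = (\<lambda>u. {v. (u, v) \<in> (parcs G)\<^sup>*}) ` pverts G"
  proof (intro equalityI subsetI)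
    fix S assume "S \<in> G.sccs_verts"
    then have S: "S \<noteq> {}" "\<And>u v. u \<in> S \<Longrightarrow> v \<in> S \<Longrightarrow> u \<in> pverts G \<and> (u, v) \<in> (parcs G)\<^sup>*"
      "\<And>u v. u \<in> S \<Longrightarrow> v \<notin> S \<Longrightarrow>
        \<not> (u \<in> pverts G \<and> (u, v) \<in> (parcs G)\<^sup>*) \<or> \<not> (v \<in> pverts G \<and> (v, u) \<in> (parcs G)\<^sup>*)"
      unfolding G.in_sccs_verts_conv_reachable reach by blast+
    then obtain u where u: "u \<in> S" by blast
    then have uV: "u \<in> pverts G" using S(2) by blast
    have "S = {v. (u, v) \<in> (parcs G)\<^sup>*}"
      using S(2)[OF u] S(3)[OF u] uV inV[OF _ uV] symD[OF s, of u] by blast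
    then show "S \<in> (\<lambda>u. {v. (u, v) \<in> (parcs G)\<^sup>*}) ` pverts G" using uV by blast
  next
    fix S assume "S \<in> (\<lambda>u. {v. (u, v) \<in> (parcs G)\<^sup>*}) ` pverts G"
    then obtain u where u: "u \<in> pverts G" and S: "S = {v. (u, v) \<in> (parcs G)\<^sup>*}" by blast
    have "a \<in> pverts G \<and> (a, b) \<in> (parcs G)\<^sup>*" if "a \<in> S" "b \<in> S" for a b
      using that inV[OF _ u] symD[OF s, of u a] rtrancl_trans[of a u "parcs G" b] by (simp add: S)
    moreover have "(a, b) \<notin> (parcs G)\<^sup>*" if "a \<in> S" "b \<notin> S" for a b
      using that rtrancl_trans[of u a "parcs G" b] by (auto simp: S)
    moreover have "u \<in> S" by (simp add: S)
    ultimately show "S \<in> G.sccs_verts"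
      unfolding G.in_sccs_verts_conv_reachable reach by blast
  qed
  then show ?thesis using G.card_sccs_verts by (simp add: num_components_def)
qed

lemma num_components_connected: "graph_connected G \<Longrightarrow> num_components G = 1"
proof -
  assume "graph_connected G"
  then have c: "pverts G \<noteq> {}" "\<And>u v. u \<in> pverts G \<Longrightarrow> v \<in> pverts G \<Longrightarrow> (u, v) \<in> (parcs G)\<^sup>*"
    unfolding graph_connected_iff by blast+
  have "{v. (u, v) \<in> (parcs G)\<^sup>*} = pverts G" if u: "u \<in> pverts G" for u
  proof (intro equalityI subsetI)
    fix v assume "v \<in> {v. (u, v) \<in> (parcs G)\<^sup>*}"
    then show "v \<in> pverts G" using reachable_in_pverts[OF _ u] by simp
  qed (simp add: c(2)[OF u])
  then have "(\<lambda>u. {v. (u, v) \<in> (parcs G)\<^sup>*}) ` pverts G = {pverts G}"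
    using c(1) by auto
  then show ?thesis by (simp add: num_components_eq)
qed

lemma one_less_num_components:
  assumes "u \<in> pverts G" "v \<in> pverts G" "(u, v) \<notin> (parcs G)\<^sup>*"
  shows "1 < num_components G"
proof -
  let ?C = "\<lambda>u. {v. (u, v) \<in> (parcs G)\<^sup>*}"
  have "?C u \<noteq> ?C v" using assms(3) by auto
  then have "card {?C u, ?C v} = 2" by simp
  moreover have "card {?C u, ?C v} \<le> card (?C ` pverts G)"
    using assms G.pair_finite_verts by (intro card_mono) auto
  ultimately show ?thesis by (simp add: num_components_eq)
qed

end

lemma two_connected_iff:
  assumes G: "pair_graph G"
  shows "two_connected G \<longleftrightarrow> (\<exists>x\<in>pverts G. \<exists>y\<in>pverts G. x \<noteq> y) \<and>
     (\<forall>x\<in>pverts G. \<forall>y\<in>pverts G. (x, y) \<in> (parcs G)\<^sup>*) \<and>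
     (\<forall>c\<in>pverts G. \<forall>x\<in>pverts G. \<forall>y\<in>pverts G. x \<noteq> c \<longrightarrow> y \<noteq> c \<longrightarrow> (x, y) \<in> (avoiding (parcs G) c)\<^sup>*)"
proof
  assume "two_connected G"
  then have "graph_connected G" and del: "\<And>v. v \<in> pverts G \<Longrightarrow> graph_connected (delete_vertex G v)"
    unfolding two_connected_def by blast+
  then have c: "pverts G \<noteq> {}" "\<And>x y. x \<in> pverts G \<Longrightarrow> y \<in> pverts G \<Longrightarrow> (x, y) \<in> (parcs G)\<^sup>*"
    unfolding graph_connected_iff[OF G] by blast+
  have d: "pverts G - {v} \<noteq> {}"
    "\<And>x y. x \<in> pverts G - {v} \<Longrightarrow> y \<in> pverts G - {v} \<Longrightarrow> (x, y) \<in> (avoiding (parcs G) v)\<^sup>*"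
    if "v \<in> pverts G" for v
    using del[OF that]
    unfolding graph_connected_iff[OF pair_graph_delete_vertex[OF G]] delete_vertex_simps[OF G] by blast+
  obtain x where x: "x \<in> pverts G" using c(1) by blast
  then obtain y where "y \<in> pverts G" "x \<noteq> y" using d(1)[OF x] by blast
  then show "(\<exists>x\<in>pverts G. \<exists>y\<in>pverts G. x \<noteq> y) \<and>
     (\<forall>x\<in>pverts G. \<forall>y\<in>pverts G. (x, y) \<in> (parcs G)\<^sup>*) \<and>
     (\<forall>c\<in>pverts G. \<forall>x\<in>pverts G. \<forall>y\<in>pverts G. x \<noteq> c \<longrightarrow> y \<noteq> c \<longrightarrow> (x, y) \<in> (avoiding (parcs G) c)\<^sup>*)"
    using x c(2) d(2) by (intro conjI ballI impI) (blast, simp_all)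
next
  assume *: "(\<exists>x\<in>pverts G. \<exists>y\<in>pverts G. x \<noteq> y) \<and>
     (\<forall>x\<in>pverts G. \<forall>y\<in>pverts G. (x, y) \<in> (parcs G)\<^sup>*) \<and>
     (\<forall>c\<in>pverts G. \<forall>x\<in>pverts G. \<forall>y\<in>pverts G. x \<noteq> c \<longrightarrow> y \<noteq> c \<longrightarrow> (x, y) \<in> (avoiding (parcs G) c)\<^sup>*)"
  then obtain x y where xy: "x \<in> pverts G" "y \<in> pverts G" "x \<noteq> y" by blast
  have "graph_connected G" using * xy unfolding graph_connected_iff[OF G] by blast
  moreover have "pverts (delete_vertex G v) \<noteq> {}" for v using xy by (auto simp: delete_vertex_simps[OF G])
  moreover have "graph_connected (delete_vertex G v)" if v: "v \<in> pverts G" for v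
    unfolding graph_connected_iff[OF pair_graph_delete_vertex[OF G]] delete_vertex_simps[OF G]
  proof (intro conjI ballI)
    show "pverts G - {v} \<noteq> {}" using xy by auto
    fix a b assume "a \<in> pverts G - {v}" "b \<in> pverts G - {v}"
    then show "(a, b) \<in> (avoiding (parcs G) v)\<^sup>*" using * v by simp
  qed
  ultimately show "two_connected G" by (simp add: two_connected_def)
qed

section \<open>Blocks and cut vertices\<close>

lemma subgraph_iff:
  assumes "pair_graph B" "pair_graph G"
  shows "subgraph (with_proj B) (with_proj G) \<longleftrightarrow> pverts B \<subseteq> pverts G \<and> parcs B \<subseteq> parcs G"
proof -
  interpret B: pair_graph B by fact
  interpret G: pair_graph G by fact
  show ?thesis using B.wf_digraph G.wf_digraph by (auto simp: subgraph_def compatible_def)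
qed

lemma avoiding_mono: "P \<subseteq> Q \<Longrightarrow> avoiding P c \<subseteq> avoiding Q c"
  by (auto simp: avoiding_def)

locale connected_pair_graph =
  fixes G :: "'a pair_pre_digraph"
  assumes G: "pair_graph G" and connected: "graph_connected G"
begin

sublocale connected_rel "pverts G" "parcs G"
proof
  interpret pair_graph G by (fact G)
  show "finite (pverts G)" by (fact pair_finite_verts)
qed (use parcs_subset[OF G] sym_parcs[OF G] irrefl_parcs[OF G] connected graph_connected_iff[OF G] in auto)

abbreviation "bset \<equiv> block_set (pverts G) (parcs G)"

lemma bset_subset: "bset x y \<subseteq> pverts G"
  by (auto simp: block_set_def)

lemma bset_self: "x \<in> pverts G \<Longrightarrow> y \<in> pverts G \<Longrightarrow> x \<in> bset x y \<and> y \<in> bset x y"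
  by (auto simp: block_set_def)

lemma two_connected_induced_bset:
  assumes v: "x \<in> pverts G" "y \<in> pverts G" and b: "bond x y"
  shows "two_connected (induced G (bset x y))"
proof -
  let ?K = "bset x y"
  \<comment> \<open>Applied to all edges this gives connectedness of the block, applied to the edges
    avoiding \<open>c\<close> its connectedness after deletion of \<open>c\<close>.\<close>
  have restrict: "(u, v) \<in> (P \<inter> ?K \<times> ?K)\<^sup>*" if "P \<subseteq> parcs G" "u \<in> ?K" "v \<in> ?K" "(u, v) \<in> P\<^sup>*" for P u v
    using block_set_convex[OF v b that] .
  have eq: "parcs (induced G ?K) = parcs G \<inter> ?K \<times> ?K" by (auto simp: induced_def)
  have "(u, w) \<in> (parcs (induced G ?K))\<^sup>*" if uw: "u \<in> ?K" "w \<in> ?K" for u w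
    unfolding eq using restrict[OF order_refl uw conn[OF subsetD[OF bset_subset uw(1)] subsetD[OF bset_subset uw(2)]]] .
  moreover have "(u, w) \<in> (avoiding (parcs (induced G ?K)) c)\<^sup>*"
    if c: "c \<in> ?K" and uw: "u \<in> ?K" "w \<in> ?K" "u \<noteq> c" "w \<noteq> c" for c u w
  proof (cases "u = w")
    case False
    have "\<not> sep c u w" using bondD[OF block_set_cong[OF v b uw(1,2) False]] c uw bset_subset by auto
    then have "(u, w) \<in> (avoiding (parcs G) c)\<^sup>*" using uw by (auto simp: separates_def)
    then have "(u, w) \<in> (avoiding (parcs G) c \<inter> ?K \<times> ?K)\<^sup>*"
      using restrict[of "avoiding (parcs G) c" u w] uw by (auto simp: avoiding_def)
    moreover have "avoiding (parcs G) c \<inter> ?K \<times> ?K = avoiding (parcs (induced G ?K)) c"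
      by (auto simp: avoiding_def eq)
    ultimately show ?thesis by simp
  qed simp
  moreover have "\<exists>u\<in>?K. \<exists>w\<in>?K. u \<noteq> w" using bset_self[OF v] bond_neq[OF b] by blast
  ultimately show ?thesis
    using two_connected_iff[OF pair_graph_induced[OF G bset_subset], of x y] by simp
qed

lemma two_connected_subgraph_bond:
  assumes B: "pair_graph B" "pverts B \<subseteq> pverts G" "parcs B \<subseteq> parcs G" "two_connected B"
    and xy: "x \<in> pverts B" "y \<in> pverts B" "x \<noteq> y"
  shows "bond x y"
  unfolding bonded_def
proof (intro conjI ballI impI)
  fix c assume c: "c \<noteq> x" "c \<noteq> y"
  note tc = B(4)[unfolded two_connected_iff[OF B(1)]]
  have "(x, y) \<in> (avoiding (parcs B) c)\<^sup>*"
  proof (cases "c \<in> pverts B")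
    case True
    then show ?thesis using tc xy c by auto
  next
    case False
    then have "avoiding (parcs B) c = parcs B"
      using parcs_subset[OF B(1)] by (auto simp: avoiding_def)
    then show ?thesis using tc xy by auto
  qed
  then have "(x, y) \<in> (avoiding (parcs G) c)\<^sup>*" using rtrancl_mono[OF avoiding_mono[OF B(3)]] by blast
  then show "\<not> sep c x y" using c by (auto simp: separates_def)
qed (fact xy(3))

lemma clique_subset_bset:
  assumes "S \<subseteq> pverts G" "\<And>u w. u \<in> S \<Longrightarrow> w \<in> S \<Longrightarrow> u \<noteq> w \<Longrightarrow> bond u w" "x \<in> S" "y \<in> S"
  shows "S \<subseteq> bset x y"
  using assms by (auto simp: block_set_def)

text \<open>The vertices of a 2-connected subgraph are pairwise bonded, hence lie in one
  \<open>bset\<close>, which itself induces a 2-connected subgraph. Maximality then also forces all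
  edges of the induced subgraph.\<close>

lemma blocks_eq: "blocks G = {induced G (bset x y) |x y. x \<in> pverts G \<and> y \<in> pverts G \<and> bond x y}"
proof (intro equalityI subsetI)
  fix B assume "B \<in> blocks G"
  then have B: "pair_graph B" "subgraph (with_proj B) (with_proj G)" "two_connected B"
    and max: "\<And>B'. pair_graph B' \<Longrightarrow> subgraph (with_proj B') (with_proj G) \<Longrightarrow> two_connected B' \<Longrightarrow>
      subgraph (with_proj B) (with_proj B') \<Longrightarrow> B' = B"
    by (auto simp: blocks_def)
  have s: "pverts B \<subseteq> pverts G" "parcs B \<subseteq> parcs G" using B(2) subgraph_iff[OF B(1) G] by auto
  obtain x y where xy: "x \<in> pverts B" "y \<in> pverts B" "x \<noteq> y"
    using B(3) two_connected_iff[OF B(1)] by blast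
  note b = two_connected_subgraph_bond[OF B(1) s B(3)]
  have v: "x \<in> pverts G" "y \<in> pverts G" using s xy by auto
  let ?I = "induced G (bset x y)"
  note I = pair_graph_induced[OF G bset_subset]
  have "pverts B \<subseteq> bset x y" by (rule clique_subset_bset) (use s b xy in auto)
  moreover from this have "parcs B \<subseteq> parcs ?I"
    using s parcs_subset[OF B(1)] by (auto simp: induced_def)
  ultimately have "subgraph (with_proj B) (with_proj ?I)" using subgraph_iff[OF B(1) I] by auto
  moreover have "subgraph (with_proj ?I) (with_proj G)"
    using subgraph_iff[OF I G] bset_subset by (auto simp: induced_def)
  ultimately have "?I = B"
    using max[OF I] two_connected_induced_bset[OF v b[OF xy]] by blast
  then show "B \<in> {induced G (bset x y) |x y. x \<in> pverts G \<and> y \<in> pverts G \<and> bond x y}"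
    using v b[OF xy] by blast
next
  fix B assume "B \<in> {induced G (bset x y) |x y. x \<in> pverts G \<and> y \<in> pverts G \<and> bond x y}"
  then obtain x y where v: "x \<in> pverts G" "y \<in> pverts G" and b: "bond x y" and B: "B = induced G (bset x y)"
    by blast
  note I = pair_graph_induced[OF G bset_subset, of x y, folded B]
  have "B' = B" if B': "pair_graph B'" "subgraph (with_proj B') (with_proj G)" "two_connected B'"
    "subgraph (with_proj B) (with_proj B')" for B'
  proof -
    have s: "pverts B' \<subseteq> pverts G" "parcs B' \<subseteq> parcs G" "pverts B \<subseteq> pverts B'" "parcs B \<subseteq> parcs B'"
      using B'(2,4) subgraph_iff[OF B'(1) G] subgraph_iff[OF I B'(1)] by auto
    have "x \<in> pverts B'" "y \<in> pverts B'" using s(3) bset_self[OF v] by (auto simp: B)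
    then have "pverts B' \<subseteq> bset x y"
      using two_connected_subgraph_bond[OF B'(1) s(1,2) B'(3)] s(1) by (intro clique_subset_bset) auto
    then have "pverts B' = pverts B" using s(3) by (auto simp: B)
    moreover have "parcs B' \<subseteq> parcs B"
      using s(2) parcs_subset[OF B'(1)] calculation by (auto simp: B induced_def)
    ultimately show ?thesis using s(4) by (intro pair_pre_digraph.equality) auto
  qed
  moreover have "subgraph (with_proj B) (with_proj G)"
    using subgraph_iff[OF I G] bset_subset by (auto simp: induced_def B)
  ultimately show "B \<in> blocks G"
    using I two_connected_induced_bset[OF v b] unfolding blocks_def B by blast
qed

lemma cut_vertices_eq:
  assumes two: "2 \<le> card (pverts G)"
  shows "cut_vertices G = {v \<in> pverts G.
    \<exists>x\<in>pverts G. \<exists>y\<in>pverts G. bond v x \<and> bond v y \<and> x \<noteq> y \<and> \<not> bond x y}"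
proof -
  have "num_components G < num_components (delete_vertex G v) \<longleftrightarrow>
      (\<exists>x\<in>pverts G. \<exists>y\<in>pverts G. x \<noteq> v \<and> y \<noteq> v \<and> sep v x y)" if v: "v \<in> pverts G" for v
  proof -
    note D = pair_graph_delete_vertex[OF G, of v] and simps = delete_vertex_simps[OF G, of v]
    have "pverts G - {v} \<noteq> {}"
    proof
      assume "pverts G - {v} = {}"
      then have "pverts G \<subseteq> {v}" by blast
      then have "card (pverts G) \<le> 1" using card_mono[of "{v}" "pverts G"] by simp
      then show False using two by simp
    qed
    then have "(\<exists>x\<in>pverts G. \<exists>y\<in>pverts G. x \<noteq> v \<and> y \<noteq> v \<and> sep v x y) \<longleftrightarrow> \<not> graph_connected (delete_vertex G v)"
      unfolding graph_connected_iff[OF D] simps separates_def by blast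
    moreover have "1 < num_components (delete_vertex G v)" if n: "\<not> graph_connected (delete_vertex G v)"
    proof -
      obtain x y where "x \<in> pverts G - {v}" "y \<in> pverts G - {v}" "(x, y) \<notin> (avoiding (parcs G) v)\<^sup>*"
        using n \<open>pverts G - {v} \<noteq> {}\<close> unfolding graph_connected_iff[OF D] simps by blast
      then show ?thesis using one_less_num_components[OF D, of x y] simps by simp
    qed
    ultimately show ?thesis
      using num_components_connected[OF D] num_components_connected[OF G connected] by fastforce
  qed
  then show ?thesis using cut_iff_bond two unfolding cut_vertices_def by auto
qed

lemma two_connected_iff_bond:
  assumes "2 \<le> card (pverts G)"
  shows "two_connected G \<longleftrightarrow> (\<forall>x\<in>pverts G. \<forall>y\<in>pverts G. x \<noteq> y \<longrightarrow> bond x y)"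
proof
  assume "two_connected G"
  then show "\<forall>x\<in>pverts G. \<forall>y\<in>pverts G. x \<noteq> y \<longrightarrow> bond x y"
    using two_connected_subgraph_bond[OF G order_refl order_refl] by blast
next
  assume *: "\<forall>x\<in>pverts G. \<forall>y\<in>pverts G. x \<noteq> y \<longrightarrow> bond x y"
  have "(x, y) \<in> (avoiding (parcs G) c)\<^sup>*"
    if "c \<in> pverts G" "x \<in> pverts G" "y \<in> pverts G" "x \<noteq> c" "y \<noteq> c" for c x y
  proof (cases "x = y")
    case False
    then show ?thesis using bondD[of x y c] * that by (auto simp: separates_def)
  qed simp
  moreover have "\<exists>x\<in>pverts G. \<exists>y\<in>pverts G. x \<noteq> y"
    using assms finV card_le_Suc0_iff_eq[of "pverts G"] by fastforce
  ultimately show "two_connected G" using two_connected_iff[OF G] conn by blast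
qed

end

text \<open>Blocks, cut vertices, incidence and intersection of blocks are all determined by the
  bonds, so one map \<open>g\<close> on blocks serves the block tree and the block graph. The
  isomorphism between a block and its image may be unrelated to \<open>f\<close>.\<close>

lemma same_block_structureI:
  fixes G :: "'a pair_pre_digraph" and H :: "'b pair_pre_digraph"
  assumes "connected_pair_graph G" "connected_pair_graph H"
    and two: "2 \<le> card (pverts G)" "2 \<le> card (pverts H)"
    and f: "bij_betw f (pverts G) (pverts H)"
    and bond: "\<And>x y. x \<in> pverts G \<Longrightarrow> y \<in> pverts G \<Longrightarrow>
      bonded (pverts G) (parcs G) x y \<longleftrightarrow> bonded (pverts H) (parcs H) (f x) (f y)"
    and iso: "\<And>x y. x \<in> pverts G \<Longrightarrow> y \<in> pverts G \<Longrightarrow> bonded (pverts G) (parcs G) x y \<Longrightarrow>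
      isomorphic (induced G (block_set (pverts G) (parcs G) x y))
        (induced H (f ` block_set (pverts G) (parcs G) x y))"
  shows "same_block_structure G H"
proof -
  interpret G: connected_pair_graph G by fact
  interpret H: connected_pair_graph H by fact
  have inj: "inj_on f (pverts G)" and im: "f ` pverts G = pverts H"
    using f by (auto simp: bij_betw_def)
  have fV: "f x \<in> pverts H" if "x \<in> pverts G" for x using that im by auto
  have f_eq: "f x = f y \<longleftrightarrow> x = y" if "x \<in> pverts G" "y \<in> pverts G" for x y
    using inj that by (auto simp: inj_on_eq_iff)
  have image_bset: "f ` G.bset x y = H.bset (f x) (f y)" if "x \<in> pverts G" "y \<in> pverts G" for x y
  proof -
    have "f z \<in> H.bset (f x) (f y) \<longleftrightarrow> z \<in> G.bset x y" if z: "z \<in> pverts G" for z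
      using z \<open>x \<in> pverts G\<close> \<open>y \<in> pverts G\<close> bond fV f_eq by (simp add: block_set_def)
    moreover have "\<exists>z\<in>pverts G. w = f z" if "w \<in> H.bset (f x) (f y)" for w
      using that H.bset_subset im by blast
    ultimately show ?thesis using G.bset_subset by blast
  qed
  define g where "g b = induced H (f ` pverts b)" for b :: "'a pair_pre_digraph"
  have sub: "pverts b \<subseteq> pverts G" if "b \<in> blocks G" for b
    using that subsetD[OF G.bset_subset] unfolding G.blocks_eq by auto
  have mem: "f c \<in> pverts (g b) \<longleftrightarrow> c \<in> pverts b" if "b \<in> blocks G" "c \<in> pverts G" for b c
    using sub[OF that(1)] that(2) f_eq by (auto simp: g_def)
  have gb: "g b \<in> blocks H" if b: "b \<in> blocks G" for b
  proof -
    obtain x y where xy: "x \<in> pverts G" "y \<in> pverts G" "G.bond x y" "b = induced G (G.bset x y)"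
      using b unfolding G.blocks_eq by blast
    then have "g b = induced H (H.bset (f x) (f y))" by (simp add: g_def image_bset)
    then show ?thesis unfolding H.blocks_eq using xy fV bond by blast
  qed
  have g_iso: "isomorphic b (g b)" if "b \<in> blocks G" for b
    using that iso unfolding G.blocks_eq by (auto simp: g_def)
  have g_bij: "bij_betw g (blocks G) (blocks H)"
  proof (rule bij_betwI')
    fix b b' assume b: "b \<in> blocks G" "b' \<in> blocks G"
    show "g b = g b' \<longleftrightarrow> b = b'"
    proof
      assume "g b = g b'"
      then have "f ` pverts b = f ` pverts b'" by (simp add: g_def induced_def)
      then have "pverts b = pverts b'" using inj_on_image_eq_iff[OF inj] sub b by blast
      then show "b = b'" using b unfolding G.blocks_eq by auto
    qed simp
  next
    fix b' assume "b' \<in> blocks H"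
    then obtain i j where ij: "i \<in> pverts H" "j \<in> pverts H" "H.bond i j" "b' = induced H (H.bset i j)"
      unfolding H.blocks_eq by blast
    obtain x y where xy: "x \<in> pverts G" "y \<in> pverts G" "i = f x" "j = f y" using ij im by blast
    then have "induced G (G.bset x y) \<in> blocks G" unfolding G.blocks_eq using ij bond by blast
    moreover have "b' = g (induced G (G.bset x y))" using ij xy by (simp add: g_def image_bset)
    ultimately show "\<exists>b\<in>blocks G. b' = g b" by blast
  qed (fact gb)
  have cut: "f v \<in> cut_vertices H \<longleftrightarrow> v \<in> cut_vertices G" if "v \<in> pverts G" for v
  proof -
    have "(\<exists>x\<in>f ` pverts G. \<exists>y\<in>f ` pverts G. H.bond (f v) x \<and> H.bond (f v) y \<and> x \<noteq> y \<and> \<not> H.bond x y) \<longleftrightarrow>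
      (\<exists>x\<in>pverts G. \<exists>y\<in>pverts G. G.bond v x \<and> G.bond v y \<and> x \<noteq> y \<and> \<not> G.bond x y)"
      using that bond f_eq by auto
    then show ?thesis
      unfolding H.cut_vertices_eq[OF two(2)] G.cut_vertices_eq[OF two(1)] im using that fV by simp
  qed
  have cutV: "v \<in> pverts G" if "v \<in> cut_vertices G" for v using that by (simp add: cut_vertices_def)
  have cutH: "\<exists>v\<in>cut_vertices G. w = f v" if w: "w \<in> cut_vertices H" for w
  proof -
    have "w \<in> f ` pverts G" using w im by (auto simp: cut_vertices_def)
    then show ?thesis using cut w by blast
  qed
  define \<alpha> :: "('a pair_pre_digraph, 'a) block_tree_vertex \<Rightarrow> ('b pair_pre_digraph, 'b) block_tree_vertex"
    where "\<alpha> t = (case t of White b \<Rightarrow> White (g b) | Black c \<Rightarrow> Black (f c))" for t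
  have \<alpha>: "\<alpha> (White b) = White (g b)" "\<alpha> (Black c) = Black (f c)" for b c by (simp_all add: \<alpha>_def)
  have g_eq: "g b = g b' \<longleftrightarrow> b = b'" if "b \<in> blocks G" "b' \<in> blocks G" for b b'
    using g_bij that by (auto simp: bij_betw_def inj_on_eq_iff)
  have "bij_betw \<alpha> (pverts (block_tree G)) (pverts (block_tree H))"
  proof (rule bij_betwI')
    fix s t assume "s \<in> pverts (block_tree G)" "t \<in> pverts (block_tree G)"
    then show "\<alpha> s = \<alpha> t \<longleftrightarrow> s = t" using g_eq f_eq cutV by (auto simp: block_tree_def \<alpha>)
  next
    fix s assume "s \<in> pverts (block_tree G)"
    then show "\<alpha> s \<in> pverts (block_tree H)" using gb cut cutV by (auto simp: block_tree_def \<alpha>)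
  next
    fix t assume "t \<in> pverts (block_tree H)"
    then consider b' where "t = White b'" "b' \<in> blocks H" | w where "t = Black w" "w \<in> cut_vertices H"
      by (auto simp: block_tree_def)
    then show "\<exists>s\<in>pverts (block_tree G). t = \<alpha> s"
    proof cases
      case 1
      then obtain b where "b \<in> blocks G" "b' = g b" using g_bij by (auto simp: bij_betw_def)
      then show ?thesis using 1 by (intro bexI[of _ "White b"]) (auto simp: block_tree_def \<alpha>)
    next
      case 2
      then obtain v where "v \<in> cut_vertices G" "w = f v" using cutH by blast
      then show ?thesis using 2 by (intro bexI[of _ "Black v"]) (auto simp: block_tree_def \<alpha>)
    qed
  qed
  moreover have arcs: "(s, t) \<in> parcs (block_tree K) \<longleftrightarrow> (\<exists>b\<in>blocks K. \<exists>c\<in>cut_vertices K. c \<in> pverts b \<and>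
      (s = White b \<and> t = Black c \<or> s = Black c \<and> t = White b))" for K :: "'k pair_pre_digraph" and s t
    by (auto simp: block_tree_def)
  have "(s, t) \<in> parcs (block_tree G) \<longleftrightarrow> (\<alpha> s, \<alpha> t) \<in> parcs (block_tree H)"
    if "s \<in> pverts (block_tree G)" "t \<in> pverts (block_tree G)" for s t
    using that gb mem cut cutV by (auto simp: block_tree_def \<alpha>)
  ultimately have "block_tree_isomorphism \<alpha> G H"
    unfolding block_tree_isomorphism_def graph_isomorphism_def by (auto simp: block_tree_def \<alpha>)
  moreover have "graph_isomorphism g (block_graph G) (block_graph H)"
  proof -
    have "pverts (g b) \<inter> pverts (g b') = f ` (pverts b \<inter> pverts b')" if "b \<in> blocks G" "b' \<in> blocks G" for b b'
      using inj_on_image_Int[OF inj sub sub] that by (simp add: g_def)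
    then show ?thesis
      using g_bij gb g_eq by (simp add: graph_isomorphism_def block_graph_def)
  qed
  moreover have "isomorphic (g b) (g b)" for b
    unfolding isomorphic_def graph_isomorphism_def by (rule exI[of _ id]) auto
  ultimately show ?thesis
    unfolding same_block_structure_def using g_iso
    by (intro exI[of _ \<alpha>] exI[of _ g]) (auto simp: \<alpha>)
qed

section \<open>Matching coloured classes and forests\<close>

definition equivalence_on :: "'a set \<Rightarrow> ('a \<Rightarrow> 'a \<Rightarrow> bool) \<Rightarrow> bool" where
  "equivalence_on S E \<longleftrightarrow> (\<forall>x\<in>S. E x x) \<and> (\<forall>x\<in>S. \<forall>y\<in>S. E x y \<longrightarrow> E y x) \<and>
     (\<forall>x\<in>S. \<forall>y\<in>S. \<forall>z\<in>S. E x y \<longrightarrow> E y z \<longrightarrow> E x z)"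

lemma equivalence_on_subset: "equivalence_on S E \<Longrightarrow> T \<subseteq> S \<Longrightarrow> equivalence_on T E"
  unfolding equivalence_on_def by (meson subsetD)

lemma equivalence_onD:
  assumes "equivalence_on S E"
  shows "x \<in> S \<Longrightarrow> E x x" "x \<in> S \<Longrightarrow> y \<in> S \<Longrightarrow> E x y \<Longrightarrow> E y x"
    "x \<in> S \<Longrightarrow> y \<in> S \<Longrightarrow> z \<in> S \<Longrightarrow> E x y \<Longrightarrow> E y z \<Longrightarrow> E x z"
  using assms unfolding equivalence_on_def by blast+

lemma card_remove_class:
  assumes "finite S" "C \<subseteq> S" "\<And>z. z \<in> C \<Longrightarrow> \<tau> z = t"
  shows "card {z \<in> S - C. \<tau> z = u} = card {z \<in> S. \<tau> z = u} - (if u = t then card C else 0)"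
proof (cases "u = t")
  case True
  then have "{z \<in> S - C. \<tau> z = u} = {z \<in> S. \<tau> z = u} - C" "C \<subseteq> {z \<in> S. \<tau> z = u}" using assms by auto
  then show ?thesis using True finite_subset[OF assms(2,1)] by (simp add: card_Diff_subset)
next
  case False
  then have "{z \<in> S - C. \<tau> z = u} = {z \<in> S. \<tau> z = u}" using assms by auto
  then show ?thesis using False by simp
qed

text \<open>One class on each side is removed at a time. It suffices to count elements instead of
  classes, because classes with the same invariant are in bijection by the last hypothesis and the
  invariant is constant on classes: the removal lowers both counts equally. \<open>Q\<close> records
  what the chosen bijections preserve inside a class.\<close>

lemma class_matching:
  fixes \<tau> :: "'a \<Rightarrow> 't" and \<tau>' :: "'b \<Rightarrow> 't"
  assumes "finite S" "finite S'"
    and "equivalence_on S E" "equivalence_on S' E'"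
    and "\<And>x y. x \<in> S \<Longrightarrow> y \<in> S \<Longrightarrow> E x y \<Longrightarrow> \<tau> x = \<tau> y"
    and "\<And>i j. i \<in> S' \<Longrightarrow> j \<in> S' \<Longrightarrow> E' i j \<Longrightarrow> \<tau>' i = \<tau>' j"
    and "\<And>t. card {x \<in> S. \<tau> x = t} = card {i \<in> S'. \<tau>' i = t}"
    and "\<And>x i. x \<in> S \<Longrightarrow> i \<in> S' \<Longrightarrow> \<tau> x = \<tau>' i \<Longrightarrow> \<exists>\<phi>. bij_betw \<phi> {z \<in> S. E x z} {k \<in> S'. E' i k} \<and>
      (\<forall>z\<in>S. \<forall>w\<in>S. E x z \<longrightarrow> E x w \<longrightarrow> Q z w (\<phi> z) (\<phi> w))"
  shows "\<exists>f. bij_betw f S S' \<and>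
    (\<forall>x\<in>S. \<forall>z\<in>S. (E x z \<longleftrightarrow> E' (f x) (f z)) \<and> (E x z \<longrightarrow> Q x z (f x) (f z)))"
  using assms
proof (induction "card S" arbitrary: S S' rule: less_induct)
  case (less S S')
  note fin = less.prems(1,2) and E = equivalence_onD[OF less.prems(3)] and E' = equivalence_onD[OF less.prems(4)]
    and \<tau> = less.prems(5,6) and count = less.prems(7) and match = less.prems(8)
  show ?case
  proof (cases "S = {}")
    case True
    have "S' = {}"
    proof (rule ccontr)
      assume "S' \<noteq> {}"
      then obtain i where "i \<in> S'" by blast
      then have "card {k \<in> S'. \<tau>' k = \<tau>' i} \<noteq> 0" using fin by auto
      then show False using count[of "\<tau>' i"] True by simp
    qed
    then show ?thesis using True by (auto simp: bij_betw_def)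
  next
    case False
    then obtain x where x: "x \<in> S" by blast
    then have "card {z \<in> S. \<tau> z = \<tau> x} \<noteq> 0" using fin by auto
    then have "card {i \<in> S'. \<tau>' i = \<tau> x} \<noteq> 0" using count[of "\<tau> x"] by simp
    then have "{i \<in> S'. \<tau>' i = \<tau> x} \<noteq> {}" by (intro notI) simp
    then obtain i where i: "i \<in> S'" "\<tau>' i = \<tau> x" by blast
    define C where "C = {z \<in> S. E x z}"
    define C' where "C' = {k \<in> S'. E' i k}"
    from match[OF x i(1) i(2)[symmetric]] obtain \<phi> where bij\<phi>: "bij_betw \<phi> C C'"
      and Q\<phi>: "\<forall>z\<in>S. \<forall>w\<in>S. E x z \<longrightarrow> E x w \<longrightarrow> Q z w (\<phi> z) (\<phi> w)"
      unfolding C_def[symmetric] C'_def[symmetric] by (elim exE conjE)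
    have \<phi>: "bij_betw \<phi> C C'" "\<And>z w. z \<in> C \<Longrightarrow> w \<in> C \<Longrightarrow> Q z w (\<phi> z) (\<phi> w)"
      using bij\<phi> Q\<phi> by (simp_all add: C_def)
    have C: "C \<subseteq> S" "x \<in> C" "C' \<subseteq> S'" using x E(1)[OF x] by (auto simp: C_def C'_def)
    have C\<tau>: "\<tau> z = \<tau> x" if "z \<in> C" for z using that \<tau>(1)[OF x, of z] by (simp add: C_def)
    have C'\<tau>: "\<tau>' k = \<tau> x" if "k \<in> C'" for k using that \<tau>(2)[OF i(1), of k] i(2) by (simp add: C'_def)
    have closed: "z \<in> C \<longleftrightarrow> w \<in> C" if "z \<in> S" "w \<in> S" "E z w" for z w
      using that E(3)[OF x that(1,2)] E(3)[OF x that(2,1)] E(2)[OF that] by (simp add: C_def) metis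
    have closed': "k \<in> C' \<longleftrightarrow> l \<in> C'" if "k \<in> S'" "l \<in> S'" "E' k l" for k l
      using that E'(3)[OF i(1) that(1,2)] E'(3)[OF i(1) that(2,1)] E'(2)[OF that] by (simp add: C'_def) metis
    have inC: "E z w" if "z \<in> C" "w \<in> C" for z w
      using that E(2)[OF x, of z] E(3)[of z x w] x by (simp add: C_def)
    have inC': "E' k l" if "k \<in> C'" "l \<in> C'" for k l
      using that E'(2)[OF i(1), of k] E'(3)[of k i l] i(1) by (simp add: C'_def)
    have "\<exists>f. bij_betw f (S - C) (S' - C') \<and>
      (\<forall>x\<in>S - C. \<forall>z\<in>S - C. (E x z \<longleftrightarrow> E' (f x) (f z)) \<and> (E x z \<longrightarrow> Q x z (f x) (f z)))"
    proof (rule less.hyps)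
      show "card (S - C) < card S" using C x fin by (intro psubset_card_mono) auto
      show "card {z \<in> S - C. \<tau> z = t} = card {k \<in> S' - C'. \<tau>' k = t}" for t
        using card_remove_class[OF fin(1) C(1) C\<tau>, where u = t]
          card_remove_class[OF fin(2) C(3) C'\<tau>, where u = t]
          count[of t] bij_betw_same_card[OF \<phi>(1)] by simp
      fix z k assume zk: "z \<in> S - C" "k \<in> S' - C'" "\<tau> z = \<tau>' k"
      have eq: "{w \<in> S - C. E z w} = {w \<in> S. E z w}" "{l \<in> S' - C'. E' k l} = {l \<in> S'. E' k l}"
        using closed[of z] closed'[of k] zk by auto
      have zk': "z \<in> S" "k \<in> S'" using zk by auto
      from match[OF zk' zk(3)] obtain \<psi> where "bij_betw \<psi> {w \<in> S. E z w} {l \<in> S'. E' k l}"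
        and "\<forall>v\<in>S. \<forall>w\<in>S. E z v \<longrightarrow> E z w \<longrightarrow> Q v w (\<psi> v) (\<psi> w)" by (elim exE conjE)
      then show "\<exists>\<phi>. bij_betw \<phi> {w \<in> S - C. E z w} {l \<in> S' - C'. E' k l} \<and>
          (\<forall>v\<in>S - C. \<forall>w\<in>S - C. E z v \<longrightarrow> E z w \<longrightarrow> Q v w (\<phi> v) (\<phi> w))"
        unfolding eq by (intro exI[of _ \<psi>]) simp
    next
      show "\<tau> z = \<tau> w" if "z \<in> S - C" "w \<in> S - C" "E z w" for z w using \<tau>(1) that by blast
      show "\<tau>' k = \<tau>' l" if "k \<in> S' - C'" "l \<in> S' - C'" "E' k l" for k l using \<tau>(2) that by blast
    qed (use fin equivalence_on_subset[OF less.prems(3)] equivalence_on_subset[OF less.prems(4)] in auto)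
    then obtain f where f: "bij_betw f (S - C) (S' - C')"
      "\<forall>x\<in>S - C. \<forall>z\<in>S - C. (E x z \<longleftrightarrow> E' (f x) (f z)) \<and> (E x z \<longrightarrow> Q x z (f x) (f z))"
      by (elim exE conjE) (erule (1) that)
    define h where "h z = (if z \<in> C then \<phi> z else f z)" for z
    have "bij_betw h C C'" "bij_betw h (S - C) (S' - C')"
      using \<phi>(1) f(1) bij_betw_cong[of C h \<phi>] bij_betw_cong[of "S - C" h f] by (simp_all add: h_def)
    then have "bij_betw h (C \<union> (S - C)) (C' \<union> (S' - C'))" by (rule bij_betw_combine) auto
    then have bij: "bij_betw h S S'" using C by (simp add: Un_absorb1)
    have "(E z w \<longleftrightarrow> E' (h z) (h w)) \<and> (E z w \<longrightarrow> Q z w (h z) (h w))" if zw: "z \<in> S" "w \<in> S" for z w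
    proof -
      have h: "h v \<in> S'" "h v \<in> C' \<longleftrightarrow> v \<in> C" if "v \<in> S" for v
        using that bij_betwE[OF bij] bij_betwE[OF \<phi>(1)] bij_betwE[OF f(1)] by (auto simp: h_def)
      consider "z \<in> C" "w \<in> C" | "z \<in> S - C" "w \<in> S - C" | "(z \<in> C) \<noteq> (w \<in> C)" using zw by blast
      then show ?thesis
      proof cases
        case 1
        then show ?thesis
          using inC inC'[of "\<phi> z" "\<phi> w"] bij_betwE[OF \<phi>(1)] \<phi>(2) by (simp add: h_def)
      next
        case 2
        then show ?thesis using f(2) by (simp add: h_def)
      next
        case 3
        then show ?thesis using closed[OF zw] closed'[OF h(1)[OF zw(1)] h(1)[OF zw(2)]] h zw by blast
      qed
    qed
    then show ?thesis using bij by (intro exI[of _ h]) simp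
  qed
qed

corollary colour_matching:
  assumes "finite S" "finite S'" "\<And>t. card {x \<in> S. \<tau> x = t} = card {i \<in> S'. \<tau>' i = t}"
  shows "\<exists>f. bij_betw f S S' \<and> (\<forall>x\<in>S. \<tau> x = \<tau>' (f x))"
proof -
  have "\<exists>f. bij_betw f S S' \<and>
    (\<forall>x\<in>S. \<forall>z\<in>S. (x = z \<longleftrightarrow> f x = f z) \<and> (x = z \<longrightarrow> (\<lambda>x z i k. \<tau> x = \<tau>' i) x z (f x) (f z)))"
  proof (rule class_matching[where \<tau> = \<tau> and \<tau>' = \<tau>'])
    fix x i assume "x \<in> S" "i \<in> S'" "\<tau> x = \<tau>' i"
    moreover from this have "{z \<in> S. x = z} = {x}" "{k \<in> S'. i = k} = {i}" by auto
    ultimately show "\<exists>\<phi>. bij_betw \<phi> {z \<in> S. x = z} {k \<in> S'. i = k} \<and>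
        (\<forall>z\<in>S. \<forall>w\<in>S. x = z \<longrightarrow> x = w \<longrightarrow> \<tau> z = \<tau>' (\<phi> z))"
      by (intro exI[of _ "\<lambda>_. i"]) (auto simp: bij_betw_def)
  qed (use assms in \<open>auto simp: equivalence_on_def\<close>)
  then show ?thesis by (elim ex_forward) simp
qed

text \<open>The connected component of \<open>s\<close> in the bipartite graph of \<open>L\<close>,
  which makes vertices of the two graphs comparable in one type.\<close>

definition colour :: "('a \<Rightarrow> 'b \<Rightarrow> bool) \<Rightarrow> 'a + 'b \<Rightarrow> ('a + 'b) set" where
  "colour L s = {t. (s, t) \<in> ({(Inl a, Inr i) |a i. L a i} \<union> {(Inr i, Inl a) |a i. L a i})\<^sup>*}"

lemma colour_eqI:
  assumes "L a i"
  shows "colour L (Inl a) = colour L (Inr i)"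
  unfolding colour_def using assms
  by (intro Collect_cong iffI) (rule converse_rtrancl_into_rtrancl, blast, assumption)+

text \<open>Agreement along single links propagates along chains of links. Every common invariant is
  thus a function of the colour.\<close>

lemma colour_eqD:
  assumes eq: "colour L (Inl a) = colour L (Inr i)" and F: "\<And>a i. L a i \<Longrightarrow> F a = F' i"
  shows "F a = F' i"
proof -
  have "case_sum F F' s = case_sum F F' t"
    if "(s, t) \<in> ({(Inl a, Inr i) |a i. L a i} \<union> {(Inr i, Inl a) |a i. L a i})\<^sup>*" for s t
    using that by (induction rule: rtrancl_induct) (auto simp: F)
  moreover have "Inr i \<in> colour L (Inl a)" unfolding eq by (simp add: colour_def)
  ultimately have "case_sum F F' (Inl a) = case_sum F F' (Inr i)" unfolding colour_def by blast
  then show ?thesis by simp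
qed

section \<open>Isomorphisms of coloured rooted forests\<close>

locale rooted_forest =
  fixes V :: "'a set" and P E :: "'a \<Rightarrow> 'a \<Rightarrow> bool" and m :: "'a \<Rightarrow> nat"
  assumes fin: "finite V"
    and unique: "\<And>x y z. x \<in> V \<Longrightarrow> y \<in> V \<Longrightarrow> z \<in> V \<Longrightarrow> P x y \<Longrightarrow> P x z \<Longrightarrow> y = z"
    and measure: "\<And>x y. x \<in> V \<Longrightarrow> y \<in> V \<Longrightarrow> P x y \<Longrightarrow> m y < m x"
    and equivalence: "equivalence_on V E"
    and same_parent: "\<And>x y z. x \<in> V \<Longrightarrow> y \<in> V \<Longrightarrow> z \<in> V \<Longrightarrow> E x z \<Longrightarrow> P x y \<Longrightarrow> P z y"

text \<open>The bijection is built from the roots downwards. Each step preserves colours, which is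
  what the next step requires in order to match children. Injectivity follows by induction, as equal
  images have equal parents, and surjectivity by counting.\<close>

lemma rooted_forest_matching:
  assumes "rooted_forest V P E m" "rooted_forest V' P' E' m'" and card: "card V = card V'"
    and roots: "\<exists>\<phi>. bij_betw \<phi> {x \<in> V. \<forall>y\<in>V. \<not> P x y} {i \<in> V'. \<forall>j\<in>V'. \<not> P' i j} \<and>
      (\<forall>x\<in>{x \<in> V. \<forall>y\<in>V. \<not> P x y}. \<forall>z\<in>{x \<in> V. \<forall>y\<in>V. \<not> P x y}.
        (E x z \<longleftrightarrow> E' (\<phi> x) (\<phi> z)) \<and> \<kappa> x = \<kappa>' (\<phi> x))"
    and children: "\<And>y j. y \<in> V \<Longrightarrow> j \<in> V' \<Longrightarrow> \<kappa> y = \<kappa>' j \<Longrightarrow>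
      \<exists>\<phi>. bij_betw \<phi> {x \<in> V. P x y} {i \<in> V'. P' i j} \<and>
        (\<forall>x\<in>{x \<in> V. P x y}. \<forall>z\<in>{x \<in> V. P x y}. (E x z \<longleftrightarrow> E' (\<phi> x) (\<phi> z)) \<and> \<kappa> x = \<kappa>' (\<phi> x))"
  shows "\<exists>f. bij_betw f V V' \<and> (\<forall>x\<in>V. \<kappa> x = \<kappa>' (f x)) \<and>
    (\<forall>x\<in>V. \<forall>y\<in>V. (E x y \<longleftrightarrow> E' (f x) (f y)) \<and> (P x y \<longleftrightarrow> P' (f x) (f y)))"
proof -
  interpret F: rooted_forest V P E m by fact
  interpret F': rooted_forest V' P' E' m' by fact
  define root where "root x \<longleftrightarrow> (\<forall>y\<in>V. \<not> P x y)" for x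
  define root' where "root' i \<longleftrightarrow> (\<forall>j\<in>V'. \<not> P' i j)" for i
  define good where "good T T' \<phi> \<longleftrightarrow> bij_betw \<phi> T T' \<and>
    (\<forall>x\<in>T. \<forall>z\<in>T. (E x z \<longleftrightarrow> E' (\<phi> x) (\<phi> z)) \<and> \<kappa> x = \<kappa>' (\<phi> x))" for T T' \<phi>
  have good: "bij_betw \<phi> T T'" "\<And>x z. x \<in> T \<Longrightarrow> z \<in> T \<Longrightarrow> E x z \<longleftrightarrow> E' (\<phi> x) (\<phi> z)"
    "\<And>x. x \<in> T \<Longrightarrow> \<kappa> x = \<kappa>' (\<phi> x)" if "good T T' \<phi>" for T T' \<phi>
    using that unfolding good_def by blast+
  from roots obtain \<phi> where "good {x \<in> V. root x} {i \<in> V'. root' i} \<phi>"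
    unfolding root_def root'_def good_def by (elim exE)
  note \<phi> = good[OF this, simplified mem_Collect_eq]
  \<comment> \<open>A matching of children is fixed for every parent and every possible image of it,
    since the actual image is known only during the recursion.\<close>
  define \<Phi> where "\<Phi> y j = (SOME \<phi>. good {x \<in> V. P x y} {i \<in> V'. P' i j} \<phi>)" for y j
  have "good {x \<in> V. P x y} {i \<in> V'. P' i j} (\<Phi> y j)" if "y \<in> V" "j \<in> V'" "\<kappa> y = \<kappa>' j" for y j
    unfolding \<Phi>_def
  proof (rule someI_ex[of "good {x \<in> V. P x y} {i \<in> V'. P' i j}"])
    show "\<exists>\<phi>. good {x \<in> V. P x y} {i \<in> V'. P' i j} \<phi>" using children[OF that] unfolding good_def .
  qed
  note \<Phi> = good[OF this, simplified mem_Collect_eq]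
  define p where "p x = (THE y. y \<in> V \<and> P x y)" for x
  have p: "p x = y" if "x \<in> V" "y \<in> V" "P x y" for x y
    unfolding p_def using that F.unique by (intro the_equality) auto
  define f where "f = wfrec (Wellfounded.measure m)
    (\<lambda>g x. if x \<in> V \<and> \<not> root x then \<Phi> (p x) (g (p x)) x else \<phi> x)"
  have f_unfold: "f x = (if x \<in> V \<and> \<not> root x then \<Phi> (p x) (cut f (Wellfounded.measure m) x (p x)) x else \<phi> x)" for x
    unfolding f_def by (subst wfrec) auto
  have f_root: "f x = \<phi> x" if "root x" for x using that by (simp add: f_unfold)
  have f_child: "f x = \<Phi> y (f y) x" if xy: "x \<in> V" "y \<in> V" "P x y" for x y
    using f_unfold[of x] xy p[OF xy] F.measure[OF xy] by (auto simp: root_def cut_def)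
  have main: "f x \<in> V' \<and> \<kappa> x = \<kappa>' (f x)" if "x \<in> V" for x
    using that
  proof (induction "m x" arbitrary: x rule: less_induct)
    case (less x)
    show ?case
    proof (cases "root x")
      case True
      then show ?thesis using \<phi>(3)[of x] bij_betwE[OF \<phi>(1)] less.prems f_root by auto
    next
      case False
      then obtain y where y: "y \<in> V" "P x y" by (auto simp: root_def)
      then have fy: "f y \<in> V'" "\<kappa> y = \<kappa>' (f y)" using less F.measure by auto
      show ?thesis
        using \<Phi>(3)[OF y(1) fy, of x] bij_betwE[OF \<Phi>(1)[OF y(1) fy]] less.prems y f_child[OF less.prems y] by auto
    qed
  qed
  have root_f: "root' (f x)" if "x \<in> V" "root x" for x
    using bij_betwE[OF \<phi>(1)] that f_root by auto
  have P_f: "P' (f x) (f y)" if "x \<in> V" "y \<in> V" "P x y" for x y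
    using bij_betwE[OF \<Phi>(1)[OF that(2), of "f y"]] main[OF that(2)] that f_child[OF that] by auto
  have f_eqD: "x = z" if "x \<in> V" "z \<in> V" "f x = f z" for x z
    using that
  proof (induction "m x" arbitrary: x z rule: less_induct)
    case (less x z)
    show ?case
    proof (cases "root x")
      case True
      have "root z"
      proof (rule ccontr)
        assume "\<not> root z"
        then obtain w where "w \<in> V" "P z w" by (auto simp: root_def)
        then show False using P_f[of z w] main[of w] root_f[OF _ True] less.prems by (auto simp: root'_def)
      qed
      then show ?thesis
        using True \<phi>(1) less.prems f_root by (auto simp: bij_betw_def inj_on_def)
    next
      case False
      then obtain y where y: "y \<in> V" "P x y" by (auto simp: root_def)
      have "\<not> root z" using root_f[of z] P_f[OF less.prems(1) y] main[OF y(1)] less.prems by (auto simp: root'_def)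
      then obtain w where w: "w \<in> V" "P z w" by (auto simp: root_def)
      have "f y = f w"
        using F'.unique[of "f x" "f y" "f w"] P_f[OF less.prems(1) y] P_f[OF less.prems(2) w] main less.prems y w by auto
      then have "y = w" using less.hyps[OF F.measure[OF less.prems(1) y] y(1) w(1)] by simp
      then show ?thesis
        using \<Phi>(1)[OF y(1)] main[OF y(1)] less.prems y w f_child[OF less.prems(1) y] f_child[OF less.prems(2) w]
        by (auto simp: bij_betw_def inj_on_def)
    qed
  qed
  then have inj: "inj_on f V" by (auto simp: inj_on_def)
  have "f ` V = V'"
    using main card_image[OF inj] card F'.fin by (intro card_subset_eq) auto
  then have bij: "bij_betw f V V'" using inj by (simp add: bij_betw_def)
  have P_iff: "P x y \<longleftrightarrow> P' (f x) (f y)" if xy: "x \<in> V" "y \<in> V" for x y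
  proof
    assume *: "P' (f x) (f y)"
    then have "\<not> root x" using root_f xy main by (auto simp: root'_def)
    then obtain w where w: "w \<in> V" "P x w" by (auto simp: root_def)
    then have "f w = f y" using F'.unique[OF _ _ _ P_f[OF xy(1) w] *] main xy by auto
    then show "P x y" using w f_eqD xy by blast
  qed (use P_f xy in blast)
  have E_iff: "E x z \<longleftrightarrow> E' (f x) (f z)" if xz: "x \<in> V" "z \<in> V" for x z
  proof (cases "root x")
    case True
    show ?thesis
    proof (cases "root z")
      case True
      then show ?thesis using \<open>root x\<close> \<phi>(2)[of x z] xz True f_root by simp
    next
      case False
      then obtain w where w: "w \<in> V" "P z w" by (auto simp: root_def)
      have "\<not> E x z" using F.same_parent[OF xz(2) w(1) xz(1) _ w(2)] equivalence_onD(2)[OF F.equivalence xz] True w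
        by (auto simp: root_def)
      moreover have "\<not> E' (f x) (f z)"
      proof
        assume e: "E' (f x) (f z)"
        have "P' (f x) (f w)"
          using F'.same_parent[of "f z" "f w" "f x"] P_f[OF xz(2) w] main xz w equivalence_onD(2)[OF F'.equivalence _ _ e]
          by blast
        then show False using root_f[OF xz(1) True] main[OF w(1)] by (auto simp: root'_def)
      qed
      ultimately show ?thesis by simp
    qed
  next
    case False
    then obtain y where y: "y \<in> V" "P x y" by (auto simp: root_def)
    show ?thesis
    proof (cases "P z y")
      case True
      then show ?thesis using \<Phi>(2)[OF y(1), of "f y" x z] True main[OF y(1)] y f_child xz by simp
    next
      case F: False
      then have "\<not> E x z" using F.same_parent[OF xz(1) y(1) xz(2) _ y(2)] by blast
      moreover have "\<not> E' (f x) (f z)"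
        using F'.same_parent[of "f x" "f y" "f z"] P_f[OF xz(1) y] main xz y F P_iff by blast
      ultimately show ?thesis by simp
    qed
  qed
  show ?thesis using bij main P_iff E_iff by blast
qed

section \<open>Structure of a smallest pair\<close>

text \<open>Representatives on natural numbers allow graphs with different vertex types to have
  equal classes.\<close>

definition iso_class :: "'a pair_pre_digraph \<Rightarrow> nat pair_pre_digraph set" where
  "iso_class G = {K. isomorphic K G}"

lemma isomorphic_sym: "isomorphic G H \<Longrightarrow> isomorphic H G"
  unfolding isomorphic_def using graph_isomorphism_inv by (elim exE) (rule exI)

lemma isomorphic_trans: "isomorphic G H \<Longrightarrow> isomorphic H K \<Longrightarrow> isomorphic G K"
  unfolding isomorphic_def by (elim exE) (rule exI, erule (1) graph_isomorphism_comp)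

lemma iso_class_eq_iff:
  assumes "pair_graph G"
  shows "iso_class G = iso_class H \<longleftrightarrow> isomorphic G H"
proof
  assume eq: "iso_class G = iso_class H"
  obtain K :: "nat pair_pre_digraph" and f where "graph_isomorphism f K G" using nat_copy[OF assms] .
  then have K: "isomorphic K G" unfolding isomorphic_def by blast
  then have "K \<in> iso_class H" unfolding eq[symmetric] by (simp add: iso_class_def)
  then have "isomorphic K H" by (simp add: iso_class_def)
  then show "isomorphic G H" by (rule isomorphic_trans[OF isomorphic_sym[OF K]])
next
  assume iso: "isomorphic G H"
  show "iso_class G = iso_class H"
    unfolding iso_class_def
    using isomorphic_trans[OF _ iso] isomorphic_trans[OF _ isomorphic_sym[OF iso]] by (intro Collect_cong iffI)
qed

context connected_rel
begin

lemma equivalence_sibling: "equivalence_on V sib"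
  unfolding equivalence_on_def
proof (intro conjI ballI impI)
  show "sib x x" for x by (simp add: sibling_def)
qed (use sibling_sym in blast, rule sibling_trans)

lemma rooted_forest_parent: "\<exists>m. rooted_forest V par sib m"
proof -
  define p where "p x = (SOME y. y \<in> V \<and> par x y)" for x
  have p: "p x = y" if "x \<in> V" "y \<in> V" "par x y" for x y
  proof -
    have "p x \<in> V \<and> par x (p x)" unfolding p_def by (rule someI[of _ y]) (use that in simp)
    then show ?thesis using parent_unique[OF that(1) _ that(2) _ that(3)] by blast
  qed
  \<comment> \<open>The successor keeps the measure positive at every vertex with a parent, so that
    a vertex without one can have measure zero.\<close>
  define m where "m x = (if \<exists>y\<in>V. par x y then Suc (card V) - card (behind V R (p x) x) else 0)" for x
  have le: "card (behind V R y x) \<le> card V" for x y using card_mono[OF finV behind_subset] .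
  have mp: "m x = Suc (card V) - card (behind V R y x)" if xy: "x \<in> V" "y \<in> V" "par x y" for x y
  proof -
    have "\<exists>y\<in>V. par x y" using xy by blast
    then show ?thesis unfolding m_def p[OF xy] by (rule if_P)
  qed
  have less: "m y < m x" if xy: "x \<in> V" "y \<in> V" "par x y" for x y
  proof (cases "\<exists>w\<in>V. par y w")
    case True
    then obtain w where w: "w \<in> V" "par y w" by blast
    show ?thesis
      using mp[OF xy] mp[OF xy(2) w] parent_parent_card[OF xy(1,2) w(1) xy(3) w(2)] le[of w y] by linarith
  next
    case False
    then have "m y = 0" unfolding m_def by (rule if_not_P)
    then show ?thesis using mp[OF xy] le[of y x] by simp
  qed
  have "rooted_forest V par sib m"
  proof (rule rooted_forest.intro)
    show "y = z" if "x \<in> V" "y \<in> V" "z \<in> V" "par x y" "par x z" for x y z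
      using parent_unique[OF that] .
    show "par z y" if "x \<in> V" "y \<in> V" "z \<in> V" "sib x z" "par x y" for x y z
      using sibling_parent[OF that] .
  qed (fact finV, erule (2) less, fact equivalence_sibling)
  then show ?thesis by blast
qed

lemma hood_bond:
  assumes "a \<in> V" "x \<in> hood V R a" "y \<in> hood V R a" "x \<noteq> y"
  shows "bond x y"
proof -
  have v: "x \<in> V" "y \<in> V" and xy: "sib a x \<or> par a x" "sib a y \<or> par a y" using assms by (auto simp: hood_def)
  consider "sib a x" "sib a y" | "sib a x" "par a y" | "par a x" "sib a y" | "par a x" "par a y" using xy by blast
  then show ?thesis
  proof cases
    case 1
    have "sib x a" using 1(1) sibling_sym[of x a] by simp
    then show ?thesis using sibling_trans[OF v(1) assms(1) v(2) _ 1(2)] sibling_bond[of x y] assms(4) by simp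
  next
    case 2
    then show ?thesis using sibling_parent[OF assms(1) v(2,1)] parentD by simp
  next
    case 3
    then show ?thesis using sibling_parent[OF assms(1) v] parentD[of y x] bond_sym[of x y] by simp
  next
    case 4
    then show ?thesis using parent_unique[OF assms(1) v] assms(4) by simp
  qed
qed

end

section \<open>Intertwined invariants of the two graphs\<close>

context quantum_iso
begin

lemma intertwined_map2:
  "\<lbrakk>intertwined T T'; intertwined S S'\<rbrakk> \<Longrightarrow>
    intertwined (\<lambda>a b. \<phi> (T a b) (S a b)) (\<lambda>i j. \<phi> (T' i j) (S' i j))"
  unfolding intertwined_def by simp

lemma quantum_isomorphism_of_intertwined:
  assumes v: "pverts G' = pverts G" "pverts H' = pverts H"
    and adj: "intertwined (\<lambda>a b. (a, b) \<in> parcs G') (\<lambda>i j. (i, j) \<in> parcs H')"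
  shows "quantum_isomorphism A G' H' U"
proof -
  have "(\<Oplus>a\<in>pverts G. adjacency G' a b \<odot> U i a) = (\<Oplus>k\<in>pverts H. adjacency H' i k \<odot> U k b)"
    if ib: "i \<in> pverts H" "b \<in> pverts G" for i b
  proof (rule finsum_eq_of_support[OF fin, where w = "\<lambda>k a. U i a \<otimes> U k b"])
    fix k a assume ka: "k \<in> pverts H" "a \<in> pverts G" "U i a \<otimes> U k b \<noteq> \<zero>"
    show "adjacency G' a b = adjacency H' i k"
      using intertwinedD[OF adj ka(3) ib(1) ka(1,2) ib(2)] by (simp add: adjacency_def)
  qed (use U ib col_expand(1) row_expand(2) in auto)
  then show ?thesis using quantum_isomorphism by (simp add: quantum_isomorphism_def v)
qed

lemma quantum_isomorphic_complement: "quantum_isomorphic (complement_graph G) (complement_graph H)"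
proof (rule quantum_isomorphicI[OF _ one_neq_zero])
  show "unital_cstar_algebra A" ..
  have "intertwined (\<lambda>a b. a \<noteq> b \<and> (a, b) \<notin> parcs G) (\<lambda>i j. i \<noteq> j \<and> (i, j) \<notin> parcs H)"
    by (rule intertwined_map2[OF intertwined_eq intertwined_adjacent, where \<phi> = "\<lambda>e r. \<not> e \<and> \<not> r"])
  then have "intertwined (\<lambda>a b. (a, b) \<in> parcs (complement_graph G)) (\<lambda>i j. (i, j) \<in> parcs (complement_graph H))"
    by (simp add: intertwined_def complement_graph_def)
  then show "quantum_isomorphism A (complement_graph G) (complement_graph H) U"
    by (rule quantum_isomorphism_of_intertwined[rotated 2]) (simp_all add: complement_graph_def)
qed

abbreviation "WG \<equiv> walk_series (pverts G) (parcs G)"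
abbreviation "WH \<equiv> walk_series (pverts H) (parcs H)"

lemma intertwined_walk_series: "intertwined WG WH"
proof -
  have "intertwined (walk_count (pverts G) (parcs G) m) (walk_count (pverts H) (parcs H) m)" for m
  proof (induction m)
    case 0
    show ?case
      using intertwined_map2[OF intertwined_eq intertwined_eq, of "\<lambda>e _. if e then 1 else 0 :: nat"]
      by (simp add: intertwined_def)
  next
    case (Suc m)
    show ?case
      using intertwined_sum[OF intertwined_eq intertwined_adjacent Suc, of "\<lambda>_ r w. if r then w else 0"]
      by (simp add: intertwined_def)
  qed
  then show ?thesis unfolding intertwined_def walk_series_def by simp
qed

lemma intertwined_reachable:
  assumes "pair_graph G" "pair_graph H"
  shows "intertwined (\<lambda>a b. (a, b) \<in> (parcs G)\<^sup>*) (\<lambda>i j. (i, j) \<in> (parcs H)\<^sup>*)"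
  using intertwined_map2[OF intertwined_walk_series intertwined_eq, of "\<lambda>w _. w \<noteq> 0"]
    walk_series_neq_0_iff[OF fin(1) parcs_subset[OF assms(1)]] walk_series_neq_0_iff[OF fin(2) parcs_subset[OF assms(2)]]
  by simp

lemma pair_graph_reachable_equivalence:
  assumes "pair_graph K"
  shows "equivalence_on (pverts K) (\<lambda>a b. (a, b) \<in> (parcs K)\<^sup>*)"
  unfolding equivalence_on_def
  by (intro conjI ballI impI)
    (rule rtrancl_refl, erule symD[OF sym_rtrancl[OF sym_parcs[OF assms]]], erule (1) rtrancl_trans)

text \<open>Separation relates three vertices; counting over the third makes it binary. Being bonded
  means that the number of separating vertices other than the endpoints is zero.\<close>

lemma
  assumes "pair_graph G" "pair_graph H"
  shows intertwined_card_behind: "intertwined (\<lambda>a b. card (behind (pverts G) (parcs G) a b)) (\<lambda>i j. card (behind (pverts H) (parcs H) i j))"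
    and intertwined_bonded: "intertwined (bonded (pverts G) (parcs G)) (bonded (pverts H) (parcs H))"
proof -
  note W = intertwined_walk_series
  \<comment> \<open>The factor of closed walks depends on one vertex only; read as a function of the
    second argument it can be paired with the other series.\<close>
  have diag: "intertwined (\<lambda>a b. WG b b) (\<lambda>i j. WH j j)"
    by (rule intertwined_snd) (rule intertwined_diag[OF W])
  have sepG: "separates (parcs G) c x y \<longleftrightarrow> WG x y * WG c c = WG x c * WG c y" if "c \<in> pverts G" for c x y
    using separates_iff_walk_series[OF fin(1) that parcs_subset[OF assms(1)]] .
  have sepH: "separates (parcs H) c x y \<longleftrightarrow> WH x y * WH c c = WH x c * WH c y" if "c \<in> pverts H" for c x y
    using separates_iff_walk_series[OF fin(2) that parcs_subset[OF assms(2)]] .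
  have behindG: "behind (pverts G) (parcs G) a b = {c \<in> pverts G. WG a c * WG b b = WG a b * WG b c}"
    if "b \<in> pverts G" for a b unfolding behind_def sepG[OF that] ..
  have behindH: "behind (pverts H) (parcs H) a b = {c \<in> pverts H. WH a c * WH b b = WH a b * WH b c}"
    if "b \<in> pverts H" for a b unfolding behind_def sepH[OF that] ..
  show "intertwined (\<lambda>a b. card (behind (pverts G) (parcs G) a b)) (\<lambda>i j. card (behind (pverts H) (parcs H) i j))"
    using intertwined_card[OF intertwined_map2[OF W diag, of Pair] W intertwined_converse[OF W],
        of "\<lambda>r t s. t * snd r = fst r * s"]
    unfolding intertwined_def fst_conv snd_conv by (intro ballI impI) (simp only: behindG behindH, blast)
  have bondG: "bonded (pverts G) (parcs G) a b \<longleftrightarrow> a \<noteq> b \<and>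
      card {c \<in> pverts G. a \<noteq> c \<and> c \<noteq> b \<and> WG a b * WG c c = WG a c * WG c b} = 0" for a b
    using fin(1) sepG[of _ a b] unfolding bonded_def by auto
  have bondH: "bonded (pverts H) (parcs H) a b \<longleftrightarrow> a \<noteq> b \<and>
      card {c \<in> pverts H. a \<noteq> c \<and> c \<noteq> b \<and> WH a b * WH c c = WH a c * WH c b} = 0" for a b
    using fin(2) sepH[of _ a b] unfolding bonded_def by auto
  have "intertwined
     (\<lambda>a b. card {c \<in> pverts G. a \<noteq> c \<and> c \<noteq> b \<and> WG a b * WG c c = WG a c * WG c b})
     (\<lambda>a b. card {c \<in> pverts H. a \<noteq> c \<and> c \<noteq> b \<and> WH a b * WH c c = WH a c * WH c b})"
    using intertwined_card[OF W intertwined_map2[OF intertwined_eq intertwined_map2[OF W diag, of Pair], of Pair]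
        intertwined_map2[OF intertwined_eq W, of Pair],
        of "\<lambda>r t s. \<not> fst t \<and> \<not> fst s \<and> r * snd (snd t) = fst (snd t) * snd s"]
    unfolding fst_conv snd_conv .
  from intertwined_map2[OF intertwined_eq this, of "\<lambda>e n. \<not> e \<and> n = 0"]
  show "intertwined (bonded (pverts G) (parcs G)) (bonded (pverts H) (parcs H))"
    unfolding bondG[abs_def] bondH[abs_def] .
qed

lemma intertwined_parent:
  assumes "pair_graph G" "pair_graph H"
  shows "intertwined (parent (pverts G) (parcs G)) (parent (pverts H) (parcs H))"
  using intertwined_map2[OF intertwined_bonded[OF assms] intertwined_card_behind[OF assms],
      of "\<lambda>b n. b \<and> card (pverts G) < 2 * n"]
  by (simp add: intertwined_def parent_def card_eq)

lemma intertwined_sibling: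
  assumes "pair_graph G" "pair_graph H"
  shows "intertwined (sibling (pverts G) (parcs G)) (sibling (pverts H) (parcs H))"
proof -
  note p = intertwined_parent[OF assms]
  have "intertwined (\<lambda>a b. a = b \<or> (bonded (pverts G) (parcs G) a b \<and>
      (\<not> parent (pverts G) (parcs G) a b \<and> \<not> parent (pverts G) (parcs G) b a)))
    (\<lambda>i j. i = j \<or> (bonded (pverts H) (parcs H) i j \<and>
      (\<not> parent (pverts H) (parcs H) i j \<and> \<not> parent (pverts H) (parcs H) j i)))"
    by (intro intertwined_map2[where \<phi> = "(\<or>)"] intertwined_map2[where \<phi> = "(\<and>)"] intertwined_eq
        intertwined_bonded[OF assms]
        intertwined_map2[OF p intertwined_converse[OF p], where \<phi> = "\<lambda>x y. \<not> x \<and> \<not> y"])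
  then show ?thesis by (simp add: intertwined_def sibling_def)
qed

end

lemma card_cong_pred: "(\<And>x. x \<in> S \<Longrightarrow> P x \<longleftrightarrow> Q x) \<Longrightarrow> card {x \<in> S. P x} = card {x \<in> S. Q x}"
  by (rule arg_cong[where f = card]) blast

section \<open>The disconnected case\<close>

context quantum_iso
begin

text \<open>Here the class and the set cut out by \<open>Z\<close> coincide in
  \<open>quantum_isomorphic_class\<close>, so no further vertex arises. Disconnectedness makes the
  component a proper subset.\<close>

lemma component_iso_class_eq:
  assumes G: "pair_graph G" and H: "pair_graph H"
    and small: "\<And>S S'. S \<subset> pverts G \<Longrightarrow> S' \<subseteq> pverts H \<Longrightarrow>
      quantum_isomorphic (induced G S) (induced H S') \<Longrightarrow> isomorphic (induced G S) (induced H S')"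
    and disconnected: "\<not> graph_connected G"
    and ia: "i \<in> pverts H" "a \<in> pverts G" "U i a \<noteq> \<zero>"
  shows "isomorphic (induced G {b \<in> pverts G. (a, b) \<in> (parcs G)\<^sup>*}) (induced H {k \<in> pverts H. (i, k) \<in> (parcs H)\<^sup>*})"
proof (rule small)
  note eG = equivalence_onD[OF pair_graph_reachable_equivalence[OF G]]
    and eH = equivalence_onD[OF pair_graph_reachable_equivalence[OF H]]
  have cls: "(k, l) \<in> (parcs H)\<^sup>* \<longleftrightarrow> (i, l) \<in> (parcs H)\<^sup>*"
    if "k \<in> pverts H" "l \<in> pverts H" "(i, k) \<in> (parcs H)\<^sup>*" for k l
    using eH(2)[OF ia(1) that(1,3)] eH(3)[OF ia(1) that] eH(3)[OF that(1) ia(1) that(2)] by blast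
  show "quantum_isomorphic (induced G {b \<in> pverts G. (a, b) \<in> (parcs G)\<^sup>*})
      (induced H {k \<in> pverts H. (i, k) \<in> (parcs H)\<^sup>*})"
    by (rule quantum_isomorphic_class[OF intertwined_reachable[OF G H] eG(2) _ cls ia(1)
          intertwined_reachable[OF G H] cls _ ia(2,3)]) simp_all
  have "{b \<in> pverts G. (a, b) \<in> (parcs G)\<^sup>*} \<noteq> pverts G"
  proof
    assume eq: "{b \<in> pverts G. (a, b) \<in> (parcs G)\<^sup>*} = pverts G"
    have "(b, c) \<in> (parcs G)\<^sup>*" if "b \<in> pverts G" "c \<in> pverts G" for b c
    proof -
      have "(a, b) \<in> (parcs G)\<^sup>*" "(a, c) \<in> (parcs G)\<^sup>*" using eq that by blast+
      then show ?thesis using eG(2)[OF ia(2) that(1)] eG(3)[OF that(1) ia(2) that(2)] by simp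
    qed
    then show False using disconnected ia(2) unfolding graph_connected_iff[OF G] by blast
  qed
  then show "{b \<in> pverts G. (a, b) \<in> (parcs G)\<^sup>*} \<subset> pverts G" by blast
qed blast

text \<open>Linked vertices lie in isomorphic components, so both graphs have equally many vertices
  of each component type. As no edge leaves a component, isomorphisms of matched components
  glue.\<close>

lemma disconnected_isomorphic:
  assumes G: "pair_graph G" and H: "pair_graph H"
    and small: "\<And>S S'. S \<subset> pverts G \<Longrightarrow> S' \<subseteq> pverts H \<Longrightarrow>
      quantum_isomorphic (induced G S) (induced H S') \<Longrightarrow> isomorphic (induced G S) (induced H S')"
    and disconnected: "\<not> graph_connected G"
  shows "isomorphic G H"
proof -
  let ?E = "\<lambda>a b. (a, b) \<in> (parcs G)\<^sup>*" and ?E' = "\<lambda>i j. (i, j) \<in> (parcs H)\<^sup>*"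
  note eqvG = pair_graph_reachable_equivalence[OF G] and eqvH = pair_graph_reachable_equivalence[OF H]
  note eG = equivalence_onD[OF eqvG] and eH = equivalence_onD[OF eqvH]
  define C where "C a = {b \<in> pverts G. ?E a b}" for a
  define C' where "C' i = {k \<in> pverts H. ?E' i k}" for i
  have C_cong: "C a = C b" if "a \<in> pverts G" "b \<in> pverts G" "?E a b" for a b
    unfolding C_def using eG(3)[OF that(1,2) _ that(3)] eG(3)[OF that(2,1) _ eG(2)[OF that]]
    by (intro Collect_cong conj_cong refl iffI)
  have C'_cong: "C' i = C' j" if "i \<in> pverts H" "j \<in> pverts H" "?E' i j" for i j
    unfolding C'_def using eH(3)[OF that(1,2) _ that(3)] eH(3)[OF that(2,1) _ eH(2)[OF that]]
    by (intro Collect_cong conj_cong refl iffI)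
  have sub: "C a \<subseteq> pverts G" "C' i \<subseteq> pverts H" for a i by (auto simp: C_def C'_def)
  define \<tau> where "\<tau> a = iso_class (induced G (C a))" for a
  define \<tau>' where "\<tau>' i = iso_class (induced H (C' i))" for i
  have \<tau>_iff: "\<tau> a = \<tau>' i \<longleftrightarrow> isomorphic (induced G (C a)) (induced H (C' i))" for a i
    unfolding \<tau>_def \<tau>'_def by (rule iso_class_eq_iff[OF pair_graph_induced[OF G sub(1)]])
  have \<tau>U: "\<tau> a = \<tau>' i" if "i \<in> pverts H" "a \<in> pverts G" "U i a \<noteq> \<zero>" for i a
    unfolding \<tau>_iff C_def C'_def using component_iso_class_eq[OF assms that] .
  have "\<exists>f. bij_betw f (pverts G) (pverts H) \<and> (\<forall>x\<in>pverts G. \<forall>z\<in>pverts G. (?E x z \<longleftrightarrow> ?E' (f x) (f z)) \<and>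
      (?E x z \<longrightarrow> (\<lambda>x z i k. (x, z) \<in> parcs G \<longleftrightarrow> (i, k) \<in> parcs H) x z (f x) (f z)))"
  proof (rule class_matching[OF fin eqvG eqvH])
    show "\<tau> x = \<tau> y" if "x \<in> pverts G" "y \<in> pverts G" "?E x y" for x y
      unfolding \<tau>_def C_cong[OF that] ..
    show "\<tau>' x = \<tau>' y" if "x \<in> pverts H" "y \<in> pverts H" "?E' x y" for x y
      unfolding \<tau>'_def C'_cong[OF that] ..
    show "card {x \<in> pverts G. \<tau> x = t} = card {i \<in> pverts H. \<tau>' i = t}" for t
    proof (rule card_eq_of_invariant)
      show "\<tau> a = t \<longleftrightarrow> \<tau>' i = t" if "i \<in> pverts H" "a \<in> pverts G" "U i a \<noteq> \<zero>" for i a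
        unfolding \<tau>U[OF that] ..
    qed
    fix x i assume xi: "x \<in> pverts G" "i \<in> pverts H" "\<tau> x = \<tau>' i"
    then obtain \<phi> where \<phi>: "graph_isomorphism \<phi> (induced G (C x)) (induced H (C' i))"
      unfolding \<tau>_iff isomorphic_def by blast
    then have b: "bij_betw \<phi> (C x) (C' i)" unfolding graph_isomorphism_def by simp
    have "(z, w) \<in> parcs G \<longleftrightarrow> (\<phi> z, \<phi> w) \<in> parcs H" if "z \<in> C x" "w \<in> C x" for z w
      using \<phi> that bij_betwE[OF b] unfolding graph_isomorphism_def by simp
    then show "\<exists>\<phi>. bij_betw \<phi> {z \<in> pverts G. ?E x z} {k \<in> pverts H. ?E' i k} \<and>
      (\<forall>z\<in>pverts G. \<forall>w\<in>pverts G. ?E x z \<longrightarrow> ?E x w \<longrightarrow> ((z, w) \<in> parcs G \<longleftrightarrow> (\<phi> z, \<phi> w) \<in> parcs H))"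
      using b unfolding C_def C'_def by (intro exI[of _ \<phi>]) simp
  qed
  then obtain f where f: "bij_betw f (pverts G) (pverts H)"
    "\<forall>x\<in>pverts G. \<forall>z\<in>pverts G. (?E x z \<longleftrightarrow> ?E' (f x) (f z)) \<and>
      (?E x z \<longrightarrow> ((x, z) \<in> parcs G \<longleftrightarrow> (f x, f z) \<in> parcs H))" by (elim exE conjE) (erule (1) that)
  have "(x, z) \<in> parcs G \<longleftrightarrow> (f x, f z) \<in> parcs H" if "x \<in> pverts G" "z \<in> pverts G" for x z
  proof (cases "?E x z")
    case True
    then show ?thesis using f(2) that by simp
  next
    case False
    then have "\<not> ?E' (f x) (f z)" using f(2) that by simp
    then show ?thesis using False r_into_rtrancl[of "(x, z)" "parcs G"] r_into_rtrancl[of "(f x, f z)" "parcs H"] by blast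
  qed
  then show ?thesis unfolding isomorphic_def graph_isomorphism_def using f(1) by blast
qed

end

section \<open>The connected case: matching rooted block trees\<close>

locale quantum_iso_connected = quantum_iso A G H U + G: connected_pair_graph G + H: connected_pair_graph H
  for A :: "'x star_algebra" (structure) and G :: "'g pair_pre_digraph" and H :: "'h pair_pre_digraph"
    and U :: "'h \<Rightarrow> 'g \<Rightarrow> 'x"
begin

abbreviation "hoodG \<equiv> hood (pverts G) (parcs G)"
abbreviation "hoodH \<equiv> hood (pverts H) (parcs H)"

lemmas itw_bond = intertwined_bonded[OF G.G H.G]
lemmas itw_parent = intertwined_parent[OF G.G H.G]
lemmas itw_sibling = intertwined_sibling[OF G.G H.G]

text \<open>The siblings form the class, and the parent is the one further vertex.\<close>

lemma quantum_isomorphic_hood: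
  assumes ia: "i \<in> pverts H" "a \<in> pverts G" "U i a \<noteq> \<zero>"
  shows "quantum_isomorphic (induced G (hoodG a)) (induced H (hoodH i))"
proof -
  note eG = equivalence_onD[OF G.equivalence_sibling] and eH = equivalence_onD[OF H.equivalence_sibling]
  have cls: "H.sib k l \<longleftrightarrow> H.sib i l" if "k \<in> pverts H" "l \<in> pverts H" "H.sib i k" for k l
    using eH(2)[OF ia(1) that(1,3)] eH(3)[OF ia(1) that] eH(3)[OF that(1) ia(1) that(2)] by blast
  have par: "H.par k l \<longleftrightarrow> H.par i l" if kl: "k \<in> pverts H" "l \<in> pverts H" "H.sib i k" for k l
    using H.sibling_parent[OF ia(1) kl(2,1,3)] H.sibling_parent[OF kl(1,2) ia(1) eH(2)[OF ia(1) kl(1,3)]] by blast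
  have Z: "intertwined (\<lambda>a b. G.sib a b \<or> G.par a b) (\<lambda>i j. H.sib i j \<or> H.par i j)"
    by (rule intertwined_map2[OF itw_sibling itw_parent])
  have "quantum_isomorphic (induced G {b \<in> pverts G. G.sib a b \<or> G.par a b})
      (induced H {k \<in> pverts H. H.sib i k \<or> H.par i k})"
  proof (rule quantum_isomorphic_class[OF itw_sibling eG(2) eH(1)[OF ia(1)] cls ia(1) Z _ _ ia(2,3) eG(1)[OF ia(2)]])
    fix k l assume kl: "k \<in> pverts H" "l \<in> pverts H"
    show "(H.sib k l \<or> H.par k l) = (H.sib i l \<or> H.par i l)" if "H.sib i k"
      using cls[OF kl that] par[OF kl that] by simp
    assume "H.sib i k \<or> H.par i k" "H.sib i l \<or> H.par i l" "\<not> H.sib i k" "\<not> H.sib i l"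
    then show "k = l" using H.parent_unique[OF ia(1) kl] by simp
  qed
  then show ?thesis by (simp add: hood_def)
qed

definition link :: "'g \<Rightarrow> 'h \<Rightarrow> bool" where
  "link a i \<longleftrightarrow> a \<in> pverts G \<and> i \<in> pverts H \<and> U i a \<noteq> \<zero>"

abbreviation "colG a \<equiv> colour link (Inl a)"
abbreviation "colH i \<equiv> colour link (Inr i)"

text \<open>Two sibling classes with the same histogram can be matched colour by colour, so this is
  the invariant by which the classes themselves are matched.\<close>

definition histG :: "'g \<Rightarrow> ('g + 'h) set \<Rightarrow> nat" where
  "histG a t = card {z \<in> pverts G. G.sib a z \<and> colG z = t}"

definition histH :: "'h \<Rightarrow> ('g + 'h) set \<Rightarrow> nat" where
  "histH i t = card {k \<in> pverts H. H.sib i k \<and> colH k = t}"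

lemma itw_col: "intertwined (\<lambda>a b. colG b) (\<lambda>i j. colH j)"
  by (rule intertwined_snd) (rule colour_eqI, simp add: link_def)

lemma hist_link: "link a i \<Longrightarrow> histG a = histH i"
proof
  fix t assume l: "link a i"
  have "intertwined (\<lambda>a b. G.sib a b \<and> colG b = t) (\<lambda>i j. H.sib i j \<and> colH j = t)"
    by (rule intertwined_map2[OF itw_sibling itw_col, where \<phi> = "\<lambda>s c. s \<and> c = t"])
  from intertwined_diag[OF intertwined_card[OF intertwined_eq this intertwined_eq, of "\<lambda>_ s _. s"]]
  show "histG a t = histH i t" using l by (simp add: link_def histG_def histH_def)
qed

text \<open>The number of children with a given histogram is an invariant of linked vertices, hence
  a function of the colour. Colours therefore need not be refined level by level along the
  tree.\<close>

lemma children_hist_eq: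
  assumes "colG y = colH j"
  shows "card {x \<in> pverts G. G.par x y \<and> histG x = t} = card {i \<in> pverts H. H.par i j \<and> histH i = t}"
proof (rule colour_eqD[OF assms, where F = "\<lambda>y. card {x \<in> pverts G. G.par x y \<and> histG x = t}"
      and F' = "\<lambda>j. card {i \<in> pverts H. H.par i j \<and> histH i = t}"])
  fix y j assume l: "link y j"
  have "intertwined (\<lambda>a b. histG a) (\<lambda>i j. histH i)"
    by (rule intertwined_fst) (rule hist_link, simp add: link_def)
  from intertwined_map2[OF itw_parent this, where \<phi> = "\<lambda>p h. p \<and> h = t"]
  have "intertwined (\<lambda>a b. G.par a b \<and> histG a = t) (\<lambda>i j. H.par i j \<and> histH i = t)" .
  from intertwined_diag[OF intertwined_card[OF intertwined_eq intertwined_eq this, of "\<lambda>_ _ s. s"]]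
  show "card {x \<in> pverts G. G.par x y \<and> histG x = t} = card {i \<in> pverts H. H.par i j \<and> histH i = t}"
    using l by (simp add: link_def)
qed

lemma roots_hist_eq:
  "card {x \<in> pverts G. (\<forall>y\<in>pverts G. \<not> G.par x y) \<and> histG x = t} =
   card {i \<in> pverts H. (\<forall>j\<in>pverts H. \<not> H.par i j) \<and> histH i = t}"
proof (rule card_eq_of_invariant)
  fix i a assume ia: "i \<in> pverts H" "a \<in> pverts G" "U i a \<noteq> \<zero>"
  then have "card {y \<in> pverts G. G.par a y} = card {j \<in> pverts H. H.par i j}"
    using intertwined_diag[OF intertwined_card[OF intertwined_eq itw_parent intertwined_eq, of "\<lambda>_ s _. s"]] by simp
  then have "(\<forall>y\<in>pverts G. \<not> G.par a y) = (\<forall>j\<in>pverts H. \<not> H.par i j)"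
    using fin card_eq_0_iff[of "{y \<in> pverts G. G.par a y}"] card_eq_0_iff[of "{j \<in> pverts H. H.par i j}"] by auto
  moreover have "histG a = histH i" using hist_link ia by (simp add: link_def)
  ultimately show "((\<forall>y\<in>pverts G. \<not> G.par a y) \<and> histG a = t) = ((\<forall>j\<in>pverts H. \<not> H.par i j) \<and> histH i = t)"
    by simp
qed

text \<open>The matching has two levels: sibling classes are paired by their histograms, then the
  vertices of paired classes by their colours. It applies to the set of roots and to the children of
  a vertex, since siblings have the same parents.\<close>

lemma sibling_matching:
  assumes S: "S \<subseteq> pverts G" "S' \<subseteq> pverts H"
    and closed: "\<And>x z. x \<in> S \<Longrightarrow> z \<in> pverts G \<Longrightarrow> G.sib x z \<Longrightarrow> z \<in> S"
    and closed': "\<And>i k. i \<in> S' \<Longrightarrow> k \<in> pverts H \<Longrightarrow> H.sib i k \<Longrightarrow> k \<in> S'"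
    and count: "\<And>t. card {x \<in> S. histG x = t} = card {i \<in> S'. histH i = t}"
  shows "\<exists>\<phi>. bij_betw \<phi> S S' \<and>
    (\<forall>x\<in>S. \<forall>z\<in>S. (G.sib x z \<longleftrightarrow> H.sib (\<phi> x) (\<phi> z)) \<and> colG x = colH (\<phi> x))"
proof -
  note eqvG = equivalence_on_subset[OF G.equivalence_sibling S(1)]
    and eqvH = equivalence_on_subset[OF H.equivalence_sibling S(2)]
  note eG = equivalence_onD[OF G.equivalence_sibling] and eH = equivalence_onD[OF H.equivalence_sibling]
  have fS: "finite S" "finite S'" using S fin finite_subset by blast+
  have clsG: "{z \<in> S. G.sib x z} = {z \<in> pverts G. G.sib x z}" if "x \<in> S" for x
    using closed[OF that] S(1) by blast
  have clsH: "{k \<in> S'. H.sib i k} = {k \<in> pverts H. H.sib i k}" if "i \<in> S'" for i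
    using closed'[OF that] S(2) by blast
  have "\<exists>f. bij_betw f S S' \<and> (\<forall>x\<in>S. \<forall>z\<in>S. (G.sib x z \<longleftrightarrow> H.sib (f x) (f z)) \<and>
      (G.sib x z \<longrightarrow> (\<lambda>x z i k. colG x = colH i) x z (f x) (f z)))"
  proof (rule class_matching[OF fS eqvG eqvH _ _ count])
    show "histG x = histG y" if "x \<in> S" "y \<in> S" "G.sib x y" for x y
    proof
      have v: "x \<in> pverts G" "y \<in> pverts G" using that S by auto
      show "histG x t = histG y t" for t
        unfolding histG_def using eG(3)[OF v _ that(3)] eG(3)[OF v(2,1) _ eG(2)[OF v that(3)]]
        by (intro card_cong_pred conj_cong iffI refl)
    qed
    show "histH x = histH y" if "x \<in> S'" "y \<in> S'" "H.sib x y" for x y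
    proof
      have v: "x \<in> pverts H" "y \<in> pverts H" using that S by auto
      show "histH x t = histH y t" for t
        unfolding histH_def using eH(3)[OF v _ that(3)] eH(3)[OF v(2,1) _ eH(2)[OF v that(3)]]
        by (intro card_cong_pred conj_cong iffI refl)
    qed
    fix x i assume xi: "x \<in> S" "i \<in> S'" "histG x = histH i"
    have "\<exists>f. bij_betw f {z \<in> S. G.sib x z} {k \<in> S'. H.sib i k} \<and> (\<forall>z\<in>{z \<in> S. G.sib x z}. colG z = colH (f z))"
    proof (rule colour_matching)
      fix t
      have "histG x t = histH i t" using xi(3) by simp
      then show "card {z \<in> {z \<in> S. G.sib x z}. colG z = t} = card {k \<in> {k \<in> S'. H.sib i k}. colH k = t}"
        unfolding clsG[OF xi(1)] clsH[OF xi(2)] histG_def histH_def by (simp add: conj_assoc)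
    qed (use fS in auto)
    then show "\<exists>\<phi>. bij_betw \<phi> {z \<in> S. G.sib x z} {k \<in> S'. H.sib i k} \<and>
        (\<forall>z\<in>S. \<forall>w\<in>S. G.sib x z \<longrightarrow> G.sib x w \<longrightarrow> colG z = colH (\<phi> z))"
      by (elim ex_forward) simp
  qed
  then obtain f where "bij_betw f S S'" and f: "\<forall>x\<in>S. \<forall>z\<in>S. (G.sib x z \<longleftrightarrow> H.sib (f x) (f z)) \<and>
      (G.sib x z \<longrightarrow> colG x = colH (f x))" by (elim exE conjE) (erule (1) that)
  moreover have "colG x = colH (f x)" if "x \<in> S" for x using f that equivalence_onD(1)[OF eqvG that] by blast
  ultimately show ?thesis by (intro exI[of _ f]) simp
qed

lemma block_structure_matching:
  "\<exists>f. bij_betw f (pverts G) (pverts H) \<and> (\<forall>x\<in>pverts G. colG x = colH (f x)) \<and>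
    (\<forall>x\<in>pverts G. \<forall>y\<in>pverts G. (G.sib x y \<longleftrightarrow> H.sib (f x) (f y)) \<and> (G.par x y \<longleftrightarrow> H.par (f x) (f y)))"
proof -
  obtain m where m: "rooted_forest (pverts G) G.par G.sib m" using G.rooted_forest_parent by blast
  obtain m' where m': "rooted_forest (pverts H) H.par H.sib m'" using H.rooted_forest_parent by blast
  note eG = equivalence_onD[OF G.equivalence_sibling] and eH = equivalence_onD[OF H.equivalence_sibling]
  show ?thesis
  proof (rule rooted_forest_matching[OF m m' card_eq])
    show "\<exists>\<phi>. bij_betw \<phi> {x \<in> pverts G. \<forall>y\<in>pverts G. \<not> G.par x y} {i \<in> pverts H. \<forall>j\<in>pverts H. \<not> H.par i j} \<and>
      (\<forall>x\<in>{x \<in> pverts G. \<forall>y\<in>pverts G. \<not> G.par x y}. \<forall>z\<in>{x \<in> pverts G. \<forall>y\<in>pverts G. \<not> G.par x y}.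
        (G.sib x z \<longleftrightarrow> H.sib (\<phi> x) (\<phi> z)) \<and> colG x = colH (\<phi> x))"
    proof (rule sibling_matching)
      show "z \<in> {x \<in> pverts G. \<forall>y\<in>pverts G. \<not> G.par x y}"
        if "x \<in> {x \<in> pverts G. \<forall>y\<in>pverts G. \<not> G.par x y}" "z \<in> pverts G" "G.sib x z" for x z
        using that G.sibling_parent[OF that(2) _ _ eG(2)[OF _ that(2,3)]] by blast
      show "z \<in> {x \<in> pverts H. \<forall>y\<in>pverts H. \<not> H.par x y}"
        if "x \<in> {x \<in> pverts H. \<forall>y\<in>pverts H. \<not> H.par x y}" "z \<in> pverts H" "H.sib x z" for x z
        using that H.sibling_parent[OF that(2) _ _ eH(2)[OF _ that(2,3)]] by blast
      show "card {x \<in> {x \<in> pverts G. \<forall>y\<in>pverts G. \<not> G.par x y}. histG x = t} =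
          card {i \<in> {i \<in> pverts H. \<forall>j\<in>pverts H. \<not> H.par i j}. histH i = t}" for t
        using roots_hist_eq[of t] by (simp add: conj_assoc)
    qed auto
  next
    fix y j assume yj: "y \<in> pverts G" "j \<in> pverts H" "colG y = colH j"
    show "\<exists>\<phi>. bij_betw \<phi> {x \<in> pverts G. G.par x y} {i \<in> pverts H. H.par i j} \<and>
      (\<forall>x\<in>{x \<in> pverts G. G.par x y}. \<forall>z\<in>{x \<in> pverts G. G.par x y}.
        (G.sib x z \<longleftrightarrow> H.sib (\<phi> x) (\<phi> z)) \<and> colG x = colH (\<phi> x))"
    proof (rule sibling_matching)
      show "z \<in> {x \<in> pverts G. G.par x y}"
        if "x \<in> {x \<in> pverts G. G.par x y}" "z \<in> pverts G" "G.sib x z" for x z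
        using that G.sibling_parent[OF _ yj(1) that(2,3)] by simp
      show "z \<in> {x \<in> pverts H. H.par x j}"
        if "x \<in> {x \<in> pverts H. H.par x j}" "z \<in> pverts H" "H.sib x z" for x z
        using that H.sibling_parent[OF _ yj(2) that(2,3)] by simp
      show "card {x \<in> {x \<in> pverts G. G.par x y}. histG x = t} = card {i \<in> {i \<in> pverts H. H.par i j}. histH i = t}" for t
        using children_hist_eq[OF yj(3), of t] by (simp add: conj_assoc)
    qed auto
  qed
qed

text \<open>The bijection \<open>f\<close> preserves the rooted structure and the colours but
  perhaps no edges. Its blocks still correspond to isomorphic ones, because the isomorphism type of
  the hood agrees on linked vertices and so depends only on the colour.\<close>

lemma same_block_structure:
  assumes two: "2 \<le> card (pverts G)" and not_2conn: "\<not> two_connected G"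
    and small: "\<And>S S'. S \<subset> pverts G \<Longrightarrow> S' \<subseteq> pverts H \<Longrightarrow>
      quantum_isomorphic (induced G S) (induced H S') \<Longrightarrow> isomorphic (induced G S) (induced H S')"
  shows "same_block_structure G H"
proof -
  obtain f where f: "bij_betw f (pverts G) (pverts H)" and col: "\<forall>x\<in>pverts G. colG x = colH (f x)"
    and str: "\<forall>x\<in>pverts G. \<forall>y\<in>pverts G. (G.sib x y \<longleftrightarrow> H.sib (f x) (f y)) \<and> (G.par x y \<longleftrightarrow> H.par (f x) (f y))"
    using block_structure_matching by (elim exE conjE) (erule (2) that)
  have fV: "f x \<in> pverts H" if "x \<in> pverts G" for x using bij_betwE[OF f] that by blast
  have sub: "hoodG a \<subseteq> pverts G" "hoodH i \<subseteq> pverts H" for a i by (auto simp: hood_def)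
  have hood_iso: "isomorphic (induced G (hoodG a)) (induced H (hoodH i))" if l: "link a i" for a i
  proof (rule small)
    have ia: "i \<in> pverts H" "a \<in> pverts G" "U i a \<noteq> \<zero>" using l by (simp_all add: link_def)
    show "quantum_isomorphic (induced G (hoodG a)) (induced H (hoodH i))" by (rule quantum_isomorphic_hood[OF ia])
    have "hoodG a \<noteq> pverts G"
    proof
      assume "hoodG a = pverts G"
      then have "\<forall>x\<in>pverts G. \<forall>y\<in>pverts G. x \<noteq> y \<longrightarrow> G.bond x y" using G.hood_bond[OF ia(2)] by simp
      then show False using not_2conn G.two_connected_iff_bond[OF two] by simp
    qed
    then show "hoodG a \<subset> pverts G" using sub by blast
  qed (fact sub(2))
  have col_iso: "isomorphic (induced G (hoodG a)) (induced H (hoodH i))" if "colG a = colH i" for a i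
  proof -
    have "iso_class (induced G (hoodG a)) = iso_class (induced H (hoodH i))"
      by (rule colour_eqD[OF that, where F = "\<lambda>a. iso_class (induced G (hoodG a))"
            and F' = "\<lambda>i. iso_class (induced H (hoodH i))"])
        (simp only: iso_class_eq_iff[OF pair_graph_induced[OF G.G sub(1)]] hood_iso)
    then show ?thesis by (simp only: iso_class_eq_iff[OF pair_graph_induced[OF G.G sub(1)]])
  qed
  have f_eq: "f x = f y \<longleftrightarrow> x = y" if "x \<in> pverts G" "y \<in> pverts G" for x y
    using f that by (auto simp: bij_betw_def inj_on_eq_iff)
  have image_hood: "f ` hoodG a = hoodH (f a)" if a: "a \<in> pverts G" for a
  proof
    show "f ` hoodG a \<subseteq> hoodH (f a)" using str a fV by (auto simp: hood_def)
    show "hoodH (f a) \<subseteq> f ` hoodG a"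
    proof
      fix i assume i: "i \<in> hoodH (f a)"
      then have "i \<in> f ` pverts G" using sub(2) f by (auto simp: bij_betw_def)
      then obtain x where x: "x \<in> pverts G" "i = f x" by blast
      then have "x \<in> hoodG a" using i str a by (simp add: hood_def)
      then show "i \<in> f ` hoodG a" using x by blast
    qed
  qed
  show ?thesis
  proof (rule same_block_structureI[OF G.connected_pair_graph_axioms H.connected_pair_graph_axioms two _ f])
    show "2 \<le> card (pverts H)" using two card_eq by simp
    show "G.bond x y \<longleftrightarrow> H.bond (f x) (f y)" if "x \<in> pverts G" "y \<in> pverts G" for x y
      unfolding G.bond_iff[of x y] H.bond_iff[of "f x" "f y"] using str f_eq that by simp
    fix x y assume xy: "x \<in> pverts G" "y \<in> pverts G" "G.bond x y"
    \<comment> \<open>The block is represented by a vertex that is not its root vertex, so the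
      colour of this one vertex decides its isomorphism type.\<close>
    obtain a where a: "a \<in> pverts G" "G.bset x y = hoodG a" using G.block_set_eq_hood[OF xy] .
    show "isomorphic (induced G (G.bset x y)) (induced H (f ` G.bset x y))"
      unfolding a(2) image_hood[OF a(1)] using col_iso col a(1) by simp
  qed
qed

lemma two_connected_transfer:
  assumes "2 \<le> card (pverts G)" "two_connected G"
  shows "two_connected H"
proof -
  have "H.bond i j" if ij: "i \<in> pverts H" "j \<in> pverts H" "i \<noteq> j" for i j
  proof -
    obtain a b where ab: "a \<in> pverts G" "b \<in> pverts G" "U i a \<otimes> U j b \<noteq> \<zero>"
      using row_pair_neq_zero[OF ij(1,2)] by blast
    have "a \<noteq> b" using intertwinedD[OF intertwined_eq ab(3) ij(1,2) ab(1,2)] ij(3) by simp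
    then have "G.bond a b" using assms G.two_connected_iff_bond ab by simp
    then show ?thesis using intertwinedD[OF itw_bond ab(3) ij(1,2) ab(1,2)] by simp
  qed
  then show ?thesis using H.two_connected_iff_bond assms(1) card_eq by simp
qed

end

section \<open>Minimality and the conclusion\<close>

lemma isomorphic_of_card_le_1:
  assumes "pair_graph G" "pair_graph H" "card (pverts G) \<le> 1" "card (pverts H) = card (pverts G)"
  shows "isomorphic G H"
proof -
  interpret G: pair_graph G by fact
  interpret H: pair_graph H by fact
  obtain f where f: "bij_betw f (pverts G) (pverts H)"
    using finite_same_card_bij[OF G.pair_finite_verts H.pair_finite_verts] assms(4) by metis
  have "u = v" if "u \<in> pverts G" "v \<in> pverts G" for u v
    using assms(3) card_le_Suc0_iff_eq[OF G.pair_finite_verts] that by simp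
  then have "(u, v) \<in> parcs G \<longleftrightarrow> (f u, f v) \<in> parcs H" if "u \<in> pverts G" "v \<in> pverts G" for u v
    using G.no_loops'[of u] H.no_loops'[of "f u"] that by metis
  then show ?thesis using f unfolding isomorphic_def graph_isomorphism_def by blast
qed

lemma quantum_isomorphicE:
  fixes G :: "'g pair_pre_digraph" and H :: "'h pair_pre_digraph"
  assumes "quantum_isomorphic G H"
  obtains A :: "real star_algebra" and U where "quantum_iso A G H U"
  using assms unfolding quantum_isomorphic_def quantum_iso_def quantum_iso_axioms_def by blast

text \<open>A proper induced subgraph of \<open>G\<close> has fewer than \<open>n\<close> vertices,
  so minimality turns quantum isomorphism into isomorphism there; this is the hypothesis
  \<open>small\<close> of the disconnected and of the block case. The statement holds for any pair
  of order \<open>n\<close>, hence also for the complements.\<close>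

lemma smallest_pair_structure:
  assumes n: "smallest_quantum_pair_order n" and G: "pair_graph G" and H: "pair_graph H"
    and card: "card (pverts G) = n" "card (pverts H) = n" and q: "quantum_isomorphic G H"
  shows "isomorphic G H
    \<or> graph_connected G \<and> graph_connected H \<and> same_block_structure G H
    \<or> two_connected G \<and> two_connected H"
proof (cases "isomorphic G H")
  case False
  obtain A :: "real star_algebra" and U where "quantum_iso A G H U" using quantum_isomorphicE[OF q] .
  then interpret quantum_iso A G H U .
  have small: "isomorphic (induced G S) (induced H S')"
    if S: "S \<subset> pverts G" "S' \<subseteq> pverts H" "quantum_isomorphic (induced G S) (induced H S')" for S S'
  proof (rule ccontr)
    assume ni: "\<not> ?thesis"
    have "S \<subseteq> pverts G" using S(1) by blast
    then have "n \<le> card (pverts (induced G S))"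
      using smallest_quantum_pair_le[OF n pair_graph_induced[OF G] pair_graph_induced[OF H S(2)] S(3) ni] by simp
    moreover have "card S < card (pverts G)" using fin(1) S(1) by (rule psubset_card_mono)
    ultimately show False using card by simp
  qed
  have Gc: "graph_connected G"
  proof (rule ccontr)
    assume "\<not> graph_connected G"
    from disconnected_isomorphic[OF G H small this] False show False by contradiction
  qed
  have two: "2 \<le> card (pverts G)"
  proof (rule ccontr)
    assume "\<not> 2 \<le> card (pverts G)"
    then have "card (pverts G) \<le> 1" by simp
    from isomorphic_of_card_le_1[OF G H this] False card show False by simp
  qed
  have "(i, j) \<in> (parcs H)\<^sup>*" if ij: "i \<in> pverts H" "j \<in> pverts H" for i j
  proof -
    obtain a b where ab: "a \<in> pverts G" "b \<in> pverts G" "U i a \<otimes>\<^bsub>A\<^esub> U j b \<noteq> \<zero>\<^bsub>A\<^esub>"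
      using row_pair_neq_zero[OF ij] by blast
    then show ?thesis
      using intertwinedD[OF intertwined_reachable[OF G H] ab(3) ij ab(1,2)] Gc
      unfolding graph_connected_iff[OF G] by simp
  qed
  moreover have "pverts H \<noteq> {}" using two card by auto
  ultimately have Hc: "graph_connected H" unfolding graph_connected_iff[OF H] by simp
  interpret quantum_iso_connected A G H U
    by (intro quantum_iso_connected.intro quantum_iso_axioms connected_pair_graph.intro G H Gc Hc)
  show ?thesis
  proof (cases "two_connected G")
    case True
    then show ?thesis using two_connected_transfer[OF two] by simp
  next
    case F: False
    then show ?thesis using same_block_structure[OF two F small] Gc Hc by simp
  qed
qed simp

lemma pair_graph_complement:
  assumes "pair_graph G"
  shows "pair_graph (complement_graph G)"
proof -
  interpret G: pair_graph G by fact
  have "finite (parcs (complement_graph G))"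
    using finite_subset[of "parcs (complement_graph G)" "pverts G \<times> pverts G"] G.pair_finite_verts
    by (auto simp: complement_graph_def)
  moreover have "symmetric (with_proj (complement_graph G))"
    using G.arcs_symmetric by (auto simp: symmetric_def sym_def complement_graph_def)
  ultimately show ?thesis
    using G.pair_finite_verts by unfold_locales (auto simp: complement_graph_def)
qed

theorem corollary5p7:
  fixes n :: nat
    and G :: "'a pair_pre_digraph"
    and H :: "'b pair_pre_digraph"
  assumes "smallest_quantum_pair_order n"
    and "pair_graph G" and "pair_graph H"
    and "card (pverts G) = n" and "card (pverts H) = n"
    and "quantum_isomorphic G H"
  shows "(isomorphic G H
          \<or> graph_connected G \<and> graph_connected H \<and> same_block_structure G H
          \<or> two_connected G \<and> two_connected H)
       \<and> (isomorphic (complement_graph G) (complement_graph H)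
          \<or> graph_connected (complement_graph G) \<and> graph_connected (complement_graph H) \<and>
            same_block_structure (complement_graph G) (complement_graph H)
          \<or> two_connected (complement_graph G) \<and> two_connected (complement_graph H))"
proof
  show "isomorphic G H
          \<or> graph_connected G \<and> graph_connected H \<and> same_block_structure G H
          \<or> two_connected G \<and> two_connected H"
    using smallest_pair_structure assms .
  obtain A :: "real star_algebra" and U where "quantum_iso A G H U"
    using quantum_isomorphicE[OF assms(6)] .
  then have "quantum_isomorphic (complement_graph G) (complement_graph H)"
    by (rule quantum_iso.quantum_isomorphic_complement)
  then show "isomorphic (complement_graph G) (complement_graph H)
          \<or> graph_connected (complement_graph G) \<and> graph_connected (complement_graph H) \<and>
            same_block_structure (complement_graph G) (complement_graph H)
          \<or> two_connected (complement_graph G) \<and> two_connected (complement_graph H)"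
    using assms by (intro smallest_pair_structure[OF assms(1)] pair_graph_complement)
      (simp_all add: complement_graph_def)
qed

end
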